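(* Let $\{x_n\}_{n\ge0}$ be a sequence with $x_n\in\mathcal{O}_{K_n}$ and $\mathrm{N}_{K_{n+1}/K_n}(x_{n+1})=x_n$ for all $n\ge0$. Then there exists a unique power series $\mathrm{Col}_x(T)\in\mathcal{O}_K[[T]]$ such that $x_n=\mathrm{Col}_x(u_n)$ for all $n\ge0$.
   Context: Let $p\neq 2$ be a prime, $K$ a finite extension of $\mathbf{Q}_p$ with ring of integers $\mathcal{O}_K$, maximal ideal $\mathfrak{m}_K$ and residue field $k$ of cardinality $q$. Let $d$ be a power of $q$ and $P(T)=T^d+a_{d-1}T^{d-1}+\cdots+a_1T$ with $a_i\in\mathfrak{m}_K$ for $1\le i\le d-1$. Let $u_0$ be a uniformizer of $\mathcal{O}_K$ and, for $n\ge 0$, let $u_{n+1}\in\overline{\mathbf{Q}}_p$ be a root of $P(T)=u_n$. Put $K_n=K(u_n)$. *)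

theory Defs
  imports
    Complex_Main
    "HOL-Computational_Algebra.Computational_Algebra"
    "HOL-Algebra.Algebraic_Closure_Type"
    "HOL-Algebra.Generated_Fields"
    "Jordan_Normal_Form.Determinant"
begin

text \<open>
  All fields live inside one ambient type, which plays the role of the algebraic closure of
  \<open>Q_p\<close> and carries its absolute value \<open>nv\<close>. Subfields are subsets of this type; the field
  theory is that of HOL-Algebra, applied to the ring structure of the type.
\<close>

abbreviation amb :: "'a :: field ring"
  where "amb \<equiv> ring_of_type_algebra"

definition Qp :: "('a :: field_char_0 \<Rightarrow> real) \<Rightarrow> 'a set"
  where "Qp nv = {x. \<exists>r :: nat \<Rightarrow> rat. (\<lambda>n. nv (of_rat (r n) - x)) \<longlonglongrightarrow> 0}"

text \<open>
  The type with \<open>nv\<close> is an algebraic closure of \<open>Q_p\<close> with the extension of the \<open>p\<close>-adic absolute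
  value. Here \<open>Q_p\<close> is the completion of the rationals: the closure of the prime field, required
  to be complete. By multiplicativity, \<open>nv_of_int\<close> fixes \<open>nv\<close> on all rationals.
\<close>

locale padic_alg_closure =
  fixes p :: nat and nv :: "'a :: {field_char_0, alg_closed_field} \<Rightarrow> real"
  assumes prime_p: "prime p"
    and nv_nonneg: "nv x \<ge> 0"
    and nv_eq_0_iff: "nv x = 0 \<longleftrightarrow> x = 0"
    and nv_mult: "nv (x * y) = nv x * nv y"
    and nv_add_le_max: "nv (x + y) \<le> max (nv x) (nv y)"
    and nv_of_int: "k \<noteq> 0 \<Longrightarrow> nv (of_int k) = 1 / real p ^ multiplicity (int p) k"
    and Qp_complete: "\<lbrakk>\<And>n. s n \<in> Qp nv; \<And>e. e > 0 \<Longrightarrow> \<exists>N. \<forall>m\<ge>N. \<forall>n\<ge>N. nv (s m - s n) < e\<rbrakk>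
          \<Longrightarrow> \<exists>x \<in> Qp nv. (\<lambda>n. nv (s n - x)) \<longlonglongrightarrow> 0"
    and algebraic_Qp: "(ring.algebraic amb over Qp nv) x"

definition finite_ext :: "'a :: field set \<Rightarrow> 'a set \<Rightarrow> bool"
  where "finite_ext F L \<longleftrightarrow>
    subfield F amb \<and> subfield L amb \<and> F \<subseteq> L \<and> ring.finite_dimension amb F L"

definition int_ring :: "('a :: field \<Rightarrow> real) \<Rightarrow> 'a set \<Rightarrow> 'a ring"
  where "int_ring nv K = amb\<lparr>carrier := {x \<in> K. nv x \<le> 1}\<rparr>"

definition max_ideal :: "('a :: field \<Rightarrow> real) \<Rightarrow> 'a set \<Rightarrow> 'a set"
  where "max_ideal nv K = {x \<in> K. nv x < 1}"

definition uniformizer :: "('a :: field \<Rightarrow> real) \<Rightarrow> 'a set \<Rightarrow> 'a \<Rightarrow> bool"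
  where "uniformizer nv K t \<longleftrightarrow>
    t \<in> carrier (int_ring nv K) \<and> PIdl\<^bsub>int_ring nv K\<^esub> t = max_ideal nv K"

definition residue_field :: "('a :: field \<Rightarrow> real) \<Rightarrow> 'a set \<Rightarrow> 'a set ring"
  where "residue_field nv K = int_ring nv K Quot max_ideal nv K"

definition adjoin :: "'a :: field set \<Rightarrow> 'a \<Rightarrow> 'a set"
  where "adjoin K t = generate_field amb (insert t K)"

text \<open>
  The norm of \<open>x\<close> from \<open>L\<close> down to \<open>F\<close> is the determinant of multiplication by \<open>x\<close> on the
  \<open>F\<close>-vector space \<open>L\<close>; column \<open>j\<close> of \<open>A\<close> holds the coordinates of \<open>x\<close> times the \<open>j\<close>-th basis
  vector. The determinant does not depend on the basis, so the choice is immaterial.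
\<close>

definition mult_matrix :: "'a :: field set \<Rightarrow> 'a set \<Rightarrow> 'a list \<Rightarrow> 'a \<Rightarrow> 'a mat \<Rightarrow> bool"
  where "mult_matrix F L bs x A \<longleftrightarrow>
    set bs \<subseteq> L \<and> ring.independent amb F bs \<and> ring.Span amb F bs = L \<and>
    A \<in> carrier_mat (length bs) (length bs) \<and>
    (\<forall>i<length bs. \<forall>j<length bs. A $$ (i, j) \<in> F) \<and>
    (\<forall>j<length bs. x * bs ! j = (\<Sum>i<length bs. A $$ (i, j) * bs ! i))"

definition field_norm :: "'a :: field set \<Rightarrow> 'a set \<Rightarrow> 'a \<Rightarrow> 'a"
  where "field_norm F L x = (SOME y. \<exists>bs A. mult_matrix F L bs x A \<and> y = det A)"

definition fps_evaluates_to :: "('a :: field \<Rightarrow> real) \<Rightarrow> 'a fps \<Rightarrow> 'a \<Rightarrow> 'a \<Rightarrow> bool"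
  where "fps_evaluates_to nv f z y \<longleftrightarrow> (\<lambda>N. nv ((\<Sum>i<N. fps_nth f i * z ^ i) - y)) \<longlonglongrightarrow> 0"

end

theory Submission
  imports Defs "HOL-Algebra.Sylow"
begin

text \<open>
  Write \<open>\<pi> = u 0\<close>. Each step \<open>K_(n+1) / K_n\<close> is generated by a root of the Eisenstein polynomial
  \<open>P(T) - u_n\<close>, so the norm is the determinant of multiplication in the basis \<open>u_(n+1)^i\<close>, and
  everything is integral in these coordinates. Three facts drive the proof.
  First, since \<open>|u_n|\<close> tends to 1, a power series over the integers of \<open>K\<close> that is small at all \<open>u_n\<close>
  has small coefficients; this gives uniqueness and convergence.
  Second, power series in \<open>T\<close> are free over power series in \<open>P(T)\<close> with the same basis \<open>T^i\<close>, so the norms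
  of the values of a power series at all \<open>u_(n+1)\<close> are again the values of a power series at all \<open>u_n\<close>.
  Third, modulo \<open>\<pi>\<close> the extensions look purely inseparable, so traces vanish modulo \<open>\<pi>\<close>
  and the norm turns a congruence modulo \<open>\<pi>^k\<close> into one modulo \<open>\<pi>^(k+1)\<close>.
  A series matching \<open>x\<close> modulo \<open>\<pi>\<close> exists because the norm of \<open>F(u_(n+1))\<close> is congruent to \<open>F(u_n)\<close>
  modulo \<open>\<pi>\<close>; applying the norm repeatedly yields series matching \<open>x\<close> modulo every \<open>\<pi>^k\<close>.
\<close>

section \<open>Subfields of the ambient field and independence of the norm from the basis\<close>

text \<open>No completeness of the fields \<open>K_n\<close> is used. A series is therefore never
  evaluated exactly along the way: \<open>apx e f z y\<close> says that \<open>y\<close> is a value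
  up to \<open>e\<close>, and partial sums supply such values inside \<open>K_n\<close>.
  Completeness enters only at the end, for coefficients in \<open>K\<close>. The powers
  \<open>u_(n+1)^i\<close> with \<open>i < d\<close> have absolute values that differ modulo the
  value group of \<open>K_n\<close>, so the terms of an expansion cannot cancel; with discreteness
  this makes coordinates of integral elements integral. The gain of one power of \<pi> comes from
  \<open>det (A + s B) = det A + s tr (adj A B) + O(s^2)\<close>: the adjugate of multiplication by
  \<open>z\<close> is multiplication by \<open>N(z) / z\<close>, so the linear term is a trace. The
  congruence between the norm of \<open>F(u_(n+1))\<close> and \<open>F(u_n)\<close> is seen only
  after raising to the power \<open>d\<close>: for \<open>w = F(u_(n+1))\<close> one has
  \<open>w^d = F(u_n)\<close> modulo \<pi>, hence \<open>N(w)^d = F(u_n)^d\<close> modulo \<pi>.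
  Undoing the power leaves the weak bound \<open>|\<pi>|^(1/d)\<close>, which is still below 1; that
  excludes unit coefficients, and non-unit coefficients in \<open>K\<close> are divisible by
  \<pi>.\<close>

lemma amb_simps [simp]:
  "carrier amb = UNIV" "monoid.mult amb = (*)" "monoid.one amb = 1" "ring.zero amb = 0" "ring.add amb = (+)"
  by (simp_all add: ring_of_type_algebra_def)

lemma amb_field: "field (amb :: 'a::field ring)"
  by (rule field_from_type_algebra)

lemma amb_a_inv [simp]: "a_inv amb x = - (x :: 'a :: field)"
proof -
  interpret field "amb :: 'a ring" by (rule amb_field)
  show ?thesis
    by (metis UNIV_I add.inv_equality amb_simps(1,4,5) add.commute neg_eq_iff_add_eq_0 add.right_inverse)
qed

lemma amb_m_inv [simp]: "x \<noteq> 0 \<Longrightarrow> m_inv amb x = inverse (x :: 'a :: field)"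
proof -
  interpret field "amb :: 'a ring" by (rule amb_field)
  show "x \<noteq> 0 \<Longrightarrow> m_inv amb x = inverse x"
    by (metis UNIV_I amb_simps(1-3) comm_inv_char right_inverse)
qed

locale amb_subfield =
  fixes F :: "'a :: field set"
  assumes subfield_F: "subfield F amb"
begin

lemma zero_mem [simp]: "0 \<in> F"
  using subringE(2)[OF subfieldE(1)[OF subfield_F]] by simp

lemma one_mem [simp]: "1 \<in> F"
  using subringE(3)[OF subfieldE(1)[OF subfield_F]] by simp

lemma add_mem [intro]: "x \<in> F \<Longrightarrow> y \<in> F \<Longrightarrow> x + y \<in> F"
  using subringE(7)[OF subfieldE(1)[OF subfield_F], of x y] by simp

lemma mult_mem [intro]: "x \<in> F \<Longrightarrow> y \<in> F \<Longrightarrow> x * y \<in> F"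
  using subringE(6)[OF subfieldE(1)[OF subfield_F], of x y] by simp

lemma minus_mem [intro]: "x \<in> F \<Longrightarrow> - x \<in> F"
  using subringE(5)[OF subfieldE(1)[OF subfield_F], of x] by simp

lemma diff_mem [intro]: "x \<in> F \<Longrightarrow> y \<in> F \<Longrightarrow> x - y \<in> F"
  using add_mem[of x "- y"] minus_mem by simp

lemma inverse_mem [intro]: "x \<in> F \<Longrightarrow> inverse x \<in> F"
proof (cases "x = 0")
  case False
  interpret field "amb :: 'a ring" by (rule amb_field)
  assume "x \<in> F"
  with False show ?thesis using subfield_m_inv(1)[OF subfield_F, of x] by simp
qed simp

lemma divide_mem [intro]: "x \<in> F \<Longrightarrow> y \<in> F \<Longrightarrow> x / y \<in> F"
  unfolding divide_inverse by (intro mult_mem inverse_mem)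

lemma power_mem [intro]: "x \<in> F \<Longrightarrow> x ^ n \<in> F"
  by (induct n) auto

lemma of_nat_mem [simp]: "of_nat n \<in> F"
  by (induct n) auto

lemma sum_mem [intro]: "(\<And>i. i \<in> I \<Longrightarrow> f i \<in> F) \<Longrightarrow> sum f I \<in> F"
  by (induct I rule: infinite_finite_induct) auto

lemma prod_mem [intro]: "(\<And>i. i \<in> I \<Longrightarrow> f i \<in> F) \<Longrightarrow> prod f I \<in> F"
  by (induct I rule: infinite_finite_induct) auto

lemma signof_mem [simp]: "(signof s :: 'a) \<in> F"
  by (auto simp: sign_def)

lemma det_mem: "A \<in> carrier_mat n n \<Longrightarrow> (\<And>i j. i < n \<Longrightarrow> j < n \<Longrightarrow> A $$ (i, j) \<in> F) \<Longrightarrow> det A \<in> F"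
  unfolding det_def' using permutes_in_image[of _ "{0..<n}"]
  by (intro sum_mem mult_mem prod_mem) (auto simp: permutes_in_image)

end

lemma combine_amb:
  "ring.combine amb Ks Us = (\<Sum>i<min (length Ks) (length Us). Ks ! i * Us ! i :: 'a :: field)"
proof -
  interpret field "amb :: 'a ring" by (rule amb_field)
  show ?thesis
    by (induct Ks Us rule: combine.induct) (simp_all add: sum.lessThan_Suc_shift del: sum.lessThan_Suc)
qed

text \<open>Coefficient lists become coefficient functions and finite sums, the form in which matrix
  columns are handled below.\<close>

lemma mem_Span_amb_iff:
  assumes "subfield F amb"
  shows "(y :: 'a :: field) \<in> ring.Span amb F bs \<longleftrightarrow>
    (\<exists>c. (\<forall>i<length bs. c i \<in> F) \<and> y = (\<Sum>i<length bs. c i * bs ! i))"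
proof -
  interpret field "amb :: 'a ring" by (rule amb_field)
  have "y \<in> Span F bs \<longleftrightarrow> (\<exists>Ks. set Ks \<subseteq> F \<and> length Ks = length bs \<and> y = combine Ks bs)"
    using Span_mem_iff_length_version[OF assms, of bs y] by simp
  also have "\<dots> \<longleftrightarrow> (\<exists>c. (\<forall>i<length bs. c i \<in> F) \<and> y = (\<Sum>i<length bs. c i * bs ! i))"
  proof
    assume "\<exists>Ks. set Ks \<subseteq> F \<and> length Ks = length bs \<and> y = combine Ks bs"
    then obtain Ks where "set Ks \<subseteq> F" "length Ks = length bs" "y = combine Ks bs" by blast
    then show "\<exists>c. (\<forall>i<length bs. c i \<in> F) \<and> y = (\<Sum>i<length bs. c i * bs ! i)"
      by (intro exI[of _ "\<lambda>i. Ks ! i"]) (auto simp: combine_amb)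
  next
    assume "\<exists>c. (\<forall>i<length bs. c i \<in> F) \<and> y = (\<Sum>i<length bs. c i * bs ! i)"
    then obtain c where "\<forall>i<length bs. c i \<in> F" "y = (\<Sum>i<length bs. c i * bs ! i)" by blast
    then show "\<exists>Ks. set Ks \<subseteq> F \<and> length Ks = length bs \<and> y = combine Ks bs"
      by (intro exI[of _ "map c [0..<length bs]"]) (auto simp: combine_amb)
  qed
  finally show ?thesis .
qed

lemma independent_amb_iff:
  assumes "subfield F amb"
  shows "ring.independent amb F bs \<longleftrightarrow>
    (\<forall>c. (\<forall>i<length bs. c i \<in> F) \<and> (\<Sum>i<length bs. c i * bs ! i :: 'a :: field) = 0 \<longrightarrow> (\<forall>i<length bs. c i = 0))"
    (is "_ \<longleftrightarrow> ?R")
proof -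
  interpret field "amb :: 'a ring" by (rule amb_field)
  show ?thesis
  proof
    assume ind: "independent F bs"
    show ?R
    proof (intro allI impI)
      fix c i
      assume c: "(\<forall>i<length bs. c i \<in> F) \<and> (\<Sum>i<length bs. c i * bs ! i) = 0" and i: "i < length bs"
      have "set (take (length bs) (map c [0..<length bs])) \<subseteq> {0}"
        using c by (intro independent_imp_trivial_combine[OF assms ind, unfolded amb_simps])
          (auto simp: combine_amb)
      then show "c i = 0" using i by (auto simp: image_subset_iff)
    qed
  next
    assume R: ?R
    show "independent F bs"
    proof (rule trivial_combine_imp_independent[OF assms])
      fix Ks assume Ks: "set Ks \<subseteq> F" "combine Ks bs = \<zero>\<^bsub>amb\<^esub>"
      \<comment> \<open>\<open>Ks\<close> may have any length: missing coefficients are filled with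
        0, and \<open>combine\<close> ignores surplus ones.\<close>
      define c where "c i = (if i < length Ks then Ks ! i else 0)" for i
      have "(\<Sum>i<length bs. c i * bs ! i) = (\<Sum>i<min (length Ks) (length bs). Ks ! i * bs ! i)"
        by (rule sum.mono_neutral_cong_right) (auto simp: c_def)
      also have "\<dots> = 0" using Ks by (simp add: combine_amb)
      finally have sum0: "(\<Sum>i<length bs. c i * bs ! i) = 0" .
      have "\<forall>i<length bs. c i \<in> F"
        using Ks amb_subfield.zero_mem[of F] assms by (auto simp: c_def amb_subfield_def)
      with sum0 have "\<forall>i<length bs. c i = 0" using R by blast
      then show "set (take (length bs) Ks) \<subseteq> {\<zero>\<^bsub>amb\<^esub>}"
        by (auto simp: c_def in_set_conv_nth) (metis)
    qed simp
  qed
qed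

text \<open>If the columns of \<open>B\<close> express \<open>cs\<close> in terms of \<open>bs\<close>, then both \<open>x * cs = bs * (A * B)\<close> and
  \<open>x * cs = bs * (B * C)\<close>, so that \<open>A * B = B * C\<close> with \<open>B\<close> invertible.\<close>

lemma mult_matrix_det_unique:
  assumes F: "subfield F amb" and A: "mult_matrix F L bs x A" and C: "mult_matrix F L cs x C"
  shows "det A = det (C :: 'a :: field mat)"
proof -
  interpret amb: field "amb :: 'a ring" by (rule amb_field)
  interpret F: amb_subfield F by (rule amb_subfield.intro) fact
  note A' = A[unfolded mult_matrix_def] and C' = C[unfolded mult_matrix_def]
  define n where "n = length bs"
  have len: "length cs = n"
    using amb.dimension_is_inj[OF F amb.dimensionI[OF F] amb.dimensionI[OF F]] A' C' n_def by metis
  have lin: "\<And>c i. (\<forall>i<n. c i \<in> F) \<Longrightarrow> (\<Sum>i<n. c i * bs ! i) = 0 \<Longrightarrow> i < n \<Longrightarrow> c i = 0"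
    using A' independent_amb_iff[OF F, of bs, folded n_def] by blast
  have "\<exists>b. (\<forall>i<n. b i \<in> F) \<and> cs ! j = (\<Sum>i<n. b i * bs ! i)" if "j < n" for j
    using mem_Span_amb_iff[OF F, of "cs ! j" bs] A' C' that len n_def by (metis nth_mem subsetD)
  then obtain b where b: "\<And>j. j < n \<Longrightarrow> (\<forall>i<n. b j i \<in> F) \<and> cs ! j = (\<Sum>i<n. b j i * bs ! i)"
    by metis
  have "\<exists>b. (\<forall>i<n. b i \<in> F) \<and> bs ! j = (\<Sum>i<n. b i * cs ! i)" if "j < n" for j
    using mem_Span_amb_iff[OF F, of "bs ! j" cs] A' C' that len n_def by (metis nth_mem subsetD)
  then obtain e where e: "\<And>j. j < n \<Longrightarrow> (\<forall>i<n. e j i \<in> F) \<and> bs ! j = (\<Sum>i<n. e j i * cs ! i)"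
    by metis
  define B where "B = mat n n (\<lambda>(i, j). b j i)"
  define E where "E = mat n n (\<lambda>(i, j). e j i)"
  have carr: "A \<in> carrier_mat n n" "C \<in> carrier_mat n n" "B \<in> carrier_mat n n" "E \<in> carrier_mat n n"
    using A' C' len by (auto simp: n_def B_def E_def)
  \<comment> \<open>Matrices are compared through the vectors that their columns describe in terms
    of \<open>bs\<close>. The entries must lie in \<open>F\<close>, since \<open>bs\<close> is
    independent over \<open>F\<close> only.\<close>
  have uniq: "G = H" if "G \<in> carrier_mat n n" "H \<in> carrier_mat n n"
    "\<And>i j. i < n \<Longrightarrow> j < n \<Longrightarrow> G $$ (i, j) \<in> F" "\<And>i j. i < n \<Longrightarrow> j < n \<Longrightarrow> H $$ (i, j) \<in> F"
    "\<And>j. j < n \<Longrightarrow> (\<Sum>i<n. G $$ (i, j) * bs ! i) = (\<Sum>i<n. H $$ (i, j) * bs ! i)" for G H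
  proof (rule eq_matI)
    fix i j assume "i < dim_row H" "j < dim_col H"
    then have ij: "i < n" "j < n" using that by auto
    have "G $$ (i, j) - H $$ (i, j) = 0"
      by (rule lin[of "\<lambda>i. G $$ (i, j) - H $$ (i, j)"])
         (use that ij in \<open>auto simp: left_diff_distrib sum_subtractf\<close>)
    then show "G $$ (i, j) = H $$ (i, j)" by simp
  qed (use that in auto)
  \<comment> \<open>Associativity \<open>v * (G * H) = (v * G) * H\<close> for a row vector
    \<open>v\<close>.\<close>
  have swap: "(\<Sum>i<n. (G * H) $$ (i, j) * v i) = (\<Sum>k<n. H $$ (k, j) * (\<Sum>i<n. G $$ (i, k) * v i))"
    if "G \<in> carrier_mat n n" "H \<in> carrier_mat n n" "j < n" for G H :: "'a mat" and v j
  proof -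
    have "(\<Sum>i<n. (G * H) $$ (i, j) * v i) = (\<Sum>i<n. \<Sum>k<n. G $$ (i, k) * H $$ (k, j) * v i)"
      using that by (intro sum.cong) (auto simp: scalar_prod_def sum_distrib_right lessThan_atLeast0)
    also have "\<dots> = (\<Sum>k<n. \<Sum>i<n. G $$ (i, k) * H $$ (k, j) * v i)"
      by (rule sum.swap)
    finally show ?thesis by (simp add: sum_distrib_left mult_ac)
  qed
  have memb: "(G * H) $$ (i, j) \<in> F" if "G \<in> carrier_mat n n" "H \<in> carrier_mat n n" "i < n" "j < n"
    "\<And>i j. i < n \<Longrightarrow> j < n \<Longrightarrow> G $$ (i, j) \<in> F" "\<And>i j. i < n \<Longrightarrow> j < n \<Longrightarrow> H $$ (i, j) \<in> F" for G H i j
    using that by (auto simp: scalar_prod_def intro!: F.sum_mem)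
  have entries: "\<And>i j. i < n \<Longrightarrow> j < n \<Longrightarrow> A $$ (i, j) \<in> F" "\<And>i j. i < n \<Longrightarrow> j < n \<Longrightarrow> C $$ (i, j) \<in> F"
    "\<And>i j. i < n \<Longrightarrow> j < n \<Longrightarrow> B $$ (i, j) \<in> F" "\<And>i j. i < n \<Longrightarrow> j < n \<Longrightarrow> E $$ (i, j) \<in> F"
    using A' C' len b e by (auto simp: n_def B_def E_def)
  have Bcs: "(\<Sum>i<n. B $$ (i, j) * bs ! i) = cs ! j" if "j < n" for j
    using b[OF that] that by (simp add: B_def)
  have Ebs: "(\<Sum>i<n. E $$ (i, j) * cs ! i) = bs ! j" if "j < n" for j
    using e[OF that] that by (simp add: E_def)
  have Abs: "(\<Sum>i<n. A $$ (i, j) * bs ! i) = x * bs ! j" if "j < n" for j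
    using A' that by (simp add: n_def)
  have Ccs: "(\<Sum>i<n. C $$ (i, j) * cs ! i) = x * cs ! j" if "j < n" for j
    using C' that by (simp add: len)
  have AB: "A * B = B * C"
  proof (rule uniq)
    fix j assume j: "j < n"
    have "(\<Sum>i<n. (A * B) $$ (i, j) * bs ! i) = (\<Sum>k<n. B $$ (k, j) * (x * bs ! k))"
      unfolding swap[OF carr(1,3) j] using Abs by (intro sum.cong) auto
    also have "\<dots> = x * (\<Sum>i<n. B $$ (i, j) * bs ! i)"
      by (simp add: sum_distrib_left mult_ac)
    also have "\<dots> = (\<Sum>i<n. C $$ (i, j) * cs ! i)" using j Bcs Ccs by simp
    also have "\<dots> = (\<Sum>i<n. (B * C) $$ (i, j) * bs ! i)"
      unfolding swap[OF carr(3,2) j] using Bcs by (intro sum.cong) auto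
    finally show "(\<Sum>i<n. (A * B) $$ (i, j) * bs ! i) = (\<Sum>i<n. (B * C) $$ (i, j) * bs ! i)" .
  qed (use carr entries memb in auto)
  \<comment> \<open>Passing from \<open>bs\<close> to \<open>cs\<close> and back; this makes
    \<open>det B\<close> nonzero, so it can be cancelled.\<close>
  have BE: "B * E = 1\<^sub>m n"
  proof (rule uniq)
    fix j assume j: "j < n"
    have "(\<Sum>i<n. (B * E) $$ (i, j) * bs ! i) = bs ! j"
      unfolding swap[OF carr(3,4) j] using Bcs Ebs[OF j] by simp
    also have "\<dots> = (\<Sum>i<n. 1\<^sub>m n $$ (i, j) * bs ! i)"
      using j by (simp add: if_distrib[of "\<lambda>x. x * _"] cong: if_cong)
    finally show "(\<Sum>i<n. (B * E) $$ (i, j) * bs ! i) = (\<Sum>i<n. 1\<^sub>m n $$ (i, j) * bs ! i)" .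
  qed (use carr entries memb in auto)
  have "det B * det E = 1"
    using det_mult[OF carr(3,4)] BE by simp
  moreover have "det A * det B = det B * det C"
    using det_mult[OF carr(1,3)] det_mult[OF carr(3,2)] AB by metis
  ultimately show ?thesis by auto
qed

text \<open>All multiplication matrices of \<open>x\<close> share one determinant, so the choice in
  \<open>field_norm\<close> is forced as soon as one of them is exhibited.\<close>

lemma field_norm_eq:
  assumes "subfield F amb" "mult_matrix F L bs x A"
  shows "field_norm F L x = det A"
  unfolding field_norm_def
  by (rule some_equality) (use mult_matrix_det_unique[OF assms(1)] assms(2) in blast)+

section \<open>Nonarchimedean absolute values\<close>

text \<open>Laplace expansion along row \<open>i\<close>, whose cofactors do not see that row. These
  determinants are the partial derivatives of \<open>det\<close> at \<open>A\<close> in the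
  direction \<open>B\<close>.\<close>

lemma det_replace_row:
  fixes A B :: "'a :: comm_ring_1 mat"
  assumes A: "A \<in> carrier_mat n n" and i: "i < n"
  shows "det (mat n n (\<lambda>(r, c). if r = i then B $$ (r, c) else A $$ (r, c)))
    = (\<Sum>j<n. B $$ (i, j) * cofactor A i j)"
proof -
  let ?M = "mat n n (\<lambda>(r, c). if r = i then B $$ (r, c) else A $$ (r, c))"
  have "det ?M = (\<Sum>j<n. ?M $$ (i, j) * cofactor ?M i j)"
    by (rule laplace_expansion_row) (use i in auto)
  also have "\<dots> = (\<Sum>j<n. B $$ (i, j) * cofactor A i j)"
  proof (rule sum.cong)
    fix j assume "j \<in> {..<n}"
    moreover have "mat_delete ?M i j = mat_delete A i j"
      using A i by (intro eq_matI) (auto simp: mat_delete_def)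
    ultimately show "?M $$ (i, j) * cofactor ?M i j = B $$ (i, j) * cofactor A i j"
      using i by (simp add: cofactor_def)
  qed simp
  finally show ?thesis .
qed

locale nonarch_abs =
  fixes nv :: "'a :: field \<Rightarrow> real"
  assumes nv_nonneg [simp]: "nv x \<ge> 0"
    and nv_eq_0_iff [simp]: "nv x = 0 \<longleftrightarrow> x = 0"
    and nv_mult: "nv (x * y) = nv x * nv y"
    and nv_add_le_max: "nv (x + y) \<le> max (nv x) (nv y)"
begin

lemma nv_0 [simp]: "nv 0 = 0"
  by simp

lemma nv_pos_iff [simp]: "nv x > 0 \<longleftrightarrow> x \<noteq> 0"
  using nv_nonneg[of x] nv_eq_0_iff[of x] by linarith

lemma nv_1 [simp]: "nv 1 = 1"
proof -
  have "nv 1 * nv 1 = nv 1" using nv_mult[of 1 1] by simp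
  then show ?thesis by simp
qed

lemma nv_power: "nv (x ^ n) = nv x ^ n"
  by (induct n) (auto simp: nv_mult)

lemma nv_minus [simp]: "nv (- x) = nv x"
proof -
  have "nv (- 1) * nv (- 1) = 1" using nv_mult[of "- 1" "- 1"] by simp
  then have "nv (- 1) = 1"
    using nv_nonneg[of "- 1"] by (metis abs_of_nonneg abs_one abs_square_eq_1 power2_eq_square)
  then show ?thesis using nv_mult[of "- 1" x] by simp
qed

lemma nv_minus_commute: "nv (x - y) = nv (y - x)"
  using nv_minus[of "x - y"] by simp

lemma nv_diff_le_max: "nv (x - y) \<le> max (nv x) (nv y)"
  using nv_add_le_max[of x "- y"] by simp

lemma nv_inverse: "nv (inverse x) = inverse (nv x)"
proof (cases "x = 0")
  case False
  then show ?thesis using nv_mult[of x "inverse x"] by (simp add: field_simps)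
qed simp

lemma nv_divide: "nv (x / y) = nv x / nv y"
  by (simp add: divide_inverse nv_mult nv_inverse)

lemma nv_add_le: "nv x \<le> e \<Longrightarrow> nv y \<le> e \<Longrightarrow> nv (x + y) \<le> e"
  using nv_add_le_max[of x y] by simp

lemma nv_diff_le: "nv x \<le> e \<Longrightarrow> nv y \<le> e \<Longrightarrow> nv (x - y) \<le> e"
  using nv_diff_le_max[of x y] by simp

lemma nv_add_less: "nv x < e \<Longrightarrow> nv y < e \<Longrightarrow> nv (x + y) < e"
  using nv_add_le_max[of x y] by simp

lemma nv_diff_less: "nv x < e \<Longrightarrow> nv y < e \<Longrightarrow> nv (x - y) < e"
  using nv_diff_le_max[of x y] by simp

lemma nv_sum_le: "0 \<le> e \<Longrightarrow> (\<And>i. i \<in> I \<Longrightarrow> nv (f i) \<le> e) \<Longrightarrow> nv (sum f I) \<le> e"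
  by (induct I rule: infinite_finite_induct) (auto intro: nv_add_le)

lemma nv_sum_less: "0 < e \<Longrightarrow> (\<And>i. i \<in> I \<Longrightarrow> nv (f i) < e) \<Longrightarrow> nv (sum f I) < e"
  by (induct I rule: infinite_finite_induct) (auto intro: nv_add_less)

lemma nv_prod: "nv (prod f I) = (\<Prod>i\<in>I. nv (f i))"
  by (induct I rule: infinite_finite_induct) (auto simp: nv_mult)

lemma nv_prod_le_1: "(\<And>i. i \<in> I \<Longrightarrow> nv (f i) \<le> 1) \<Longrightarrow> nv (prod f I) \<le> 1"
  unfolding nv_prod by (rule prod_le_1) auto

lemma nv_power_le_1: "nv x \<le> 1 \<Longrightarrow> nv (x ^ n) \<le> 1"
  by (simp add: nv_power power_le_one)

lemma nv_mult_le_1: "nv x \<le> 1 \<Longrightarrow> nv y \<le> 1 \<Longrightarrow> nv (x * y) \<le> 1"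
  by (simp add: nv_mult mult_le_one)

lemma nv_mult_le_left: "nv x \<le> 1 \<Longrightarrow> nv y \<le> e \<Longrightarrow> nv (x * y) \<le> e"
  using mult_mono[of "nv x" 1 "nv y" e] by (simp add: nv_mult)

lemma nv_mult_le_right: "nv x \<le> e \<Longrightarrow> nv y \<le> 1 \<Longrightarrow> nv (x * y) \<le> e"
  using nv_mult_le_left[of y x e] by (simp add: mult.commute)

lemma nv_of_nat_le_1 [simp]: "nv (of_nat n) \<le> 1"
  by (induct n) (auto intro: nv_add_le)

text \<open>The isosceles principle for ultrametrics, used throughout to exclude
  cancellation.\<close>

lemma nv_add_eq_right: "nv x < nv y \<Longrightarrow> nv (x + y) = nv y"
  using nv_add_le_max[of x y] nv_diff_le_max[of "x + y" x] by (auto simp: max_def split: if_splits)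

lemma nv_add_eq_left: "nv y < nv x \<Longrightarrow> nv (x + y) = nv x"
  using nv_add_eq_right[of y x] by (simp add: add.commute)

section \<open>Congruences, written as bounds on \<open>nv (x - y)\<close>\<close>

lemma nv_cong_trans: "nv (x - y) \<le> e \<Longrightarrow> nv (y - z) \<le> e \<Longrightarrow> nv (x - z) \<le> e"
  using nv_add_le[of "x - y" e "y - z"] by simp

lemma nv_cong_sym: "nv (x - y) \<le> e \<Longrightarrow> nv (y - x) \<le> e"
  by (simp add: nv_minus_commute)

lemma nv_cong_add: "nv (x - x') \<le> e \<Longrightarrow> nv (y - y') \<le> e \<Longrightarrow> nv ((x + y) - (x' + y')) \<le> e"
  using nv_add_le[of "x - x'" e "y - y'"] by (simp add: algebra_simps)

lemma nv_cong_sum: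
  "0 \<le> e \<Longrightarrow> (\<And>i. i \<in> I \<Longrightarrow> nv (f i - g i) \<le> e) \<Longrightarrow> nv (sum f I - sum g I) \<le> e"
  unfolding sum_subtractf[symmetric] by (rule nv_sum_le)

lemma nv_cong_le_1: "nv (x - y) \<le> e \<Longrightarrow> e \<le> 1 \<Longrightarrow> nv y \<le> 1 \<Longrightarrow> nv x \<le> 1"
  using nv_add_le[of "x - y" 1 y] by simp

lemma nv_cong_mult:
  assumes "nv x \<le> 1" "nv y' \<le> 1" "nv (x - x') \<le> e" "nv (y - y') \<le> e"
  shows "nv (x * y - x' * y') \<le> e"
proof -
  have "nv (x * (y - y') + (x - x') * y') \<le> e"
    using assms by (intro nv_add_le nv_mult_le_left nv_mult_le_right)
  then show ?thesis by (simp add: algebra_simps)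
qed

lemma nv_cong_prod:
  assumes "0 \<le> e" "\<And>i. i \<in> I \<Longrightarrow> nv (f i) \<le> 1" "\<And>i. i \<in> I \<Longrightarrow> nv (g i) \<le> 1"
    "\<And>i. i \<in> I \<Longrightarrow> nv (f i - g i) \<le> e"
  shows "nv (prod f I - prod g I) \<le> e"
  using assms
proof (induct I rule: infinite_finite_induct)
  case (insert i I)
  then show ?case by (auto intro!: nv_cong_mult nv_prod_le_1)
qed auto

lemma nv_cong_power:
  "0 \<le> e \<Longrightarrow> nv x \<le> 1 \<Longrightarrow> nv y \<le> 1 \<Longrightarrow> nv (x - y) \<le> e \<Longrightarrow> nv (x ^ n - y ^ n) \<le> e"
  using nv_cong_prod[of e "{..<n}" "\<lambda>_. x" "\<lambda>_. y"] by simp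

lemma nv_signof [simp]: "nv (signof s) = 1"
  by (simp add: sign_def)

lemma nv_det_le_1:
  assumes A: "A \<in> carrier_mat n n" and 1: "\<And>i j. i < n \<Longrightarrow> j < n \<Longrightarrow> nv (A $$ (i, j)) \<le> 1"
  shows "nv (det A) \<le> 1"
  unfolding det_def'[OF A]
  by (intro nv_sum_le nv_mult_le_1 nv_prod_le_1) (auto simp: permutes_in_image intro!: 1)

lemma nv_cong_det:
  assumes A: "A \<in> carrier_mat n n" and B: "B \<in> carrier_mat n n" and e: "0 \<le> e"
    and 1: "\<And>i j. i < n \<Longrightarrow> j < n \<Longrightarrow> nv (A $$ (i, j)) \<le> 1"
      "\<And>i j. i < n \<Longrightarrow> j < n \<Longrightarrow> nv (B $$ (i, j)) \<le> 1"
    and d: "\<And>i j. i < n \<Longrightarrow> j < n \<Longrightarrow> nv (A $$ (i, j) - B $$ (i, j)) \<le> e"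
  shows "nv (det A - det B) \<le> e"
  unfolding det_def'[OF A] det_def'[OF B]
proof (rule nv_cong_sum[OF e])
  fix s assume "s \<in> {s. s permutes {0..<n}}"
  then have s: "i < n \<Longrightarrow> s i < n" for i by (auto simp: permutes_in_image)
  have "nv ((\<Prod>i = 0..<n. A $$ (i, s i)) - (\<Prod>i = 0..<n. B $$ (i, s i))) \<le> e"
    by (rule nv_cong_prod[OF e]) (auto intro!: 1 d s)
  then show "nv (signof s * (\<Prod>i = 0..<n. A $$ (i, s i)) - signof s * (\<Prod>i = 0..<n. B $$ (i, s i))) \<le> e"
    by (simp add: right_diff_distrib[symmetric] nv_mult)
qed

text \<open>First-order Taylor expansion of a product in \<open>s\<close>: every remaining term
  carries \<open>s ^ 2\<close> with an integral coefficient.\<close>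

lemma nv_prod_expand:
  assumes "finite I" "nv s \<le> 1" "\<And>i. i \<in> I \<Longrightarrow> nv (f i) \<le> 1" "\<And>i. i \<in> I \<Longrightarrow> nv (g i) \<le> 1"
  shows "nv ((\<Prod>i\<in>I. f i + s * g i) - (prod f I + s * (\<Sum>i\<in>I. g i * prod f (I - {i})))) \<le> nv s ^ 2"
  using assms(1,3,4)
proof (induct I rule: finite_induct)
  case (insert k I)
  let ?p = "\<Prod>i\<in>I. f i + s * g i" and ?S = "\<Sum>i\<in>I. g i * prod f (I - {i})"
  have S: "(\<Sum>i\<in>insert k I. g i * prod f (insert k I - {i})) = g k * prod f I + f k * ?S"
  proof -
    have "(\<Sum>i\<in>I. g i * prod f (insert k I - {i})) = (\<Sum>i\<in>I. f k * (g i * prod f (I - {i})))"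
    proof (rule sum.cong)
      fix i assume i: "i \<in> I"
      then have "insert k I - {i} = insert k (I - {i})" using insert by auto
      then show "g i * prod f (insert k I - {i}) = f k * (g i * prod f (I - {i}))"
        using insert by simp
    qed simp
    then show ?thesis using insert by (simp add: sum_distrib_left)
  qed
  have IH: "nv (?p - (prod f I + s * ?S)) \<le> nv s ^ 2" using insert by auto
  have fk: "nv (f k + s * g k) \<le> 1"
    using insert assms(2) by (intro nv_add_le nv_mult_le_1) auto
  have S1: "nv (g k * ?S) \<le> 1"
    using insert by (intro nv_mult_le_1 nv_sum_le nv_prod_le_1) auto
  \<comment> \<open>The new error is the old one times the integral factor
    \<open>f k + s * g k\<close>, plus the single new second-order term.\<close>
  have "(\<Prod>i\<in>insert k I. f i + s * g i)
      - (prod f (insert k I) + s * (\<Sum>i\<in>insert k I. g i * prod f (insert k I - {i})))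
    = (f k + s * g k) * (?p - (prod f I + s * ?S)) + g k * ?S * s ^ 2"
    unfolding S using insert by (simp add: algebra_simps power2_eq_square)
  then show ?case
    using IH fk S1 by (auto simp: nv_power intro!: nv_add_le nv_mult_le_left)
qed auto

text \<open>Jacobi's formula with error term: the double sum is the trace of \<open>B\<close> times
  the adjugate of \<open>A\<close>. It follows from \<open>nv_prod_expand\<close> applied to each
  term of the Leibniz formula.\<close>

lemma nv_det_expand:
  assumes A: "A \<in> carrier_mat n n" and B: "B \<in> carrier_mat n n" and s: "nv s \<le> 1"
    and 1: "\<And>i j. i < n \<Longrightarrow> j < n \<Longrightarrow> nv (A $$ (i, j)) \<le> 1"
      "\<And>i j. i < n \<Longrightarrow> j < n \<Longrightarrow> nv (B $$ (i, j)) \<le> 1"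
  shows "nv (det (A + s \<cdot>\<^sub>m B) - (det A + s * (\<Sum>i<n. \<Sum>j<n. B $$ (i, j) * cofactor A i j))) \<le> nv s ^ 2"
proof -
  let ?P = "{p. p permutes {0..<n}}" and ?I = "{0..<n}"
  let ?M = "\<lambda>i. mat n n (\<lambda>(r, c). if r = i then B $$ (r, c) else A $$ (r, c))"
  have "(\<Sum>i<n. \<Sum>j<n. B $$ (i, j) * cofactor A i j) = (\<Sum>i\<in>?I. det (?M i))"
    using det_replace_row[OF A] by (simp add: lessThan_atLeast0)
  also have "\<dots> = (\<Sum>i\<in>?I. \<Sum>p\<in>?P. signof p * (B $$ (i, p i) * (\<Prod>j\<in>?I - {i}. A $$ (j, p j))))"
  proof (rule sum.cong)
    fix i assume i: "i \<in> ?I"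
    have "det (?M i) = (\<Sum>p\<in>?P. signof p * (\<Prod>j\<in>?I. ?M i $$ (j, p j)))"
      by (rule det_def') simp
    also have "\<dots> = (\<Sum>p\<in>?P. signof p * (B $$ (i, p i) * (\<Prod>j\<in>?I - {i}. A $$ (j, p j))))"
    proof (rule sum.cong)
      fix p assume "p \<in> ?P"
      then have p: "j < n \<Longrightarrow> p j < n" for j by (auto simp: permutes_in_image)
      have "(\<Prod>j\<in>?I. ?M i $$ (j, p j)) = ?M i $$ (i, p i) * (\<Prod>j\<in>?I - {i}. ?M i $$ (j, p j))"
        by (rule prod.remove) (use i in auto)
      also have "(\<Prod>j\<in>?I - {i}. ?M i $$ (j, p j)) = (\<Prod>j\<in>?I - {i}. A $$ (j, p j))"
        by (rule prod.cong) (auto simp: p)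
      finally show "signof p * (\<Prod>j\<in>?I. ?M i $$ (j, p j)) =
          signof p * (B $$ (i, p i) * (\<Prod>j\<in>?I - {i}. A $$ (j, p j)))"
        using i p by simp
    qed simp
    finally show "det (?M i) = \<dots>" .
  qed simp
  also have "\<dots> = (\<Sum>p\<in>?P. signof p * (\<Sum>i\<in>?I. B $$ (i, p i) * (\<Prod>j\<in>?I - {i}. A $$ (j, p j))))"
    by (subst sum.swap) (simp add: sum_distrib_left)
  finally have cof: "(\<Sum>i<n. \<Sum>j<n. B $$ (i, j) * cofactor A i j) = \<dots>" .
  have AB: "A + s \<cdot>\<^sub>m B \<in> carrier_mat n n" using A B by auto
  have "det A + s * (\<Sum>i<n. \<Sum>j<n. B $$ (i, j) * cofactor A i j)
    = (\<Sum>p\<in>?P. signof p * ((\<Prod>i\<in>?I. A $$ (i, p i))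
         + s * (\<Sum>i\<in>?I. B $$ (i, p i) * (\<Prod>j\<in>?I - {i}. A $$ (j, p j)))))"
    unfolding cof det_def'[OF A] sum_distrib_left[of s _ ?P] sum.distrib[symmetric]
    by (rule sum.cong) (simp_all add: distrib_left mult.left_commute)
  moreover have "nv (det (A + s \<cdot>\<^sub>m B) - \<dots>) \<le> nv s ^ 2"
    unfolding det_def'[OF AB]
  proof (rule nv_cong_sum)
    fix p assume "p \<in> ?P"
    then have p: "j < n \<Longrightarrow> p j < n" for j by (auto simp: permutes_in_image)
    have "(\<Prod>i\<in>?I. (A + s \<cdot>\<^sub>m B) $$ (i, p i)) = (\<Prod>i\<in>?I. A $$ (i, p i) + s * B $$ (i, p i))"
      by (rule prod.cong) (use A B p in auto)
    then show "nv (signof p * (\<Prod>i\<in>?I. (A + s \<cdot>\<^sub>m B) $$ (i, p i)) - signof p * ((\<Prod>i\<in>?I. A $$ (i, p i))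
         + s * (\<Sum>i\<in>?I. B $$ (i, p i) * (\<Prod>j\<in>?I - {i}. A $$ (j, p j))))) \<le> nv s ^ 2"
      unfolding right_diff_distrib[symmetric] nv_mult nv_signof
      using nv_prod_expand[of ?I s "\<lambda>i. A $$ (i, p i)" "\<lambda>i. B $$ (i, p i)"] s 1 p by simp
  qed simp
  ultimately show ?thesis by simp
qed

text \<open>Nonzero terms of pairwise different size cannot cancel, so the sum is as large as its
  largest term. The second conjunct carries the induction: it compares a new term with the partial
  sum through an earlier term. Zero terms may repeat.\<close>

lemma nv_sum_distinct:
  assumes "finite I"
    and "\<And>i j. i \<in> I \<Longrightarrow> j \<in> I \<Longrightarrow> f i \<noteq> 0 \<Longrightarrow> nv (f i) = nv (f j) \<Longrightarrow> i = j"
  shows "(\<forall>i\<in>I. nv (f i) \<le> nv (sum f I)) \<and> (sum f I \<noteq> 0 \<longrightarrow> (\<exists>i\<in>I. nv (sum f I) = nv (f i)))"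
  using assms
proof (induct I rule: finite_induct)
  case (insert k I)
  then have IH: "\<forall>i\<in>I. nv (f i) \<le> nv (sum f I)" "sum f I \<noteq> 0 \<Longrightarrow> \<exists>i\<in>I. nv (sum f I) = nv (f i)"
    by (meson insertCI)+
  consider "sum f I = 0" | "f k = 0" | "sum f I \<noteq> 0" "f k \<noteq> 0" by blast
  then show ?case
  proof cases
    case 3
    then obtain i where i: "i \<in> I" "nv (sum f I) = nv (f i)" using IH by blast
    then have "nv (f k) \<noteq> nv (sum f I)" using insert 3 by (metis insertCI)
    then consider "nv (f k) < nv (sum f I)" | "nv (f k) > nv (sum f I)" by linarith
    then show ?thesis
    proof cases
      case 1
      then show ?thesis
        using IH insert i by (auto simp: nv_add_eq_right)
    next
      case 2
      then show ?thesis
        using IH insert i by (auto simp: nv_add_eq_left intro: order.trans[OF _ less_imp_le])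
    qed
  qed (use IH insert in \<open>auto intro: order.trans[OF _ nv_nonneg]\<close>)
qed auto

end

section \<open>Eisenstein extensions\<close>

text \<open>One step of the tower: \<open>F\<close> is \<open>K_n\<close>, \<open>t\<close> is
  \<open>u_n\<close>, \<open>u\<close> is \<open>u_(n+1)\<close>. The condition
  \<open>discrete\<close> expresses that \<open>t\<close> is a uniformizer of \<open>F\<close>,
  while \<pi> stays the uniformizer of the bottom field, so that congruences at all levels use the
  same modulus.\<close>

locale eisenstein_step = nonarch_abs nv + amb_subfield F
  for nv :: "'a :: field \<Rightarrow> real" and F :: "'a set" +
  fixes a :: "nat \<Rightarrow> 'a" and t u \<pi> :: 'a and d :: nat
  assumes t_mem [simp]: "t \<in> F" and nv_t_pos: "0 < nv t" and nv_t_less: "nv t < 1"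
    and discrete: "\<And>y. y \<in> F \<Longrightarrow> nv y < 1 \<Longrightarrow> nv y \<le> nv t"
    and pi_mem [simp]: "\<pi> \<in> F" and nv_pi_pos: "0 < nv \<pi>" and nv_pi_le: "nv \<pi> \<le> nv t"
    and d_ge_2: "2 \<le> d" and nv_d: "nv (of_nat d) \<le> nv \<pi>"
    and a_mem: "\<And>i. 1 \<le> i \<Longrightarrow> i < d \<Longrightarrow> a i \<in> F"
    and nv_a: "\<And>i. 1 \<le> i \<Longrightarrow> i < d \<Longrightarrow> nv (a i) \<le> nv \<pi>"
    and root: "u ^ d = t - (\<Sum>i=1..<d. a i * u ^ i)"
begin

text \<open>The Newton polygon in elementary form. If \<open>nv u\<close> were at least 1,
  \<open>u ^ d\<close> would dominate the other terms and give \<open>nv u ^ d = nv t < 1\<close>.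
  Once \<open>nv u < 1\<close>, each lower term is strictly smaller than \<open>t\<close> because it
  contains at least one factor \<open>u\<close>.\<close>

lemma nv_u: "nv u ^ d = nv t" "nv u < 1"
proof -
  define S where "S = (\<Sum>i=1..<d. a i * u ^ i)"
  have pi1: "nv \<pi> < 1" using nv_pi_le nv_t_less by simp
  have ud: "u ^ d + S = t" by (simp add: root S_def)
  show less: "nv u < 1"
  proof (rule ccontr)
    assume "\<not> nv u < 1"
    then have ge: "1 \<le> nv u" by simp
    have "nv S \<le> nv \<pi> * nv u ^ d" unfolding S_def
    proof (rule nv_sum_le)
      fix i assume "i \<in> {1..<d}"
      then show "nv (a i * u ^ i) \<le> nv \<pi> * nv u ^ d"
        using nv_a[of i] ge nv_pi_pos by (auto simp: nv_mult nv_power intro!: mult_mono power_increasing)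
    qed (use ge nv_pi_pos in simp)
    also have "\<dots> < nv u ^ d" using pi1 ge mult_strict_right_mono[of "nv \<pi>" 1 "nv u ^ d"] zero_less_power[of "nv u" d] by linarith
    finally have "nv S < nv (u ^ d)" by (simp add: nv_power)
    then have "nv u ^ d = nv t" using nv_add_eq_left[of S "u ^ d"] ud by (simp add: nv_power)
    then show False using ge nv_t_less one_le_power[OF ge, of d] by simp
  qed
  have "nv S < nv t" unfolding S_def
  proof (rule nv_sum_less)
    fix i assume i: "i \<in> {1..<d}"
    then have u1: "nv u ^ i < 1" using less power_le_one[of "nv u" "i - 1"]
        mult_le_one[of "nv u" "nv u ^ (i - 1)"] mult_left_mono[of "nv u ^ (i - 1)" 1 "nv u"]
      by (cases i) auto
    moreover have "nv (a i) \<le> nv t" using nv_a[of i] i nv_pi_le by auto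
    ultimately show "nv (a i * u ^ i) < nv t"
      using mult_right_mono[of "nv (a i)" "nv t" "nv u ^ i"] mult_strict_left_mono[OF u1 nv_t_pos]
      by (simp add: nv_mult nv_power)
  qed (fact nv_t_pos)
  then have "nv (t - S) = nv t"
    using nv_add_eq_right[of "- S" t] by simp
  then show "nv u ^ d = nv t" using ud by (metis add_diff_cancel_right' nv_power)
qed

lemma nv_u_pos: "0 < nv u"
proof -
  have "u \<noteq> 0"
  proof
    assume "u = 0"
    then have "nv t = 0" using nv_u(1) d_ge_2 by (simp add: power_0_left)
    then show False using nv_t_pos by simp
  qed
  then show ?thesis by simp
qed

lemma nv_u_power_ge: "i < d \<Longrightarrow> nv t < nv u ^ i"
  using power_strict_decreasing[of i d "nv u"] nv_u nv_u_pos by simp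

lemma nv_t_le_u: "nv t \<le> nv u"
  using nv_u_power_ge[of 1] d_ge_2 by simp

text \<open>For \<open>i < j\<close> the quotient \<open>y / z\<close> in \<open>F\<close> would
  have absolute value \<open>nv u ^ (j - i)\<close>, strictly between \<open>nv t\<close> and 1,
  against \<open>discrete\<close>. This is total ramification of degree \<open>d\<close>.\<close>

lemma F_gap:
  assumes "y \<in> F" "i < d" "j < d" "z \<in> F" "y \<noteq> 0" "nv y * nv u ^ i = nv z * nv u ^ j"
  shows "i = j"
proof -
  have *: False if "y \<in> F" "z \<in> F" "y \<noteq> 0" "i < j" "j < d" "nv y * nv u ^ i = nv z * nv u ^ j" for y z i j
  proof -
    have "nv u ^ j = nv u ^ i * nv u ^ (j - i)" using that by (simp add: power_add[symmetric])
    then have eq: "nv y = nv z * nv u ^ (j - i)" using that nv_u_pos by simp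
    then have z: "z \<noteq> 0" using that by auto
    have yz: "nv (y / z) = nv u ^ (j - i)" using eq z by (simp add: nv_divide)
    moreover have "nv u ^ (j - i) < 1"
      using that nv_u nv_u_pos power_strict_decreasing[of 0 "j - i" "nv u"] by simp
    ultimately have "nv (y / z) \<le> nv t" using discrete[of "y / z"] that by auto
    then show False using yz nv_u_power_ge[of "j - i"] that by (simp add: less_imp_diff_less)
  qed
  have "z \<noteq> 0" using assms nv_u_pos by auto
  then show ?thesis using *[of y z i j] *[of z y j i] assms by (metis linorder_neqE_nat)
qed

text \<open>By \<open>F_gap\<close> nonzero terms have different sizes, so the powers of
  \<open>u\<close> below \<open>d\<close> form an orthogonal family. Their independence and the
  bounds on coordinates both rest on this.\<close>

lemma sum_u_distinct:
  assumes "\<forall>i<d. c i \<in> F"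
  shows "(\<forall>i\<in>{..<d}. nv (c i * u ^ i) \<le> nv (\<Sum>i<d. c i * u ^ i)) \<and>
    ((\<Sum>i<d. c i * u ^ i) \<noteq> 0 \<longrightarrow> (\<exists>i\<in>{..<d}. nv (\<Sum>i<d. c i * u ^ i) = nv (c i * u ^ i)))"
  by (rule nv_sum_distinct) (use assms in \<open>auto simp: nv_mult nv_power intro: F_gap\<close>)

lemma coeff_le: "\<forall>i<d. c i \<in> F \<Longrightarrow> i < d \<Longrightarrow> nv (c i) * nv u ^ i \<le> nv (\<Sum>i<d. c i * u ^ i)"
  using sum_u_distinct[of c] by (auto simp: nv_mult nv_power)

section \<open>The extension field as a span, and its coordinates\<close>

definition L :: "'a set"
  where "L = {\<Sum>i<d. c i * u ^ i | c. \<forall>i<d. c i \<in> F}"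

text \<open>Meaningful only for \<open>y\<close> in \<open>L\<close> and indices below
  \<open>d\<close>, where \<open>coord_eq\<close> shows that the choice is unique.\<close>

definition coord :: "'a \<Rightarrow> nat \<Rightarrow> 'a"
  where "coord y = (SOME c. (\<forall>i<d. c i \<in> F) \<and> y = (\<Sum>i<d. c i * u ^ i))"

lemma
  assumes "y \<in> L"
  shows coord_mem: "i < d \<Longrightarrow> coord y i \<in> F" and coord_sum: "(\<Sum>i<d. coord y i * u ^ i) = y"
proof -
  have "\<exists>c. (\<forall>i<d. c i \<in> F) \<and> y = (\<Sum>i<d. c i * u ^ i)" using assms by (auto simp: L_def)
  from someI_ex[OF this] show "i < d \<Longrightarrow> coord y i \<in> F" "(\<Sum>i<d. coord y i * u ^ i) = y"
    unfolding coord_def[symmetric] by auto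
qed

lemma L_I: "(\<And>i. i < d \<Longrightarrow> c i \<in> F) \<Longrightarrow> (\<Sum>i<d. c i * u ^ i) \<in> L"
  by (auto simp: L_def)

lemma coeff_zero:
  assumes "\<forall>i<d. c i \<in> F" "(\<Sum>i<d. c i * u ^ i) = 0" "i < d"
  shows "c i = 0"
proof -
  have "nv (c i) * nv u ^ i \<le> 0" using coeff_le[OF assms(1,3)] assms(2) by simp
  moreover have "0 < nv u ^ i" using nv_u_pos by simp
  ultimately have "nv (c i) \<le> 0" by (simp only: mult_le_0_iff) linarith
  then show ?thesis using nv_nonneg[of "c i"] by (metis nv_eq_0_iff order_antisym)
qed

lemma coord_eq:
  assumes c: "\<And>i. i < d \<Longrightarrow> c i \<in> F" and y: "y = (\<Sum>i<d. c i * u ^ i)" and i: "i < d"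
  shows "coord y i = c i"
proof -
  have yL: "y \<in> L" unfolding y by (rule L_I) (rule c)
  have "coord y i - c i = 0"
    by (rule coeff_zero[of "\<lambda>i. coord y i - c i"])
      (use coord_mem[OF yL] coord_sum[OF yL] c y i in \<open>auto simp: left_diff_distrib sum_subtractf\<close>)
  then show ?thesis by simp
qed

lemma F_subset_L: "c \<in> F \<Longrightarrow> c \<in> L"
  using L_I[of "\<lambda>i. if i = 0 then c else 0"] d_ge_2
  by (simp add: if_distrib[of "\<lambda>x. x * _"] cong: if_cong)

lemma L_add [intro]: "y \<in> L \<Longrightarrow> z \<in> L \<Longrightarrow> y + z \<in> L"
  using L_I[of "\<lambda>i. coord y i + coord z i"] coord_sum[of y] coord_sum[of z]
  by (simp add: distrib_right sum.distrib coord_mem add_mem)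

lemma L_smult [intro]: "c \<in> F \<Longrightarrow> y \<in> L \<Longrightarrow> c * y \<in> L"
  using L_I[of "\<lambda>i. c * coord y i"] coord_sum[of y]
  by (simp add: mult.assoc sum_distrib_left[symmetric] coord_mem mult_mem)

lemma coord_add: "y \<in> L \<Longrightarrow> z \<in> L \<Longrightarrow> i < d \<Longrightarrow> coord (y + z) i = coord y i + coord z i"
  by (rule coord_eq) (auto simp: distrib_right sum.distrib coord_mem coord_sum)

lemma coord_smult: "c \<in> F \<Longrightarrow> y \<in> L \<Longrightarrow> i < d \<Longrightarrow> coord (c * y) i = c * coord y i"
  by (rule coord_eq) (auto simp: mult.assoc sum_distrib_left[symmetric] coord_mem coord_sum)

lemma L_sum [intro]: "(\<And>i. i \<in> I \<Longrightarrow> f i \<in> L) \<Longrightarrow> sum f I \<in> L"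
  by (induct I rule: infinite_finite_induct) (auto intro: F_subset_L)

lemma coord_0: "i < d \<Longrightarrow> coord 0 i = 0"
  by (rule coord_eq) auto

lemma coord_sum_distrib:
  "(\<And>i. i \<in> I \<Longrightarrow> f i \<in> L) \<Longrightarrow> j < d \<Longrightarrow> coord (sum f I) j = (\<Sum>i\<in>I. coord (f i) j)"
  by (induct I rule: infinite_finite_induct) (auto simp: coord_0 coord_add L_sum)

lemma L_uminus [intro]: "y \<in> L \<Longrightarrow> - y \<in> L"
  using L_smult[of "- 1" y] minus_mem[OF one_mem] by simp

lemma L_diff [intro]: "y \<in> L \<Longrightarrow> z \<in> L \<Longrightarrow> y - z \<in> L"
  using L_add[of y "- z"] by auto

lemma coord_diff: "y \<in> L \<Longrightarrow> z \<in> L \<Longrightarrow> i < d \<Longrightarrow> coord (y - z) i = coord y i - coord z i"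
  using coord_add[of "y - z" z i] by (simp add: L_diff)

lemma u_power_eq_sum: "j < d \<Longrightarrow> u ^ j = (\<Sum>i<d. (if i = j then 1 else 0) * u ^ i)"
  by (simp add: if_distrib[of "\<lambda>x. x * _"] cong: if_cong)

lemma L_u_power_less: "j < d \<Longrightarrow> u ^ j \<in> L"
  by (subst u_power_eq_sum) (auto intro!: L_I)

lemma coord_u_power: "j < d \<Longrightarrow> i < d \<Longrightarrow> coord (u ^ j) i = (if i = j then 1 else 0)"
  by (rule coord_eq[OF _ u_power_eq_sum]) auto

lemma L_u_power_d: "u ^ d \<in> L"
proof -
  have "(\<Sum>i=1..<d. a i * u ^ i) \<in> L" by (auto intro!: L_sum L_smult L_u_power_less a_mem)
  then show ?thesis unfolding root by (intro L_diff) (auto intro: F_subset_L)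
qed

lemma L_mult_u: "y \<in> L \<Longrightarrow> y * u \<in> L"
proof -
  assume y: "y \<in> L"
  have "u ^ Suc i \<in> L" if "i < d" for i
    using that L_u_power_less[of "Suc i"] L_u_power_d by (cases "Suc i = d") auto
  then have "(\<Sum>i<d. coord y i * u ^ Suc i) \<in> L"
    by (auto intro!: L_sum L_smult coord_mem[OF y] simp del: power_Suc)
  moreover have "(\<Sum>i<d. coord y i * u ^ Suc i) = (\<Sum>i<d. coord y i * u ^ i) * u"
    by (simp add: sum_distrib_left sum_distrib_right mult_ac)
  ultimately show ?thesis by (simp only: coord_sum[OF y])
qed

lemma L_mult_u_power: "y \<in> L \<Longrightarrow> y * u ^ n \<in> L"
  by (induct n) (use L_mult_u in \<open>auto simp: mult.assoc[symmetric] power_Suc2 simp del: power_Suc\<close>)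

lemma L_mult [intro]: "y \<in> L \<Longrightarrow> z \<in> L \<Longrightarrow> y * z \<in> L"
proof -
  assume y: "y \<in> L" and z: "z \<in> L"
  have "(\<Sum>i<d. coord z i * (y * u ^ i)) \<in> L"
    by (auto intro!: L_sum L_smult L_mult_u_power y coord_mem[OF z])
  moreover have "(\<Sum>i<d. coord z i * (y * u ^ i)) = y * (\<Sum>i<d. coord z i * u ^ i)"
    by (simp add: sum_distrib_left mult_ac)
  ultimately show ?thesis by (simp only: coord_sum[OF z])
qed

lemma L_u: "u \<in> L"
  using L_u_power_less[of 1] d_ge_2 by simp

lemma L_1 [simp]: "1 \<in> L"
  by (simp add: F_subset_L)

lemma L_power [intro]: "y \<in> L \<Longrightarrow> y ^ n \<in> L"
  by (induct n) auto

lemma Span_L: "ring.Span amb F (map (\<lambda>i. u ^ i) [0..<d]) = L"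
  by (rule Set.set_eqI) (simp add: mem_Span_amb_iff[OF subfield_F] L_def cong: sum.cong_simp, blast)

lemma independent_u: "ring.independent amb F (map (\<lambda>i. u ^ i) [0..<d])"
proof (rule iffD2[OF independent_amb_iff[OF subfield_F]], intro allI impI, elim conjE)
  fix c i
  assume c: "\<forall>i<length (map (\<lambda>i. u ^ i) [0..<d]). c i \<in> F"
    and sum: "(\<Sum>i<length (map (\<lambda>i. u ^ i) [0..<d]). c i * map (\<lambda>i. u ^ i) [0..<d] ! i) = 0"
    and i: "i < length (map (\<lambda>i. u ^ i) [0..<d])"
  have "(\<Sum>i<length (map (\<lambda>i. u ^ i) [0..<d]). c i * map (\<lambda>i. u ^ i) [0..<d] ! i) = (\<Sum>i<d. c i * u ^ i)"
    by (rule sum.cong) auto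
  with sum have s0: "(\<Sum>i<d. c i * u ^ i) = 0" by (simp only:)
  show "c i = 0"
    by (rule coeff_zero[OF _ s0]) (use c i in \<open>simp_all only: length_map length_upt diff_zero\<close>)
qed

lemma subring_L: "subring L amb"
proof -
  interpret amb: field "amb :: 'a ring" by (rule amb_field)
  show ?thesis by (rule amb.subringI) auto
qed

text \<open>\<open>L\<close> is a finite-dimensional subring, so \<open>u\<close> is algebraic over
  \<open>F\<close> and the simple extension generated by \<open>u\<close> is a field; it coincides
  with \<open>L\<close>.\<close>

lemma subfield_L: "subfield L amb"
proof -
  interpret amb: field "amb :: 'a ring" by (rule amb_field)
  have "amb.finite_dimension F L"
    using amb.dimensionI[OF subfield_F independent_u Span_L] amb.finite_dimensionI by blast
  then have "(amb.algebraic over F) u"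
    using amb.finite_dimension_imp_algebraic[OF subfield_F subring_L] L_u by blast
  then have "subfield (amb.simple_extension F u) amb"
    using amb.simple_extension_is_subfield[OF subfield_F] by simp
  moreover have "amb.simple_extension F u = L"
  proof
    show "amb.simple_extension F u \<subseteq> L"
      by (rule amb.simple_extension_subring_incl[OF subring_L]) (auto intro: F_subset_L L_u)
    interpret S: amb_subfield "amb.simple_extension F u" by (rule amb_subfield.intro) fact
    have "F \<subseteq> amb.simple_extension F u" "u \<in> amb.simple_extension F u"
      using amb.simple_extension_incl[of F u] amb.simple_extension_mem[of F u] subfieldE(1)[OF subfield_F] by auto
    then show "L \<subseteq> amb.simple_extension F u" by (auto simp: L_def intro!: S.sum_mem)
  qed
  ultimately show ?thesis by simp
qed

sublocale L: amb_subfield L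
  by (rule amb_subfield.intro) (rule subfield_L)

text \<open>Orthogonality alone bounds a coordinate by \<open>nv c / nv u ^ i\<close>. Since
  \<open>nv u ^ i\<close> exceeds \<open>nv t\<close>, this is less than one step in the discrete
  value group of \<open>F\<close>, and the loss disappears. The threshold must therefore be the size
  of an element of \<open>F\<close>.\<close>

lemma nv_coord_le:
  assumes y: "y \<in> L" and c: "c \<in> F" "c \<noteq> 0" and le: "nv y \<le> nv c" and i: "i < d"
  shows "nv (coord y i) \<le> nv c"
proof (rule ccontr)
  assume "\<not> nv (coord y i) \<le> nv c"
  then have gt: "nv c < nv (coord y i)" by simp
  then have nz: "coord y i \<noteq> 0" using c by (metis nv_0 nv_nonneg not_less)
  have "nv (c / coord y i) < 1" using gt nz by (simp add: nv_divide)
  then have "nv (c / coord y i) \<le> nv t" using discrete coord_mem[OF y i] c by auto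
  then have "nv c \<le> nv t * nv (coord y i)" using nz by (simp add: nv_divide field_simps)
  also have "\<dots> < nv (coord y i) * nv u ^ i"
    using nv_u_power_ge[OF i] nz by (simp add: mult.commute)
  also have "\<dots> \<le> nv y" using coeff_le[of "coord y"] coord_mem[OF y] coord_sum[OF y] i by auto
  finally show False using le by simp
qed

lemma nv_coord_le_1: "y \<in> L \<Longrightarrow> nv y \<le> 1 \<Longrightarrow> i < d \<Longrightarrow> nv (coord y i) \<le> 1"
  using nv_coord_le[of y 1 i] by simp

lemma nv_coord_le_pi: "y \<in> L \<Longrightarrow> nv y \<le> nv \<pi> ^ k \<Longrightarrow> i < d \<Longrightarrow> nv (coord y i) \<le> nv \<pi> ^ k"
  using nv_coord_le[of y "\<pi> ^ k" i] nv_pi_pos by (auto simp: nv_power power_mem)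

lemma nv_sum_u_le: "0 \<le> e \<Longrightarrow> (\<And>i. i < d \<Longrightarrow> nv (c i) \<le> e) \<Longrightarrow> nv (\<Sum>i<d. c i * u ^ i) \<le> e"
  by (intro nv_sum_le nv_mult_le_right) (auto intro!: nv_power_le_1 less_imp_le[OF nv_u(2)])

text \<open>All other terms of the expansion contain a factor \<open>u\<close>. Hence the residue
  field does not grow from \<open>F\<close> to \<open>L\<close>.\<close>

lemma residue_coord_0:
  assumes y: "y \<in> L" "nv y \<le> 1"
  shows "nv (y - coord y 0) \<le> nv u"
proof -
  have "y - coord y 0 = (\<Sum>i\<in>{..<d} - {0}. coord y i * u ^ i)"
    using coord_sum[OF y(1)] sum.remove[of "{..<d}" 0 "\<lambda>i. coord y i * u ^ i"] d_ge_2
    by (simp add: algebra_simps)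
  moreover have "nv (\<Sum>i\<in>{..<d} - {0}. coord y i * u ^ i) \<le> nv u"
  proof (intro nv_sum_le nv_mult_le_left)
    fix i assume "i \<in> {..<d} - {0}"
    then show "nv (coord y i) \<le> 1" "nv (u ^ i) \<le> nv u"
      using nv_coord_le_1 y nv_u power_decreasing[of 1 i "nv u"] by (auto simp: nv_power)
  qed simp
  ultimately show ?thesis by simp
qed

text \<open>The coordinate at 0 is smaller than 1 as well and lies in \<open>F\<close>, so it is at
  most \<open>nv t\<close>, hence at most \<open>nv u\<close>. Thus \<open>u\<close> can take over
  the role of \<open>t\<close> in the next step.\<close>

lemma discrete_L:
  assumes y: "y \<in> L" "nv y < 1"
  shows "nv y \<le> nv u"
proof -
  have "nv (coord y 0) \<le> nv y"
    using coeff_le[of "coord y" 0] coord_mem[OF y(1)] coord_sum[OF y(1)] d_ge_2 by auto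
  then have "nv (coord y 0) \<le> nv t"
    using discrete[of "coord y 0"] coord_mem[OF y(1), of 0] d_ge_2 y by auto
  then have "nv (coord y 0) \<le> nv u" using nv_t_le_u by simp
  then show ?thesis using nv_add_le[OF residue_coord_0[of y]] y by fastforce
qed

section \<open>The norm as the determinant in the basis of powers of \<open>u\<close>\<close>

definition mulmat :: "'a \<Rightarrow> 'a mat"
  where "mulmat y = mat d d (\<lambda>(i, j). coord (y * u ^ j) i)"

definition Nm :: "'a \<Rightarrow> 'a"
  where "Nm y = det (mulmat y)"

lemma mulmat_carrier [simp]: "mulmat y \<in> carrier_mat d d" "dim_row (mulmat y) = d" "dim_col (mulmat y) = d"
  by (simp_all add: mulmat_def)

lemma mulmat_index [simp]: "i < d \<Longrightarrow> j < d \<Longrightarrow> mulmat y $$ (i, j) = coord (y * u ^ j) i"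
  by (simp add: mulmat_def)

lemma field_norm_L: "y \<in> L \<Longrightarrow> field_norm F L y = Nm y"
  unfolding Nm_def
  by (rule field_norm_eq[OF subfield_F, of L "map (\<lambda>i. u ^ i) [0..<d]"])
    (auto simp: mult_matrix_def Span_L independent_u coord_mem coord_sum L_mult_u_power L_u_power_less
      cong: sum.cong_simp)

lemma Nm_mem: "y \<in> L \<Longrightarrow> Nm y \<in> F"
  unfolding Nm_def by (rule det_mem) (auto simp: coord_mem L_mult_u_power)

lemma mulmat_mult:
  assumes y: "y \<in> L" and z: "z \<in> L"
  shows "mulmat (y * z) = mulmat y * mulmat z"
proof (rule eq_matI)
  fix i j assume "i < dim_row (mulmat y * mulmat z)" "j < dim_col (mulmat y * mulmat z)"
  then have ij: "i < d" "j < d" by auto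
  have zL: "z * u ^ j \<in> L" using z by (rule L_mult_u_power)
  have "y * z * u ^ j = (\<Sum>k<d. coord (z * u ^ j) k * (y * u ^ k))"
  proof -
    have "(\<Sum>k<d. coord (z * u ^ j) k * (y * u ^ k)) = y * (\<Sum>k<d. coord (z * u ^ j) k * u ^ k)"
      by (simp add: mult.left_commute sum_distrib_left)
    then show ?thesis by (simp only: coord_sum[OF zL] mult.assoc)
  qed
  also have "coord \<dots> i = (\<Sum>k<d. coord (z * u ^ j) k * coord (y * u ^ k) i)"
    using ij by (subst coord_sum_distrib) (auto simp: coord_smult L_smult coord_mem[OF zL] L_mult_u_power[OF y])
  finally show "mulmat (y * z) $$ (i, j) = (mulmat y * mulmat z) $$ (i, j)"
    using ij by (simp add: scalar_prod_def lessThan_atLeast0 mult.commute)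
qed auto

lemma Nm_mult: "y \<in> L \<Longrightarrow> z \<in> L \<Longrightarrow> Nm (y * z) = Nm y * Nm z"
  by (simp add: Nm_def mulmat_mult det_mult[of _ d])

lemma mulmat_F: "c \<in> F \<Longrightarrow> mulmat c = c \<cdot>\<^sub>m 1\<^sub>m d"
  by (rule eq_matI) (auto simp: coord_smult L_u_power_less coord_u_power)

lemma Nm_F: "c \<in> F \<Longrightarrow> Nm c = c ^ d"
  by (simp add: Nm_def mulmat_F)

lemma Nm_power: "y \<in> L \<Longrightarrow> Nm (y ^ n) = Nm y ^ n"
  by (induct n) (auto simp: Nm_mult Nm_F L_power)

lemma nv_mulmat_le_1: "y \<in> L \<Longrightarrow> nv y \<le> 1 \<Longrightarrow> i < d \<Longrightarrow> j < d \<Longrightarrow> nv (mulmat y $$ (i, j)) \<le> 1"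
  using nv_u by (auto intro!: nv_coord_le_1 nv_mult_le_1 nv_power_le_1 L_mult_u_power)

lemma nv_Nm_le_1: "y \<in> L \<Longrightarrow> nv y \<le> 1 \<Longrightarrow> nv (Nm y) \<le> 1"
  unfolding Nm_def using nv_mulmat_le_1 by (intro nv_det_le_1) auto

lemma nv_pi_power_le_1: "nv \<pi> ^ k \<le> 1"
  using nv_pi_le nv_t_less by (simp add: power_le_one)

text \<open>Congruent elements have congruent coordinates by \<open>nv_coord_le_pi\<close>, and the
  determinant is an integral polynomial in the entries.\<close>

lemma nv_cong_Nm:
  assumes y: "y \<in> L" "nv y \<le> 1" and z: "z \<in> L" "nv z \<le> 1" and yz: "nv (y - z) \<le> nv \<pi> ^ k"
  shows "nv (Nm y - Nm z) \<le> nv \<pi> ^ k"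
  unfolding Nm_def
proof (rule nv_cong_det)
  fix i j assume ij: "i < d" "j < d"
  have "mulmat y $$ (i, j) - mulmat z $$ (i, j) = coord ((y - z) * u ^ j) i"
    using ij y z by (simp add: coord_diff left_diff_distrib L_mult_u_power)
  also have "nv \<dots> \<le> nv \<pi> ^ k"
    using ij y z yz nv_u by (intro nv_coord_le_pi L_mult_u_power nv_mult_le_right nv_power_le_1) auto
  finally show "nv (mulmat y $$ (i, j) - mulmat z $$ (i, j)) \<le> nv \<pi> ^ k" .
qed (use y z nv_mulmat_le_1 in auto)

lemma nv_u_power_d_cong: "nv (u ^ d - t) \<le> nv \<pi>"
proof -
  have "nv (\<Sum>i=1..<d. a i * u ^ i) \<le> nv \<pi>"
    using nv_a nv_u by (intro nv_sum_le nv_mult_le_right nv_power_le_1) auto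
  then show ?thesis by (simp add: root)
qed

lemma t_mem_L [simp]: "t \<in> L"
  by (rule F_subset_L[OF t_mem])

lemma L_u_power_d_diff: "u ^ d - t \<in> L"
  by (rule L_diff[OF L_u_power_d t_mem_L])

text \<open>Modulo \<open>\<pi>\<close> the matrix of multiplication by \<open>u ^ j\<close> is that of the purely inseparable equation
  \<open>u ^ d = t\<close>, whose diagonal vanishes unless \<open>j = 0\<close>; for \<open>j = 0\<close> the trace is \<open>d\<close>.\<close>

lemma nv_trace_u_power:
  assumes j: "j < d"
  shows "nv (\<Sum>i<d. coord (u ^ (i + j)) i) \<le> nv \<pi>"
proof (cases "j = 0")
  case True
  then show ?thesis using nv_d by (simp add: coord_u_power)
next
  case False
  show ?thesis
  proof (rule nv_sum_le)
    fix i assume "i \<in> {..<d}"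
    then have i: "i < d" by simp
    show "nv (coord (u ^ (i + j)) i) \<le> nv \<pi>"
    proof (cases "i + j < d")
      case True
      then show ?thesis using i False by (simp add: coord_u_power)
    next
      case ge: False
      \<comment> \<open>The exponent left after splitting off \<open>u ^ d\<close>. From
        \<open>j < d\<close> follows \<open>k < i\<close>, so the main term \<open>t * u ^ k\<close>
        contributes nothing to coordinate \<open>i\<close>; only the error \<open>u ^ d - t\<close>
        remains.\<close>
      define k where "k = i + j - d"
      have k: "i + j = k + d" "k < d" "k \<noteq> i" using ge i j by (auto simp: k_def)
      have "coord (u ^ (i + j)) i = coord (t * u ^ k + (u ^ d - t) * u ^ k) i"
        by (simp add: k(1) power_add algebra_simps)
      also have "\<dots> = coord ((u ^ d - t) * u ^ k) i"
        using k i by (subst coord_add) (auto simp: coord_smult L_u_power_less coord_u_power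
            intro!: L_mult_u_power L_u_power_d_diff L_smult)
      also have "nv \<dots> \<le> nv \<pi>"
      proof -
        have "nv ((u ^ d - t) * u ^ k) \<le> nv \<pi>"
          by (rule nv_mult_le_right[OF nv_u_power_d_cong nv_power_le_1]) (use nv_u in simp)
        then show ?thesis
          using nv_coord_le_pi[OF L_mult_u_power[OF L_u_power_d_diff], of k 1 i] i by simp
      qed
      finally show ?thesis .
    qed
  qed simp
qed

lemma nv_trace_le:
  assumes v: "v \<in> L" "nv v \<le> 1"
  shows "nv (\<Sum>i<d. coord (v * u ^ i) i) \<le> nv \<pi>"
proof -
  have "(\<Sum>i<d. coord (v * u ^ i) i) = (\<Sum>i<d. \<Sum>j<d. coord v j * coord (u ^ (i + j)) i)"
  proof (rule sum.cong)
    fix i assume "i \<in> {..<d}"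
    then have i: "i < d" by simp
    have L: "u ^ n \<in> L" for n using L_mult_u_power[of 1 n] by simp
    have "v * u ^ i = (\<Sum>j<d. coord v j * u ^ (i + j))"
    proof -
      have "(\<Sum>j<d. coord v j * u ^ (i + j)) = (\<Sum>j<d. coord v j * u ^ j) * u ^ i"
        by (simp add: power_add mult_ac sum_distrib_left)
      then show ?thesis by (simp only: coord_sum[OF v(1)])
    qed
    also have "coord \<dots> i = (\<Sum>j<d. coord v j * coord (u ^ (i + j)) i)"
      using i by (subst coord_sum_distrib) (auto simp: coord_smult coord_mem[OF v(1)] L L_smult)
    finally show "coord (v * u ^ i) i = \<dots>" .
  qed simp
  also have "\<dots> = (\<Sum>j<d. coord v j * (\<Sum>i<d. coord (u ^ (i + j)) i))"
    by (subst sum.swap) (simp add: sum_distrib_left)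
  also have "nv \<dots> \<le> nv \<pi>"
  proof (rule nv_sum_le)
    fix j assume "j \<in> {..<d}"
    then show "nv (coord v j * (\<Sum>i<d. coord (u ^ (i + j)) i)) \<le> nv \<pi>"
      using nv_coord_le_1[OF v] nv_trace_u_power by (intro nv_mult_le_left) auto
  qed simp
  finally show ?thesis .
qed

lemma nv_Nm_improve:
  assumes y: "y \<in> L" "nv y \<le> 1" and z: "z \<in> L" "nv z \<le> 1"
    and yz: "nv (y - z) \<le> nv \<pi> ^ k" and k: "1 \<le> k"
  shows "nv (Nm y - Nm z) \<le> nv \<pi> ^ Suc k"
proof (cases "z = 0")
  case True
  have pi1: "nv \<pi> \<le> 1" using nv_pi_power_le_1[of 1] by simp
  \<comment> \<open>The norm of the factor \<open>\<pi> ^ k\<close> is its power \<open>d\<close>,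
    and \<open>k * d\<close> is at least \<open>k + 1\<close>.\<close>
  define w where "w = y / \<pi> ^ k"
  have pik: "\<pi> ^ k \<noteq> 0" using nv_pi_pos by auto
  have w: "w \<in> L" "nv w \<le> 1" "y = \<pi> ^ k * w"
    using y yz True pik F_subset_L[OF pi_mem] by (auto simp: w_def nv_divide nv_power divide_le_eq_1)
  have "Nm y = (\<pi> ^ k) ^ d * Nm w"
    using w by (simp add: Nm_mult Nm_F F_subset_L power_mem)
  then have "nv (Nm y) \<le> nv \<pi> ^ (k * d)"
    using nv_mult_le_right[of "\<pi> ^ (k * d)" "nv \<pi> ^ (k * d)" "Nm w"] nv_Nm_le_1[OF w(1,2)]
    by (simp add: nv_power power_mult)
  also have "\<dots> \<le> nv \<pi> ^ Suc k"
  proof (rule power_decreasing)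
    have "k * 2 \<le> k * d" using d_ge_2 by simp
    then show "Suc k \<le> k * d" using k by linarith
  qed (use pi1 in auto)
  finally show ?thesis using True Nm_F[of 0] d_ge_2 by (simp add: power_0_left)
next
  case False
  define s where "s = \<pi> ^ k"
  define v where "v = (y - z) / s"
  have s: "s \<in> F" "s \<noteq> 0" "nv s = nv \<pi> ^ k" using nv_pi_pos by (auto simp: s_def nv_power)
  have v: "v \<in> L" "nv v \<le> 1" "y = z + s * v"
    using y z yz s F_subset_L[OF s(1)] by (auto simp: v_def nv_divide divide_le_eq_1)
  define w where "w = Nm z / z"
  have Nz: "Nm z \<in> F" "Nm z \<in> L" using Nm_mem[OF z(1)] F_subset_L by auto
  have w: "w \<in> L" "z * w = Nm z" using Nz z False by (auto simp: w_def)
  have NzNw: "Nm z \<noteq> 0"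
  proof
    assume "Nm z = 0"
    then show False using Nm_mult[OF z(1) L.inverse_mem[OF z(1)]] False Nm_F[OF one_mem] by simp
  qed
  \<comment> \<open>Both matrices, multiplied by \<open>mulmat z\<close>, give the scalar matrix of
    \<open>Nm z\<close>, which is nonzero.\<close>
  have adj: "adj_mat (mulmat z) = mulmat w"
  proof -
    have A: "adj_mat (mulmat z) \<in> carrier_mat d d" using adj_mat(1)[of "mulmat z" d] by simp
    have scal: "(c \<cdot>\<^sub>m 1\<^sub>m d) * mulmat w = c \<cdot>\<^sub>m mulmat w" for c
      by (subst mult_smult_assoc_mat[of _ d d]) auto
    have "mulmat z * mulmat w = Nm z \<cdot>\<^sub>m 1\<^sub>m d"
      using mulmat_mult[OF z(1) w(1)] w(2) mulmat_F[OF Nz(1)] by simp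
    then have "adj_mat (mulmat z) * (mulmat z * mulmat w) = Nm z \<cdot>\<^sub>m adj_mat (mulmat z)"
      using A by (simp add: mult_smult_distrib[OF A, of "1\<^sub>m d" d])
    moreover have "adj_mat (mulmat z) * (mulmat z * mulmat w) = Nm z \<cdot>\<^sub>m mulmat w"
      using A adj_mat(3)[of "mulmat z" d]
      by (simp add: assoc_mult_mat[OF A mulmat_carrier(1) mulmat_carrier(1), symmetric] Nm_def scal)
    ultimately have eq: "Nm z \<cdot>\<^sub>m adj_mat (mulmat z) = Nm z \<cdot>\<^sub>m mulmat w" by simp
    show ?thesis
    proof (rule eq_matI)
      fix i j assume "i < dim_row (mulmat w)" "j < dim_col (mulmat w)"
      then have "(Nm z \<cdot>\<^sub>m adj_mat (mulmat z)) $$ (i, j) = Nm z * adj_mat (mulmat z) $$ (i, j)"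
        "(Nm z \<cdot>\<^sub>m mulmat w) $$ (i, j) = Nm z * mulmat w $$ (i, j)" using A by auto
      then show "adj_mat (mulmat z) $$ (i, j) = mulmat w $$ (i, j)" using eq NzNw by simp
    qed (use A in auto)
  qed
  have cof: "cofactor (mulmat z) i j = mulmat w $$ (j, i)" if "i < d" "j < d" for i j
    using that adj[symmetric] by (simp add: adj_mat_def)
  \<comment> \<open>The coordinates of \<open>w\<close> form column 0 of \<open>mulmat w\<close>;
    they are cofactors of an integral matrix.\<close>
  have nw: "nv w \<le> 1"
  proof -
    have "nv (coord w i) \<le> 1" if i: "i < d" for i
    proof -
      have "coord w i = cofactor (mulmat z) 0 i"
        using cof[of 0 i] i d_ge_2 by simp
      also have "nv \<dots> \<le> 1" unfolding cofactor_def
      proof (rule nv_mult_le_1)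
        show "nv ((- 1) ^ (0 + i)) \<le> 1" by (simp add: nv_power)
        show "nv (det (mat_delete (mulmat z) 0 i)) \<le> 1"
        proof (rule nv_det_le_1)
          show "mat_delete (mulmat z) 0 i \<in> carrier_mat (d - 1) (d - 1)"
            by (rule mat_delete_carrier) simp
        qed (use nv_mulmat_le_1[OF z] i in \<open>auto simp: mat_delete_def simp del: mulmat_index\<close>)
      qed
      finally show ?thesis .
    qed
    then show ?thesis using nv_sum_u_le[of 1 "coord w"] coord_sum[OF w(1)] by simp
  qed
  define T where "T = (\<Sum>i<d. \<Sum>j<d. mulmat v $$ (i, j) * cofactor (mulmat z) i j)"
  have "T = (\<Sum>i<d. mulmat (v * w) $$ (i, i))"
    unfolding T_def mulmat_mult[OF v(1) w(1)]
    by (rule sum.cong) (auto simp: scalar_prod_def lessThan_atLeast0 cof)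
  also have "\<dots> = (\<Sum>i<d. coord (v * w * u ^ i) i)" by simp
  finally have T: "nv T \<le> nv \<pi>"
    using nv_trace_le[of "v * w"] v w nw by (auto intro!: nv_mult_le_1)
  have "mulmat y = mulmat z + s \<cdot>\<^sub>m mulmat v"
    by (rule eq_matI) (auto simp: v(3) distrib_right mult.assoc coord_add coord_smult s L_smult
        L_mult_u_power v(1) z(1))
  then have "nv (Nm y - (Nm z + s * T)) \<le> nv s ^ 2"
    unfolding Nm_def T_def
    using nv_det_expand[of "mulmat z" d "mulmat v" s] nv_mulmat_le_1 z v s nv_pi_power_le_1 by simp
  also have "\<dots> \<le> nv \<pi> ^ Suc k"
    unfolding s(3) power_mult[symmetric]
    using k nv_pi_power_le_1[of 1] by (intro power_decreasing) auto
  finally have "nv (Nm y - (Nm z + s * T)) \<le> nv \<pi> ^ Suc k" .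
  moreover have "nv ((Nm z + s * T) - Nm z) \<le> nv \<pi> ^ Suc k"
    using T s by (simp add: nv_mult mult.commute mult_right_mono)
  ultimately show ?thesis by (rule nv_cong_trans)
qed

end

section \<open>Approximate evaluation of power series\<close>

context nonarch_abs
begin

text \<open>A value up to precision \<open>e\<close>. Unlike a limit it exists without completeness,
  and it is determined only up to \<open>e\<close>; exact evaluation is recovered by letting
  \<open>e\<close> tend to 0.\<close>

definition apx :: "real \<Rightarrow> 'a fps \<Rightarrow> 'a \<Rightarrow> 'a \<Rightarrow> bool"
  where "apx e f z y \<longleftrightarrow> (\<forall>\<^sub>F N in sequentially. nv (y - (\<Sum>i<N. fps_nth f i * z ^ i)) \<le> e)"

definition int_fps :: "'a fps \<Rightarrow> bool"
  where "int_fps f \<longleftrightarrow> (\<forall>i. nv (fps_nth f i) \<le> 1)"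

lemma int_fps_nth: "int_fps f \<Longrightarrow> nv (fps_nth f i) \<le> 1"
  by (simp add: int_fps_def)

lemma int_fps_0 [simp]: "int_fps 0"
  by (simp add: int_fps_def)

lemma int_fps_1 [simp]: "int_fps 1"
  by (simp add: int_fps_def)

lemma int_fps_X_power [simp]: "int_fps (fps_X ^ n)"
  by (simp add: int_fps_def fps_X_power_nth)

lemma int_fps_uminus: "int_fps f \<Longrightarrow> int_fps (- f)"
  by (simp add: int_fps_def)

lemma int_fps_add: "int_fps f \<Longrightarrow> int_fps g \<Longrightarrow> int_fps (f + g)"
  by (simp add: int_fps_def nv_add_le)

lemma int_fps_diff: "int_fps f \<Longrightarrow> int_fps g \<Longrightarrow> int_fps (f - g)"
  by (simp add: int_fps_def nv_diff_le)

lemma int_fps_mult: "int_fps f \<Longrightarrow> int_fps g \<Longrightarrow> int_fps (f * g)"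
  unfolding int_fps_def fps_mult_nth by (auto intro!: nv_sum_le nv_mult_le_1)

lemma int_fps_power: "int_fps f \<Longrightarrow> int_fps (f ^ n)"
  by (induct n) (auto intro: int_fps_mult)

lemma int_fps_sum: "(\<And>i. i \<in> I \<Longrightarrow> int_fps (f i)) \<Longrightarrow> int_fps (sum f I)"
  by (induct I rule: infinite_finite_induct) (auto intro: int_fps_add)

lemma int_fps_prod: "(\<And>i. i \<in> I \<Longrightarrow> int_fps (f i)) \<Longrightarrow> int_fps (prod f I)"
  by (induct I rule: infinite_finite_induct) (auto intro: int_fps_mult)

lemma int_fps_compose: "int_fps f \<Longrightarrow> int_fps g \<Longrightarrow> int_fps (f oo g)"
  unfolding int_fps_def[of "f oo g"] fps_compose_nth
  by (auto intro!: nv_sum_le nv_mult_le_1 int_fps_nth int_fps_power)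

lemma int_fps_signof [simp]: "int_fps (signof p)"
  by (auto simp: sign_def int_fps_uminus)

lemma nv_tail_le:
  assumes "int_fps f" "nv z \<le> 1" "N \<le> M"
  shows "nv ((\<Sum>i<M. fps_nth f i * z ^ i) - (\<Sum>i<N. fps_nth f i * z ^ i)) \<le> nv z ^ N"
proof -
  have "(\<Sum>i<M. fps_nth f i * z ^ i) - (\<Sum>i<N. fps_nth f i * z ^ i) = (\<Sum>i\<in>{N..<M}. fps_nth f i * z ^ i)"
    using assms(3) sum_diff_nat_ivl[of 0 N M "\<lambda>i. fps_nth f i * z ^ i"] by (simp add: lessThan_atLeast0)
  also have "nv \<dots> \<le> nv z ^ N"
  proof (rule nv_sum_le)
    fix i assume "i \<in> {N..<M}"
    then have "nv (z ^ i) \<le> nv z ^ N" using assms(2) by (simp add: nv_power power_decreasing)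
    then show "nv (fps_nth f i * z ^ i) \<le> nv z ^ N"
      by (rule nv_mult_le_left[OF int_fps_nth[OF assms(1)]])
  qed simp
  finally show ?thesis .
qed

lemma nv_partial_sum_le_1:
  "int_fps f \<Longrightarrow> nv z \<le> 1 \<Longrightarrow> nv (\<Sum>i<N. fps_nth f i * z ^ i) \<le> 1"
  by (intro nv_sum_le nv_mult_le_1 int_fps_nth nv_power_le_1) auto

text \<open>Removes the "eventually": the tail of an integral series from index \<open>N\<close> on
  is at most \<open>nv z ^ N\<close>. With its converse \<open>apxI\<close>, approximate values can
  be multiplied at a fixed truncation.\<close>

lemma apx_bound:
  assumes f: "int_fps f" and z: "nv z \<le> 1" and y: "apx e f z y"
  shows "nv (y - (\<Sum>i<N. fps_nth f i * z ^ i)) \<le> max e (nv z ^ N)"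
proof -
  have "\<forall>\<^sub>F M in sequentially. nv (y - (\<Sum>i<M. fps_nth f i * z ^ i)) \<le> e \<and> N \<le> M"
    using y eventually_ge_at_top[of N] unfolding apx_def by (rule eventually_conj)
  then obtain M where M: "nv (y - (\<Sum>i<M. fps_nth f i * z ^ i)) \<le> e" "N \<le> M"
    using eventually_happens'[OF sequentially_bot] by blast
  show ?thesis
    by (rule nv_cong_trans[of _ "\<Sum>i<M. fps_nth f i * z ^ i"])
      (use M nv_tail_le[OF f z M(2)] in auto)
qed

lemma eventually_power_le: "0 < e \<Longrightarrow> nv z < 1 \<Longrightarrow> \<forall>\<^sub>F N in sequentially. nv z ^ N \<le> e"
proof -
  assume "0 < e" "nv z < 1"
  then have "\<forall>\<^sub>F N in sequentially. nv z ^ N < e"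
    using order_tendstoD(2)[OF LIMSEQ_power_zero[of "nv z"], of e] by simp
  then show ?thesis by (rule eventually_mono) simp
qed

lemma apxI:
  assumes "0 < e" "nv z < 1" "\<And>N. nv (y - (\<Sum>i<N. fps_nth f i * z ^ i)) \<le> max e (nv z ^ N)"
  shows "apx e f z y"
  unfolding apx_def using eventually_power_le[OF assms(1,2)]
proof eventually_elim
  case (elim N)
  then show ?case using assms(3)[of N] by simp
qed

lemma apx_nv_le_1: "int_fps f \<Longrightarrow> nv z \<le> 1 \<Longrightarrow> e \<le> 1 \<Longrightarrow> apx e f z y \<Longrightarrow> nv y \<le> 1"
  using apx_bound[of f z e y 0] by simp

lemma apx_mono: "apx e f z y \<Longrightarrow> e \<le> e' \<Longrightarrow> apx e' f z y"
  unfolding apx_def by (erule eventually_mono) simp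

lemma apx_add: "apx e f z y \<Longrightarrow> apx e g z w \<Longrightarrow> apx e (f + g) z (y + w)"
  unfolding apx_def
proof (elim eventually_rev_mp, intro always_eventually allI impI)
  fix N assume "nv (y - (\<Sum>i<N. fps_nth f i * z ^ i)) \<le> e" "nv (w - (\<Sum>i<N. fps_nth g i * z ^ i)) \<le> e"
  from nv_cong_add[OF this] show "nv (y + w - (\<Sum>i<N. fps_nth (f + g) i * z ^ i)) \<le> e"
    by (simp add: distrib_right sum.distrib)
qed

lemma apx_uminus: "apx e f z y \<Longrightarrow> apx e (- f) z (- y)"
  unfolding apx_def
proof (erule eventually_mono)
  fix N assume "nv (y - (\<Sum>i<N. fps_nth f i * z ^ i)) \<le> e"
  from nv_cong_sym[OF this] show "nv (- y - (\<Sum>i<N. fps_nth (- f) i * z ^ i)) \<le> e"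
    by (simp add: sum_negf)
qed

lemma apx_diff: "apx e f z y \<Longrightarrow> apx e g z w \<Longrightarrow> apx e (f - g) z (y - w)"
  using apx_add[of e f z y "- g" "- w"] apx_uminus[of e g z w] by simp

lemma apx_0: "0 \<le> e \<Longrightarrow> apx e 0 z 0"
  by (simp add: apx_def)

lemma apx_sum:
  "0 \<le> e \<Longrightarrow> (\<And>i. i \<in> I \<Longrightarrow> apx e (f i) z (y i)) \<Longrightarrow> apx e (sum f I) z (sum y I)"
  by (induct I rule: infinite_finite_induct) (auto intro: apx_0 apx_add)

lemma apx_X_power: "0 \<le> e \<Longrightarrow> apx e (fps_X ^ n) z (z ^ n)"
  unfolding apx_def using eventually_gt_at_top[of n]
proof eventually_elim
  case (elim N)
  then have "(\<Sum>i<N. fps_nth (fps_X ^ n) i * z ^ i) = z ^ n"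
    by (simp add: fps_X_power_nth if_distrib[of "\<lambda>x. x * _"] cong: if_cong)
  then show ?case using \<open>0 \<le> e\<close> by simp
qed

lemma apx_1: "0 \<le> e \<Longrightarrow> apx e 1 z 1"
  using apx_X_power[of e 0 z] by simp

text \<open>Read from left to right this divides by \<open>c\<close>; the inductions on the power of
  \<pi> depend on it.\<close>

lemma apx_smult: "c \<noteq> 0 \<Longrightarrow> apx (nv c * e) (fps_const c * f) z (c * y) \<longleftrightarrow> apx e f z y"
  by (simp add: apx_def mult.assoc sum_distrib_left[symmetric] right_diff_distrib[symmetric] nv_mult)

lemma apx_const_mult: "nv c \<le> 1 \<Longrightarrow> apx e f z y \<Longrightarrow> apx e (fps_const c * f) z (c * y)"
  unfolding apx_def
  by (erule eventually_mono)
    (simp add: mult.assoc sum_distrib_left[symmetric] right_diff_distrib[symmetric] nv_mult_le_left)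

lemma apx_cong: "apx e f z y \<Longrightarrow> nv (y' - y) \<le> e \<Longrightarrow> apx e f z y'"
  unfolding apx_def by (erule eventually_mono) (rule nv_cong_trans)

lemma apx_fps_cong:
  assumes "apx e f z y" "\<And>i. nv (fps_nth f i - fps_nth g i) \<le> e" "nv z \<le> 1" "0 \<le> e"
  shows "apx e g z y"
  using assms(1) unfolding apx_def
proof (rule eventually_mono)
  fix N assume *: "nv (y - (\<Sum>i<N. fps_nth f i * z ^ i)) \<le> e"
  have "nv ((\<Sum>i<N. fps_nth f i * z ^ i) - (\<Sum>i<N. fps_nth g i * z ^ i)) \<le> e"
    unfolding sum_subtractf[symmetric] left_diff_distrib[symmetric]
    using assms by (intro nv_sum_le nv_mult_le_right nv_power_le_1) auto
  with * show "nv (y - (\<Sum>i<N. fps_nth g i * z ^ i)) \<le> e" by (rule nv_cong_trans)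
qed

lemma apx_unique: "apx e f z y \<Longrightarrow> apx e f z w \<Longrightarrow> nv (y - w) \<le> e"
  using apx_diff[of e f z y f w] by (simp add: apx_def)

lemma ex_apx_partial_sum:
  assumes "int_fps f" "nv z < 1" "0 < e"
  shows "\<exists>N. apx e f z (\<Sum>i<N. fps_nth f i * z ^ i)"
proof -
  obtain N where N: "nv z ^ N \<le> e"
    using eventually_happens'[OF sequentially_bot eventually_power_le[OF assms(3,2)]] by blast
  have "apx e f z (\<Sum>i<N. fps_nth f i * z ^ i)"
    unfolding apx_def using eventually_ge_at_top[of N]
  proof eventually_elim
    case (elim M)
    then show ?case using N nv_tail_le[OF assms(1) _ elim, of z] assms(2)
      by (simp add: nv_minus_commute)
  qed
  then show ?thesis ..
qed

text \<open>The product of the truncations differs from the truncated product by the terms with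
  \<open>i + j\<close> at least \<open>N\<close>, each with at least \<open>N\<close> factors
  \<open>z\<close>.\<close>

lemma nv_cauchy_product_le:
  assumes f: "int_fps f" and g: "int_fps g" and z: "nv z \<le> 1"
  shows "nv ((\<Sum>i<N. fps_nth f i * z ^ i) * (\<Sum>i<N. fps_nth g i * z ^ i)
    - (\<Sum>i<N. fps_nth (f * g) i * z ^ i)) \<le> nv z ^ N"
proof -
  let ?h = "\<lambda>i j. fps_nth f i * z ^ i * (fps_nth g j * z ^ j)"
  let ?T = "{(i, j). i + j < N}" and ?S = "{..<N} \<times> {..<N}"
  have "(\<Sum>i<N. fps_nth (f * g) i * z ^ i) = (\<Sum>k<N. \<Sum>i\<le>k. ?h i (k - i))"
  proof (rule sum.cong)
    fix k
    have "fps_nth (f * g) k * z ^ k = (\<Sum>i\<le>k. fps_nth f i * fps_nth g (k - i) * z ^ k)"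
      by (simp add: fps_mult_nth sum_distrib_right atLeast0AtMost)
    also have "\<dots> = (\<Sum>i\<le>k. ?h i (k - i))"
      by (rule sum.cong) (auto simp: power_add[symmetric] mult_ac)
    finally show "fps_nth (f * g) k * z ^ k = \<dots>" .
  qed simp
  also have "\<dots> = (\<Sum>(i, j)\<in>?T. ?h i j)" by (rule sum.triangle_reindex[symmetric])
  finally have 1: "(\<Sum>i<N. fps_nth (f * g) i * z ^ i) = (\<Sum>(i, j)\<in>?T. ?h i j)" .
  have "(\<Sum>i<N. fps_nth f i * z ^ i) * (\<Sum>i<N. fps_nth g i * z ^ i) = (\<Sum>(i, j)\<in>?S. ?h i j)"
    by (simp add: sum_product sum.cartesian_product)
  also have "\<dots> = (\<Sum>(i, j)\<in>?S - ?T. ?h i j) + (\<Sum>(i, j)\<in>?T. ?h i j)"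
    by (rule sum.subset_diff) auto
  finally have "(\<Sum>i<N. fps_nth f i * z ^ i) * (\<Sum>i<N. fps_nth g i * z ^ i)
      - (\<Sum>i<N. fps_nth (f * g) i * z ^ i) = (\<Sum>(i, j)\<in>?S - ?T. ?h i j)"
    unfolding 1 by simp
  also have "nv \<dots> \<le> nv z ^ N"
  proof (rule nv_sum_le)
    fix ij assume "ij \<in> ?S - ?T"
    then obtain i j where ij: "ij = (i, j)" "N \<le> i + j" by auto
    have "?h i j = (fps_nth f i * fps_nth g j) * z ^ (i + j)" by (simp add: power_add)
    also have "nv \<dots> \<le> nv z ^ N"
      using z ij by (intro nv_mult_le_left nv_mult_le_1 int_fps_nth f g) (simp add: nv_power power_decreasing)
    finally show "nv (case ij of (i, j) \<Rightarrow> ?h i j) \<le> nv z ^ N" using ij by simp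
  qed simp
  finally show ?thesis .
qed

lemma apx_mult:
  assumes f: "int_fps f" and g: "int_fps g" and z: "nv z < 1" and e: "0 < e" "e \<le> 1"
    and y: "apx e f z y" and w: "apx e g z w"
  shows "apx e (f * g) z (y * w)"
  using e(1) z
proof (rule apxI)
  fix N
  let ?F = "\<Sum>i<N. fps_nth f i * z ^ i" and ?G = "\<Sum>i<N. fps_nth g i * z ^ i"
  have "nv (y * w - ?F * ?G) \<le> max e (nv z ^ N)"
    using apx_nv_le_1[OF f _ e(2) y] apx_bound[OF f _ y] apx_bound[OF g _ w] z
    by (intro nv_cong_mult nv_partial_sum_le_1 g) auto
  moreover have "nv (?F * ?G - (\<Sum>i<N. fps_nth (f * g) i * z ^ i)) \<le> max e (nv z ^ N)"
    using nv_cauchy_product_le[OF f g, of z N] z by simp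
  ultimately show "nv (y * w - (\<Sum>i<N. fps_nth (f * g) i * z ^ i)) \<le> max e (nv z ^ N)"
    by (rule nv_cong_trans)
qed

lemma apx_power:
  assumes "int_fps f" "nv z < 1" "0 < e" "e \<le> 1" "apx e f z y"
  shows "apx e (f ^ n) z (y ^ n)"
  by (induct n) (use assms in \<open>auto intro: apx_1 apx_mult int_fps_power\<close>)

lemma apx_prod:
  assumes "nv z < 1" "0 < e" "e \<le> 1" "\<And>i. i \<in> I \<Longrightarrow> int_fps (f i)" "\<And>i. i \<in> I \<Longrightarrow> apx e (f i) z (y i)"
  shows "apx e (prod f I) z (prod y I)"
  using assms by (induct I rule: infinite_finite_induct) (auto intro: apx_1 apx_mult int_fps_prod)

lemma apx_signof: "0 \<le> e \<Longrightarrow> apx e (signof p) z (signof p)"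
  using apx_1[of e z] apx_uminus[of e 1 z 1] by (auto simp: sign_def)

lemma apx_det:
  assumes A: "A \<in> carrier_mat n n" and B: "B \<in> carrier_mat n n" and z: "nv z < 1" and e: "0 < e" "e \<le> 1"
    and "\<And>i j. i < n \<Longrightarrow> j < n \<Longrightarrow> int_fps (A $$ (i, j))"
    and "\<And>i j. i < n \<Longrightarrow> j < n \<Longrightarrow> apx e (A $$ (i, j)) z (B $$ (i, j))"
  shows "apx e (det A) z (det B)"
  unfolding det_def'[OF A] det_def'[OF B]
proof (rule apx_sum)
  fix p assume "p \<in> {p. p permutes {0..<n}}"
  then have "\<And>i. i \<in> {0..<n} \<Longrightarrow> p i < n" by (auto simp: permutes_in_image)
  with assms show "apx e (signof p * (\<Prod>i = 0..<n. A $$ (i, p i))) z (signof p * (\<Prod>i = 0..<n. B $$ (i, p i)))"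
    by (intro apx_mult apx_prod int_fps_prod apx_signof) auto
qed (use e in simp)

text \<open>Without constant term, \<open>P ^ j\<close> starts in degree \<open>j\<close> or later.
  The first \<open>N\<close> coefficients of the composition thus involve only \<open>j < N\<close>,
  which makes the two finite sums interchangeable.\<close>

lemma apx_compose:
  assumes g: "int_fps g" and P: "int_fps P" "fps_nth P 0 = 0" and z: "nv z < 1" and e: "0 < e" "e \<le> 1"
    and t: "apx e P z t" and y: "apx e g t y"
  shows "apx e (g oo P) z y"
proof -
  have "\<forall>\<^sub>F N in sequentially. nv z ^ N \<le> e" using eventually_power_le e z by blast
  moreover have "\<forall>\<^sub>F N in sequentially. nv (y - (\<Sum>i<N. fps_nth g i * t ^ i)) \<le> e"
    using y by (simp add: apx_def)
  ultimately show ?thesis unfolding apx_def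
  proof eventually_elim
    case (elim N)
    have "(\<Sum>m<N. fps_nth (g oo P) m * z ^ m) = (\<Sum>m<N. \<Sum>j<N. fps_nth g j * fps_nth (P ^ j) m * z ^ m)"
    proof (rule sum.cong)
      fix m assume "m \<in> {..<N}"
      then have m: "m < N" by simp
      have "fps_nth (g oo P) m = (\<Sum>j<N. fps_nth g j * fps_nth (P ^ j) m)"
        unfolding fps_compose_nth
        by (rule sum.mono_neutral_left)
          (use m startsby_zero_power_prefix[OF P(2)] in \<open>auto simp: not_le\<close>)
      then show "fps_nth (g oo P) m * z ^ m = (\<Sum>j<N. fps_nth g j * fps_nth (P ^ j) m * z ^ m)"
        by (simp add: sum_distrib_right)
    qed simp
    also have "\<dots> = (\<Sum>j<N. fps_nth g j * (\<Sum>m<N. fps_nth (P ^ j) m * z ^ m))"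
      by (subst sum.swap) (simp add: sum_distrib_left mult.assoc)
    finally have eq: "(\<Sum>m<N. fps_nth (g oo P) m * z ^ m) = \<dots>" .
    have "nv ((\<Sum>j<N. fps_nth g j * t ^ j) - (\<Sum>m<N. fps_nth (g oo P) m * z ^ m)) \<le> e"
      unfolding eq sum_subtractf[symmetric] right_diff_distrib[symmetric]
    proof (intro nv_sum_le nv_mult_le_left int_fps_nth g)
      fix j
      show "nv (t ^ j - (\<Sum>m<N. fps_nth (P ^ j) m * z ^ m)) \<le> e"
        using apx_bound[OF int_fps_power[OF P(1)] _ apx_power[OF P(1) z e t], of j N] z elim by simp
    qed (use e in simp)
    with elim(2) show ?case by (rule nv_cong_trans)
  qed
qed

lemma fps_evaluates_to_imp_apx: "fps_evaluates_to nv f z y \<Longrightarrow> 0 < e \<Longrightarrow> apx e f z y"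
proof -
  assume "fps_evaluates_to nv f z y" "0 < e"
  then have "\<forall>\<^sub>F N in sequentially. nv ((\<Sum>i<N. fps_nth f i * z ^ i) - y) < e"
    unfolding fps_evaluates_to_def by (rule order_tendstoD(2))
  then show ?thesis unfolding apx_def
    by (rule eventually_mono) (simp add: nv_minus_commute)
qed

lemma fps_evaluates_to_iff: "fps_evaluates_to nv f z y \<longleftrightarrow> (\<forall>e>0. apx e f z y)"
proof
  assume *: "\<forall>e>0. apx e f z y"
  show "fps_evaluates_to nv f z y" unfolding fps_evaluates_to_def
  proof (rule tendstoI)
    fix e :: real assume "0 < e"
    then have "apx (e / 2) f z y" using * by simp
    then show "\<forall>\<^sub>F N in sequentially. dist (nv ((\<Sum>i<N. fps_nth f i * z ^ i) - y)) 0 < e"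
      unfolding apx_def
    proof eventually_elim
      case (elim N)
      then have "nv ((\<Sum>i<N. fps_nth f i * z ^ i) - y) \<le> e / 2" by (rule nv_cong_sym)
      then show ?case using \<open>0 < e\<close> by simp
    qed
  qed
qed (blast intro: fps_evaluates_to_imp_apx)

lemma int_fps_cong_mult:
  assumes "int_fps f" "int_fps g'" "0 \<le> e"
    and "\<And>i. nv (fps_nth f i - fps_nth f' i) \<le> e" "\<And>i. nv (fps_nth g i - fps_nth g' i) \<le> e"
  shows "nv (fps_nth (f * g) i - fps_nth (f' * g') i) \<le> e"
  unfolding fps_mult_nth using assms by (intro nv_cong_sum nv_cong_mult int_fps_nth)

lemma int_fps_cong_power:
  assumes "int_fps f" "int_fps f'" "0 \<le> e" "\<And>i. nv (fps_nth f i - fps_nth f' i) \<le> e"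
  shows "nv (fps_nth (f ^ n) i - fps_nth (f' ^ n) i) \<le> e"
proof (induct n arbitrary: i)
  case (Suc n)
  then show ?case using assms unfolding power_Suc by (intro int_fps_cong_mult int_fps_power)
qed (use assms in simp)

text \<open>The lowest coefficient of absolute value 1 dominates the value.\<close>

lemma nv_coeff_less_1:
  assumes h: "\<And>i. nv (h i) \<le> 1" and gap: "\<And>i. nv (h i) < 1 \<Longrightarrow> nv (h i) \<le> r"
    and z: "nv z < 1" and N: "M \<le> N" and sum: "nv (\<Sum>i<N. h i * z ^ i) \<le> c"
    and r: "\<And>i. i < M \<Longrightarrow> r < nv z ^ i" and c: "\<And>i. i < M \<Longrightarrow> c < nv z ^ i" and i: "i < M"
  shows "nv (h i) < 1"
  using i
proof (induct i rule: less_induct)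
  case (less i)
  show ?case
  proof (rule ccontr)
    assume "\<not> nv (h i) < 1"
    then have hi: "nv (h i) = 1" using h[of i] by simp
    have zi: "0 < nv z ^ i"
      using c[OF less(2)] nv_nonneg order.trans[OF nv_nonneg sum] by linarith
    have "(\<Sum>j<N. h j * z ^ j) = h i * z ^ i + (\<Sum>j\<in>{..<N} - {i}. h j * z ^ j)"
      by (rule sum.remove) (use less N in auto)
    moreover have "nv (\<Sum>j\<in>{..<N} - {i}. h j * z ^ j) < nv z ^ i"
    proof (rule nv_sum_less[OF zi])
      fix j assume "j \<in> {..<N} - {i}"
      then consider "j < i" | "i < j" by fastforce
      \<comment> \<open>Below \<open>i\<close> the induction hypothesis and \<open>gap\<close> bound
        the coefficient by \<open>r\<close>; above \<open>i\<close> the extra factors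
        \<open>z\<close> make the term strictly smaller.\<close>
      then show "nv (h j * z ^ j) < nv z ^ i"
      proof cases
        case 1
        then have "nv (h j) \<le> r" using less by (intro gap) auto
        then have "nv (h j) < nv z ^ i" using r[OF less(2)] by simp
        moreover have "nv (h j * z ^ j) \<le> nv (h j)"
          using z by (intro nv_mult_le_right nv_power_le_1) auto
        ultimately show ?thesis by simp
      next
        case 2
        have "nv (h j * z ^ j) \<le> nv (z ^ j)" by (rule nv_mult_le_left) (use h in auto)
        also have "\<dots> < nv z ^ i"
        proof (cases "z = 0")
          case True
          then show ?thesis using zi 2 by (simp add: power_0_left)
        next
          case False
          then show ?thesis unfolding nv_power using 2 z by (intro power_strict_decreasing) auto
        qed
        finally show ?thesis .
      qed
    qed
    ultimately have "nv (\<Sum>j<N. h j * z ^ j) = nv z ^ i"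
      using hi by (simp add: nv_add_eq_left nv_mult nv_power)
    then show False using sum c[OF less(2)] by simp
  qed
qed

end

section \<open>The tower\<close>

lemma subfield_adjoin: "subfield (adjoin K t) (amb :: 'a :: field ring)"
  unfolding adjoin_def using field.generate_field_is_subfield[OF amb_field] by simp

lemma adjoin_incl: "K \<subseteq> adjoin K t" "t \<in> adjoin K t"
  unfolding adjoin_def by (auto intro: generate_field.incl)

lemma adjoin_least:
  assumes "subfield E (amb :: 'a :: field ring)" "K \<subseteq> E" "t \<in> E"
  shows "adjoin K t \<subseteq> E"
  unfolding adjoin_def using field.generate_field_min_subfield1[OF amb_field _ assms(1)] assms(2,3) by simp

text \<open>The equation of \<open>u\<close> writes \<open>t\<close> as a polynomial in
  \<open>u\<close> over \<open>K\<close>, so adjoining \<open>u\<close> to \<open>K\<close> already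
  yields \<open>F\<close>.\<close>

lemma (in eisenstein_step) adjoin_eq_L:
  assumes F: "F = adjoin K t" and a: "\<And>i. 1 \<le> i \<Longrightarrow> i < d \<Longrightarrow> a i \<in> K"
  shows "adjoin K u = L"
proof
  have "K \<subseteq> F" using F adjoin_incl(1)[of K t] by simp
  then show "adjoin K u \<subseteq> L" by (intro adjoin_least subfield_L) (auto intro: F_subset_L L_u)
  interpret A: amb_subfield "adjoin K u" by (rule amb_subfield.intro) (rule subfield_adjoin)
  have "u ^ d + (\<Sum>i=1..<d. a i * u ^ i) \<in> adjoin K u"
    using a adjoin_incl[where K = K and t = u]
    by (intro A.add_mem A.power_mem A.sum_mem A.mult_mem) auto
  then have "F \<subseteq> adjoin K u"
    unfolding F root using adjoin_incl(1)[of K u] by (intro adjoin_least subfield_adjoin) auto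
  then show "L \<subseteq> adjoin K u"
    using adjoin_incl(2)[of u K] by (auto simp: L_def intro!: A.sum_mem)
qed

text \<open>The arithmetic of \<open>d\<close> is condensed into \<open>nv_d\<close>,
  \<open>frobenius\<close> and \<open>frobenius_K\<close>: modulo \<open>u 0\<close>, the integer
  \<open>d\<close> vanishes and the power map \<open>d\<close> is additive and trivial on the
  integers of \<open>K\<close>.\<close>

locale coleman_tower = nonarch_abs nv + amb_subfield K
  for nv :: "'a :: field \<Rightarrow> real" and K :: "'a set" +
  fixes a u :: "nat \<Rightarrow> 'a" and d :: nat
  assumes u0_mem: "u 0 \<in> K" and nv_u0_pos: "0 < nv (u 0)" and nv_u0_less: "nv (u 0) < 1"
    and discrete: "\<And>y. y \<in> K \<Longrightarrow> nv y < 1 \<Longrightarrow> nv y \<le> nv (u 0)"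
    and d_ge_2: "2 \<le> d" and nv_d: "nv (of_nat d) \<le> nv (u 0)"
    and a_mem: "\<And>i. 1 \<le> i \<Longrightarrow> i < d \<Longrightarrow> a i \<in> K"
    and nv_a: "\<And>i. 1 \<le> i \<Longrightarrow> i < d \<Longrightarrow> nv (a i) \<le> nv (u 0)"
    and root: "\<And>n. u (Suc n) ^ d = u n - (\<Sum>i=1..<d. a i * u (Suc n) ^ i)"
    and frobenius: "\<And>x y. nv x \<le> 1 \<Longrightarrow> nv y \<le> 1 \<Longrightarrow> nv ((x + y) ^ d - (x ^ d + y ^ d)) \<le> nv (u 0)"
    and frobenius_K: "\<And>c. c \<in> K \<Longrightarrow> nv c \<le> 1 \<Longrightarrow> nv (c ^ d - c) \<le> nv (u 0)"
    and complete: "\<And>s. (\<And>n. s n \<in> K) \<Longrightarrow> (\<And>e. e > 0 \<Longrightarrow> \<exists>N. \<forall>m\<ge>N. \<forall>n\<ge>N. nv (s m - s n) < e)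
        \<Longrightarrow> \<exists>y\<in>K. (\<lambda>n. nv (s n - y)) \<longlonglongrightarrow> 0"
begin

abbreviation Kn :: "nat \<Rightarrow> 'a set"
  where "Kn n \<equiv> adjoin K (u n)"

abbreviation \<pi> :: 'a
  where "\<pi> \<equiv> u 0"

lemma Kn_0: "Kn 0 = K"
  using adjoin_incl(1)[of K "u 0"] adjoin_least[OF subfield_F subset_refl u0_mem] by auto

text \<open>The three claims are carried up together: the Eisenstein situation at level
  \<open>n\<close>, the fact that \<open>K_n\<close> has no residues beyond those of
  \<open>K\<close>, and the size of \<open>u n\<close>. The first at level \<open>n\<close> yields
  all three at level \<open>n + 1\<close>.\<close>

lemma tower_step:
  "eisenstein_step nv (Kn n) a (u n) (u (Suc n)) \<pi> d \<and>
    (\<forall>y\<in>Kn n. nv y \<le> 1 \<longrightarrow> (\<exists>c\<in>K. nv c \<le> 1 \<and> nv (y - c) < 1)) \<and> nv (u n) ^ (d ^ n) = nv \<pi>"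
proof (induct n)
  case 0
  have "eisenstein_step nv K a (u 0) (u (Suc 0)) \<pi> d"
    using u0_mem nv_u0_pos nv_u0_less discrete d_ge_2 nv_d a_mem nv_a root[of 0]
    by unfold_locales auto
  then show ?case by (auto simp: Kn_0)
next
  case (Suc n)
  then interpret s: eisenstein_step nv "Kn n" a "u n" "u (Suc n)" \<pi> d by blast
  have L: "Kn (Suc n) = s.L" by (rule s.adjoin_eq_L) (auto intro: a_mem)
  have "nv \<pi> \<le> nv (u (Suc n))" using s.nv_pi_le s.nv_t_le_u by simp
  moreover have "K \<subseteq> Kn (Suc n)" "u (Suc n) \<in> Kn (Suc n)" by (rule adjoin_incl)+
  ultimately have "eisenstein_step nv (Kn (Suc n)) a (u (Suc n)) (u (Suc (Suc n))) \<pi> d"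
    unfolding eisenstein_step_def eisenstein_step_axioms_def L
    using s.nv_u s.nv_u_pos s.discrete_L nv_u0_pos d_ge_2 nv_d a_mem nv_a root[of "Suc n"] u0_mem
    by (auto simp: nonarch_abs_axioms s.L.amb_subfield_axioms)
  moreover have "\<exists>c\<in>K. nv c \<le> 1 \<and> nv (y - c) < 1" if y: "y \<in> Kn (Suc n)" "nv y \<le> 1" for y
  proof -
    have y0: "s.coord y 0 \<in> Kn n" "nv (s.coord y 0) \<le> 1" "nv (y - s.coord y 0) < 1"
      using y d_ge_2 s.coord_mem[of y 0] s.nv_coord_le_1[of y 0] s.residue_coord_0[of y] s.nv_u(2)
      by (auto simp: L)
    then obtain c where c: "c \<in> K" "nv c \<le> 1" "nv (s.coord y 0 - c) < 1" using Suc by blast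
    have "nv (y - c) < 1" using nv_add_less[OF y0(3) c(3)] by simp
    then show ?thesis using c by blast
  qed
  moreover have "nv (u (Suc n)) ^ (d ^ Suc n) = nv \<pi>"
    using Suc s.nv_u(1) by (simp add: power_mult)
  ultimately show ?case by blast
qed

sublocale step: eisenstein_step nv "Kn n" a "u n" "u (Suc n)" \<pi> d for n
  using tower_step[of n] by blast

lemma Kn_Suc: "Kn (Suc n) = step.L n"
  by (rule step.adjoin_eq_L) (auto intro: a_mem)

lemma K_subset_Kn: "c \<in> K \<Longrightarrow> c \<in> Kn n"
  using adjoin_incl(1)[of K "u n"] by auto

lemma nv_u_power_d_power: "nv (u n) ^ (d ^ n) = nv \<pi>"
  using tower_step[of n] by blast

lemma nv_u_less_1: "nv (u n) < 1"
  by (rule step.nv_t_less)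

lemma nv_u_le_1: "nv (u n) \<le> 1"
  using nv_u_less_1[of n] by simp

lemma nv_u_pos: "0 < nv (u n)"
  by (rule step.nv_t_pos)

lemma less_d_power: "n < d ^ n"
  using d_ge_2 power_mono[of 2 d n] less_exp[of n] by linarith

lemma nv_u_power_gt_pi: "i < d ^ n \<Longrightarrow> nv \<pi> < nv (u n) ^ i"
  using power_strict_decreasing[of i "d ^ n" "nv (u n)"] nv_u_pos[of n] nv_u_less_1[of n]
  by (simp add: nv_u_power_d_power)

text \<open>\<open>nv (u n)\<close> is the root of order \<open>d ^ n\<close> of
  \<open>nv \<pi>\<close> and tends to 1.\<close>

lemma ex_nv_u_power_gt:
  assumes "r < 1"
  shows "\<exists>n. r < nv (u n) ^ i"
proof -
  have "(\<lambda>n. nv (u n)) = (\<lambda>n. root (d ^ n) (nv \<pi>))"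
    by (rule ext, rule real_root_pos_unique[symmetric]) (use d_ge_2 in \<open>simp_all add: nv_u_power_d_power\<close>)
  then have "(\<lambda>n. nv (u n)) \<longlonglongrightarrow> 1 \<longleftrightarrow> (\<lambda>n. root (d ^ n) (nv \<pi>)) \<longlonglongrightarrow> 1"
    by (rule arg_cong)
  moreover have "(\<lambda>n. root (d ^ n) (nv \<pi>)) \<longlonglongrightarrow> 1"
  proof (rule filterlim_compose[OF LIMSEQ_root_const[OF nv_u0_pos]])
    show "filterlim (\<lambda>n. d ^ n) sequentially sequentially"
      by (rule filterlim_at_top_mono[OF filterlim_ident])
        (use less_d_power less_imp_le in \<open>auto intro!: always_eventually\<close>)
  qed
  ultimately have "(\<lambda>n. nv (u n)) \<longlonglongrightarrow> 1" by blast
  then have "(\<lambda>n. nv (u n) ^ i) \<longlonglongrightarrow> 1 ^ i" by (rule tendsto_power)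
  then have "\<forall>\<^sub>F n in sequentially. r < nv (u n) ^ i"
    using order_tendstoD(1)[of _ "1 ^ i" sequentially r] assms by simp
  then show ?thesis using eventually_happens'[OF sequentially_bot] by blast
qed

section \<open>Power series over the integers of \<open>K\<close> and their values along the
  tower\<close>

definition OK_fps :: "'a fps \<Rightarrow> bool"
  where "OK_fps f \<longleftrightarrow> (\<forall>i. fps_nth f i \<in> K) \<and> int_fps f"

lemma OK_fpsD: "OK_fps f \<Longrightarrow> fps_nth f i \<in> K" "OK_fps f \<Longrightarrow> int_fps f"
  "OK_fps f \<Longrightarrow> nv (fps_nth f i) \<le> 1"
  by (auto simp: OK_fps_def int_fps_nth)

lemma OK_fpsI: "(\<And>i. fps_nth f i \<in> K) \<Longrightarrow> (\<And>i. nv (fps_nth f i) \<le> 1) \<Longrightarrow> OK_fps f"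
  by (auto simp: OK_fps_def int_fps_def)

lemma OK_fps_0 [simp]: "OK_fps 0" by (simp add: OK_fps_def)

lemma OK_fps_1 [simp]: "OK_fps 1" by (simp add: OK_fps_def)

lemma OK_fps_X_power [simp]: "OK_fps (fps_X ^ n)"
  by (simp add: OK_fps_def fps_X_power_nth)

lemma OK_fps_const: "c \<in> K \<Longrightarrow> nv c \<le> 1 \<Longrightarrow> OK_fps (fps_const c)"
  by (auto intro: OK_fpsI)

lemma OK_fps_uminus: "OK_fps f \<Longrightarrow> OK_fps (- f)"
  by (auto simp: OK_fps_def int_fps_uminus)

lemma OK_fps_add: "OK_fps f \<Longrightarrow> OK_fps g \<Longrightarrow> OK_fps (f + g)"
  by (auto simp: OK_fps_def int_fps_add)

lemma OK_fps_diff: "OK_fps f \<Longrightarrow> OK_fps g \<Longrightarrow> OK_fps (f - g)"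
  by (auto simp: OK_fps_def int_fps_diff)

lemma OK_fps_mult: "OK_fps f \<Longrightarrow> OK_fps g \<Longrightarrow> OK_fps (f * g)"
  by (auto simp: OK_fps_def int_fps_mult fps_mult_nth intro!: sum_mem)

lemma OK_fps_power: "OK_fps f \<Longrightarrow> OK_fps (f ^ n)"
  by (induct n) (auto intro: OK_fps_mult)

lemma OK_fps_sum: "(\<And>i. i \<in> I \<Longrightarrow> OK_fps (f i)) \<Longrightarrow> OK_fps (sum f I)"
  by (induct I rule: infinite_finite_induct) (auto intro: OK_fps_add)

lemma OK_fps_prod: "(\<And>i. i \<in> I \<Longrightarrow> OK_fps (f i)) \<Longrightarrow> OK_fps (prod f I)"
  by (induct I rule: infinite_finite_induct) (auto intro: OK_fps_mult)

lemma OK_fps_compose: "OK_fps f \<Longrightarrow> OK_fps g \<Longrightarrow> OK_fps (f oo g)"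
  using OK_fpsD(1) OK_fps_power[of g]
  by (auto simp: OK_fps_def[of "f oo g"] int_fps_compose OK_fpsD(2) fps_compose_nth intro!: sum_mem mult_mem)

lemma OK_fps_signof [simp]: "OK_fps (signof p)"
  by (auto simp: sign_def OK_fps_uminus)

lemma OK_fps_det:
  "A \<in> carrier_mat n n \<Longrightarrow> (\<And>i j. i < n \<Longrightarrow> j < n \<Longrightarrow> OK_fps (A $$ (i, j))) \<Longrightarrow> OK_fps (det A)"
  unfolding det_def' by (intro OK_fps_sum OK_fps_mult OK_fps_prod OK_fps_signof)
    (auto simp: permutes_in_image)

lemma OK_fps_divide_pi:
  assumes "OK_fps h" "\<And>i. nv (fps_nth h i) \<le> nv \<pi>"
  obtains h' where "OK_fps h'" "h = fps_const \<pi> * h'"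
proof
  have "nv (inverse \<pi> * fps_nth h i) \<le> 1" for i
    unfolding nv_mult nv_inverse using assms(2)[of i] nv_u0_pos by (simp add: field_simps)
  then show "OK_fps (fps_const (inverse \<pi>) * h)"
    using assms u0_mem OK_fpsD(1) by (intro OK_fpsI) auto
  show "h = fps_const \<pi> * (fps_const (inverse \<pi>) * h)"
    using nv_u0_pos by (simp add: mult.assoc[symmetric])
qed

lemma partial_sum_Kn: "OK_fps f \<Longrightarrow> (\<Sum>i<N. fps_nth f i * u n ^ i) \<in> Kn n"
  using adjoin_incl(2)[of "u n" K] K_subset_Kn OK_fpsD(1)
  by (intro step.sum_mem step.mult_mem step.power_mem) auto

text \<open>A sufficiently long partial sum serves as value and lies in \<open>K_n\<close>.\<close>

lemma ex_apx_Kn: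
  assumes "OK_fps f" "0 < e" "e \<le> 1"
  obtains y where "y \<in> Kn n" "nv y \<le> 1" "apx e f (u n) y"
  using ex_apx_partial_sum[OF OK_fpsD(2)[OF assms(1)] nv_u_less_1 assms(2), of n]
    partial_sum_Kn[OF assms(1)] apx_nv_le_1[OF OK_fpsD(2)[OF assms(1)] nv_u_le_1 assms(3)] by blast

lemma nv_pi_power: "0 < nv \<pi> ^ k" "nv \<pi> ^ k \<le> 1" "nv \<pi> * nv \<pi> ^ k \<le> nv \<pi> ^ k"
  using nv_u0_pos nv_u0_less mult_right_mono[of "nv \<pi>" 1 "nv \<pi> ^ k"] by (auto simp: power_le_one)

text \<open>Since \<open>nv (u n)\<close> tends to 1, a series that is small at all \<open>u n\<close> has no unit coefficient.\<close>

lemma coeff_le_pi_if_small: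
  assumes h: "OK_fps h" and c: "c < 1" and small: "\<And>n. apx c h (u n) 0"
  shows "nv (fps_nth h i) \<le> nv \<pi>"
proof -
  obtain n where n: "max c (nv \<pi>) < nv (u n) ^ i"
    using ex_nv_u_power_gt[of "max c (nv \<pi>)" i] c nv_u0_less by auto
  have pow: "nv (u n) ^ i \<le> nv (u n) ^ j" if "j \<le> i" for j
    using that nv_u_pos[of n] nv_u_less_1[of n] by (intro power_decreasing) auto
  obtain N where N: "nv (0 - (\<Sum>i<N. fps_nth h i * u n ^ i)) \<le> c" "Suc i \<le> N"
  proof -
    have "\<forall>\<^sub>F N in sequentially. nv (0 - (\<Sum>i<N. fps_nth h i * u n ^ i)) \<le> c \<and> Suc i \<le> N"
      using small[of n] eventually_ge_at_top[of "Suc i"] unfolding apx_def by (rule eventually_conj)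
    then show ?thesis using that eventually_happens'[OF sequentially_bot] by blast
  qed
  have "nv (fps_nth h i) < 1"
  proof (rule nv_coeff_less_1[where r = "nv \<pi>" and z = "u n" and M = "Suc i" and N = N and c = c])
    show "nv (fps_nth h j) \<le> nv \<pi>" if "nv (fps_nth h j) < 1" for j
      by (rule discrete[OF OK_fpsD(1)[OF h] that])
    show "nv \<pi> < nv (u n) ^ j" "c < nv (u n) ^ j" if "j < Suc i" for j
      using pow[of j] that n by auto
  qed (use N OK_fpsD(3)[OF h] nv_u_less_1 in auto)
  then show ?thesis by (rule discrete[OF OK_fpsD(1)[OF h]])
qed

text \<open>Smallness at all \<open>u n\<close> makes every coefficient divisible by \<pi>; dividing
  by \<pi> lowers the exponent by one.\<close>

lemma coeff_le_pi_power:
  assumes "OK_fps h" "\<And>n. apx (nv \<pi> ^ k) h (u n) 0"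
  shows "nv (fps_nth h i) \<le> nv \<pi> ^ k"
  using assms
proof (induct k arbitrary: h i)
  case 0
  then show ?case by (simp add: OK_fpsD(3))
next
  case (Suc k)
  have "nv \<pi> ^ Suc k < 1"
    using power_strict_decreasing[of 0 "Suc k" "nv \<pi>"] nv_u0_pos nv_u0_less by simp
  then have "nv (fps_nth h j) \<le> nv \<pi>" for j
    using coeff_le_pi_if_small[OF Suc(2) _ Suc(3)] by blast
  then obtain h' where h': "OK_fps h'" "h = fps_const \<pi> * h'"
    using OK_fps_divide_pi[OF Suc(2)] by blast
  have "apx (nv \<pi> ^ k) h' (u n) 0" for n
    using Suc(3)[of n] h'(2) apx_smult[of \<pi> "nv \<pi> ^ k" h' "u n" 0] nv_u0_pos by simp
  then have "nv (fps_nth h' i) \<le> nv \<pi> ^ k" using Suc(1)[OF h'(1)] by blast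
  then show ?case using h'(2) by (simp add: nv_mult mult_left_mono)
qed

section \<open>Expanding power series in \<open>T\<close> over power series in \<open>P(T)\<close>,
  and the norm operator\<close>

definition P_fps :: "'a fps"
  where "P_fps = fps_X ^ d + (\<Sum>i=1..<d. fps_const (a i) * fps_X ^ i)"

lemma OK_P_fps: "OK_fps P_fps"
  unfolding P_fps_def using a_mem nv_a nv_u0_less
  by (intro OK_fps_add OK_fps_sum OK_fps_mult OK_fps_const OK_fps_X_power) (force+)

lemma P_fps_nth_0: "fps_nth P_fps 0 = 0"
  using d_ge_2 by (simp add: P_fps_def fps_sum_nth fps_X_power_nth)

lemma apx_P_fps:
  assumes "0 \<le> e"
  shows "apx e P_fps (u (Suc n)) (u n)"
proof -
  have "apx e P_fps (u (Suc n)) (u (Suc n) ^ d + (\<Sum>i=1..<d. a i * u (Suc n) ^ i))"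
    unfolding P_fps_def using assms nv_a nv_u0_less
    by (intro apx_add apx_sum apx_const_mult apx_X_power) (force+)
  then show ?thesis using root[of n] by simp
qed

lemma nv_P_fps_cong: "nv (fps_nth P_fps m - fps_nth (fps_X ^ d) m) \<le> nv \<pi>"
proof -
  have "fps_nth P_fps m - fps_nth (fps_X ^ d) m = (\<Sum>i=1..<d. a i * fps_nth (fps_X ^ i) m)"
    by (simp add: P_fps_def fps_sum_nth)
  also have "nv \<dots> \<le> nv \<pi>"
    using nv_a by (intro nv_sum_le nv_mult_le_right) (auto simp: fps_X_power_nth)
  finally show ?thesis .
qed

text \<open>The part of \<open>f\<close> in degrees congruent to \<open>i\<close> modulo
  \<open>d\<close>, reindexed so that \<open>f\<close> is the sum of
  \<open>T^i f_i(T^d)\<close>.\<close>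

definition section_fps :: "'a fps \<Rightarrow> nat \<Rightarrow> 'a fps"
  where "section_fps f i = Abs_fps (\<lambda>j. fps_nth f (i + d * j))"

lemma OK_section_fps: "OK_fps f \<Longrightarrow> OK_fps (section_fps f i)"
  by (auto simp: section_fps_def OK_fps_def int_fps_def)

lemma section_fps_sum: "(\<Sum>i<d. fps_X ^ i * (section_fps f i oo fps_X ^ d)) = f"
proof (rule fps_ext)
  fix m
  have comp: "fps_nth (section_fps f i oo fps_X ^ d) l = (if d dvd l then fps_nth f (i + l) else 0)" for i l
  proof -
    have "fps_nth (section_fps f i oo fps_X ^ d) l
        = (\<Sum>j\<in>{0..l}. if l = d * j then fps_nth f (i + l) else 0)"
      unfolding fps_compose_nth power_mult[symmetric]
      by (rule sum.cong) (auto simp: fps_X_power_nth section_fps_def)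
    also have "\<dots> = (if d dvd l then fps_nth f (i + l) else 0)"
    proof (cases "d dvd l")
      case True
      then obtain j where j: "l = d * j" by blast
      have "(\<Sum>j'\<in>{0..l}. if l = d * j' then fps_nth f (i + l) else 0) = (\<Sum>j'\<in>{0..l}. if j' = j then fps_nth f (i + l) else 0)"
        using d_ge_2 j by (intro sum.cong) auto
      then show ?thesis using True j d_ge_2 by simp
    next
      case False
      then show ?thesis by (auto intro!: sum.neutral)
    qed
    finally show ?thesis .
  qed
  have "fps_nth (\<Sum>i<d. fps_X ^ i * (section_fps f i oo fps_X ^ d)) m
      = (\<Sum>i<d. if i = m mod d then fps_nth f m else 0)"
    unfolding fps_sum_nth
  proof (rule sum.cong)
    fix i assume "i \<in> {..<d}"
    then have i: "i < d" by simp
    have "(i \<le> m \<and> d dvd (m - i)) \<longleftrightarrow> i = m mod d"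
    proof
      assume "i \<le> m \<and> d dvd (m - i)"
      then have "m mod d = i mod d" by (metis mod_eq_dvd_iff_nat)
      then show "i = m mod d" using i by simp
    next
      assume "i = m mod d"
      then show "i \<le> m \<and> d dvd (m - i)" by (simp add: dvd_minus_mod)
    qed
    then show "fps_nth (fps_X ^ i * (section_fps f i oo fps_X ^ d)) m = (if i = m mod d then fps_nth f m else 0)"
      by (auto simp: fps_X_power_mult_nth comp not_less)
  qed simp
  also have "\<dots> = fps_nth f m" using d_ge_2 by simp
  finally show "fps_nth (\<Sum>i<d. fps_X ^ i * (section_fps f i oo fps_X ^ d)) m = fps_nth f m" .
qed

text \<open>\<open>P\<close> and \<open>T^d\<close> agree modulo \<pi>, so substituting one for the
  other in \<open>section_fps_sum\<close> changes coefficients only by multiples of \<pi>.\<close>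

lemma section_fps_cong:
  assumes "OK_fps f"
  shows "nv (fps_nth (f - (\<Sum>i<d. fps_X ^ i * (section_fps f i oo P_fps))) m) \<le> nv \<pi>"
proof -
  have "nv (fps_nth (fps_X ^ i * (section_fps f i oo fps_X ^ d)) m - fps_nth (fps_X ^ i * (section_fps f i oo P_fps)) m) \<le> nv \<pi>" for i
  proof (rule int_fps_cong_mult)
    fix l
    have "nv (fps_nth ((fps_X ^ d) ^ j) l - fps_nth (P_fps ^ j) l) \<le> nv \<pi>" for j
      by (rule int_fps_cong_power[OF _ _ _ nv_cong_sym[OF nv_P_fps_cong]])
        (auto intro: OK_fpsD(2)[OF OK_P_fps])
    then show "nv (fps_nth (section_fps f i oo fps_X ^ d) l - fps_nth (section_fps f i oo P_fps) l) \<le> nv \<pi>"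
      unfolding fps_compose_nth using OK_fpsD(3)[OF OK_section_fps[OF assms]] int_fps_cong_power[OF OK_fpsD(2)[OF OK_P_fps] int_fps_X_power _ nv_P_fps_cong]
      by (intro nv_cong_sum) (auto simp: right_diff_distrib[symmetric] nv_minus_commute intro!: nv_mult_le_left)
  qed (auto intro!: OK_fpsD(2) OK_fps_compose OK_section_fps assms OK_P_fps)
  then have "nv (fps_nth (\<Sum>i<d. fps_X ^ i * (section_fps f i oo fps_X ^ d)) m
      - fps_nth (\<Sum>i<d. fps_X ^ i * (section_fps f i oo P_fps)) m) \<le> nv \<pi>"
    unfolding fps_sum_nth by (intro nv_cong_sum) auto
  then show ?thesis by (simp add: section_fps_sum)
qed

text \<open>An approximate form of the freeness of power series in \<open>T\<close> over power series in \<open>P\<close>.\<close>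

lemma ex_section_apx:
  assumes "OK_fps f"
  shows "\<exists>g. (\<forall>i. OK_fps (g i)) \<and> (\<forall>n y. apx (nv \<pi> ^ k) f (u (Suc n)) y \<longrightarrow>
    (\<exists>z. (\<forall>i. z i \<in> Kn n \<and> nv (z i) \<le> 1 \<and> apx (nv \<pi> ^ k) (g i) (u n) (z i)) \<and>
      nv (y - (\<Sum>i<d. z i * u (Suc n) ^ i)) \<le> nv \<pi> ^ k))"
  using assms
proof (induct k arbitrary: f)
  case 0
  have "\<exists>z. (\<forall>i. z i \<in> Kn n \<and> nv (z i) \<le> 1 \<and> apx 1 0 (u n) (z i)) \<and> nv (y - (\<Sum>i<d. z i * u (Suc n) ^ i)) \<le> 1"
    if "apx 1 f (u (Suc n)) y" for n y
    using apx_nv_le_1[OF OK_fpsD(2)[OF 0] nv_u_le_1 _ that]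
    by (intro exI[of _ "\<lambda>_. 0"]) (simp add: apx_0)
  then show ?case by (intro exI[of _ "\<lambda>_. 0"]) simp
next
  case (Suc k)
  \<comment> \<open>\<open>R\<close> has an exact expansion over series in \<open>P\<close> and
    agrees with \<open>f\<close> modulo \<pi>; the remainder, divided by \<pi>, is treated by the
    induction hypothesis.\<close>
  define R where "R = (\<Sum>i<d. fps_X ^ i * (section_fps f i oo P_fps))"
  have R: "OK_fps R" unfolding R_def
    by (intro OK_fps_sum OK_fps_mult OK_fps_compose OK_section_fps OK_P_fps OK_fps_X_power Suc)
  obtain f' where f': "OK_fps f'" "f - R = fps_const \<pi> * f'"
    using OK_fps_divide_pi[OF OK_fps_diff[OF Suc(2) R]] section_fps_cong[OF Suc(2)] unfolding R_def by blast
  obtain g' where g': "\<And>i. OK_fps (g' i)" "\<And>n y. apx (nv \<pi> ^ k) f' (u (Suc n)) y \<Longrightarrow>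
    (\<exists>z. (\<forall>i. z i \<in> Kn n \<and> nv (z i) \<le> 1 \<and> apx (nv \<pi> ^ k) (g' i) (u n) (z i)) \<and>
      nv (y - (\<Sum>i<d. z i * u (Suc n) ^ i)) \<le> nv \<pi> ^ k)"
    using Suc(1)[OF f'(1)] by blast
  \<comment> \<open>Chosen before \<open>n\<close> and \<open>y\<close> are fixed, so that one
    family of series serves every level of the tower.\<close>
  define g where "g i = section_fps f i + fps_const \<pi> * g' i" for i
  have pi0: "\<pi> \<noteq> 0" using nv_u0_pos by auto
  let ?e = "nv \<pi> ^ Suc k"
  have "OK_fps (g i)" for i
    unfolding g_def using u0_mem nv_u0_less
    by (intro OK_fps_add OK_section_fps Suc OK_fps_mult OK_fps_const g'(1)) auto
  moreover have "\<exists>z. (\<forall>i. z i \<in> Kn n \<and> nv (z i) \<le> 1 \<and> apx ?e (g i) (u n) (z i)) \<and>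
      nv (y - (\<Sum>i<d. z i * u (Suc n) ^ i)) \<le> ?e" if y: "apx ?e f (u (Suc n)) y" for n y
  proof -
    have "\<exists>z. z \<in> Kn n \<and> nv z \<le> 1 \<and> apx ?e (section_fps f i) (u n) z" for i
      using ex_apx_Kn[OF OK_section_fps[OF Suc(2)] nv_pi_power(1,2)] by metis
    then obtain z0 where z0: "\<And>i. z0 i \<in> Kn n" "\<And>i. nv (z0 i) \<le> 1" "\<And>i. apx ?e (section_fps f i) (u n) (z0 i)"
      by metis
    let ?S = "\<Sum>i<d. u (Suc n) ^ i * z0 i"
    \<comment> \<open>Since \<open>P\<close> sends \<open>u (Suc n)\<close> to \<open>u n\<close>, a
      section composed with \<open>P\<close> takes at \<open>u (Suc n)\<close> the value of that
      section at \<open>u n\<close>.\<close>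
    have "apx ?e R (u (Suc n)) ?S" unfolding R_def
      using nv_pi_power[of "Suc k"] nv_u_less_1 z0
      by (intro apx_sum apx_mult apx_X_power apx_compose[OF _ _ _ _ _ _ apx_P_fps])
        (auto intro!: OK_fpsD(2) OK_section_fps Suc OK_P_fps P_fps_nth_0 OK_fps_compose)
    from apx_diff[OF y this] have "apx (nv \<pi> * nv \<pi> ^ k) (fps_const \<pi> * f') (u (Suc n)) (\<pi> * ((y - ?S) / \<pi>))"
      using f'(2) pi0 by simp
    then have "apx (nv \<pi> ^ k) f' (u (Suc n)) ((y - ?S) / \<pi>)" using apx_smult[OF pi0] by blast
    from g'(2)[OF this] obtain z' where z': "\<And>i. z' i \<in> Kn n" "\<And>i. nv (z' i) \<le> 1" "\<And>i. apx (nv \<pi> ^ k) (g' i) (u n) (z' i)"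
      "nv ((y - ?S) / \<pi> - (\<Sum>i<d. z' i * u (Suc n) ^ i)) \<le> nv \<pi> ^ k" by blast
    define z where "z i = z0 i + \<pi> * z' i" for i
    have "z i \<in> Kn n" for i
      unfolding z_def by (intro step.add_mem step.mult_mem z0 z' K_subset_Kn u0_mem)
    moreover have "nv (z i) \<le> 1" for i
      using z0 z' nv_u0_less by (auto simp: z_def intro!: nv_add_le nv_mult_le_1)
    moreover have "apx ?e (g i) (u n) (z i)" for i
      unfolding g_def z_def using z0(3)[of i] z'(3)[of i] apx_smult[OF pi0, of "nv \<pi> ^ k"]
      by (intro apx_add) simp_all
    moreover have "nv (y - (\<Sum>i<d. z i * u (Suc n) ^ i)) \<le> ?e"
    proof -
      have "(\<Sum>i<d. z i * u (Suc n) ^ i) = ?S + \<pi> * (\<Sum>i<d. z' i * u (Suc n) ^ i)"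
        by (simp add: z_def algebra_simps sum.distrib sum_distrib_left)
      then have "y - (\<Sum>i<d. z i * u (Suc n) ^ i) = \<pi> * ((y - ?S) / \<pi> - (\<Sum>i<d. z' i * u (Suc n) ^ i))"
        using pi0 by (simp add: right_diff_distrib diff_divide_distrib)
      then show ?thesis using z'(4) by (simp add: nv_mult mult_left_mono)
    qed
    ultimately show ?thesis by blast
  qed
  ultimately show ?case by blast
qed

text \<open>Column \<open>j\<close> of \<open>A\<close> expands \<open>f * T^j\<close> in the powers
  \<open>T^i\<close> over series in \<open>P\<close>, so \<open>A\<close> is multiplication by
  \<open>f\<close>. Evaluated at \<open>u n\<close> it becomes, up to the given precision, the
  matrix of multiplication by the value of \<open>f\<close>, and determinants respect this.\<close>

lemma ex_norm_apx:
  assumes f: "OK_fps f"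
  shows "\<exists>g. OK_fps g \<and> (\<forall>n. \<forall>y\<in>Kn (Suc n). apx (nv \<pi> ^ k) f (u (Suc n)) y \<longrightarrow>
    apx (nv \<pi> ^ k) g (u n) (step.Nm n y))"
proof -
  let ?e = "nv \<pi> ^ k"
  have e: "0 < ?e" "?e \<le> 1" "0 \<le> ?e" using nv_pi_power[of k] by auto
  have fX: "OK_fps (f * fps_X ^ j)" for j by (intro OK_fps_mult f OK_fps_X_power)
  have "\<forall>j. \<exists>g. (\<forall>i. OK_fps (g i)) \<and> (\<forall>n y. apx ?e (f * fps_X ^ j) (u (Suc n)) y \<longrightarrow>
    (\<exists>z. (\<forall>i. z i \<in> Kn n \<and> nv (z i) \<le> 1 \<and> apx ?e (g i) (u n) (z i)) \<and>
      nv (y - (\<Sum>i<d. z i * u (Suc n) ^ i)) \<le> ?e))"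
    using ex_section_apx[OF fX] by blast
  from choice[OF this] obtain M where M': "\<forall>j. (\<forall>i. OK_fps (M j i)) \<and> (\<forall>n y. apx ?e (f * fps_X ^ j) (u (Suc n)) y \<longrightarrow>
    (\<exists>z. (\<forall>i. z i \<in> Kn n \<and> nv (z i) \<le> 1 \<and> apx ?e (M j i) (u n) (z i)) \<and>
      nv (y - (\<Sum>i<d. z i * u (Suc n) ^ i)) \<le> ?e))" ..
  then have M: "OK_fps (M j i)" for i j by blast
  define A where "A = mat d d (\<lambda>(i, j). M j i)"
  have "OK_fps (det A)" by (rule OK_fps_det[of _ d]) (auto simp: A_def M)
  moreover have "apx ?e (det A) (u n) (step.Nm n y)"
    if yK: "y \<in> Kn (Suc n)" and y: "apx ?e f (u (Suc n)) y" for n y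
  proof -
    have yL: "y \<in> step.L n" using yK by (simp add: Kn_Suc)
    have y1: "nv y \<le> 1" using apx_nv_le_1[OF OK_fpsD(2)[OF f] nv_u_le_1 e(2) y] .
    have "apx ?e (f * fps_X ^ j) (u (Suc n)) (y * u (Suc n) ^ j)" for j
      using e nv_u_less_1 y by (intro apx_mult apx_X_power OK_fpsD(2)[OF f]) auto
    then have "\<forall>j. \<exists>z. (\<forall>i. z i \<in> Kn n \<and> nv (z i) \<le> 1 \<and> apx ?e (M j i) (u n) (z i)) \<and>
      nv (y * u (Suc n) ^ j - (\<Sum>i<d. z i * u (Suc n) ^ i)) \<le> ?e" using M' by blast
    from choice[OF this] obtain z where "\<forall>j. (\<forall>i. z j i \<in> Kn n \<and> nv (z j i) \<le> 1 \<and> apx ?e (M j i) (u n) (z j i)) \<and>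
      nv (y * u (Suc n) ^ j - (\<Sum>i<d. z j i * u (Suc n) ^ i)) \<le> ?e" ..
    then have z: "\<And>i j. z j i \<in> Kn n" "\<And>i j. nv (z j i) \<le> 1" "\<And>i j. apx ?e (M j i) (u n) (z j i)"
      "\<And>j. nv (y * u (Suc n) ^ j - (\<Sum>i<d. z j i * u (Suc n) ^ i)) \<le> ?e"
      by blast+
    define Z where "Z = mat d d (\<lambda>(i, j). z j i)"
    have "apx ?e (det A) (u n) (det Z)"
      by (rule apx_det[of _ d]) (use e nv_u_less_1 M OK_fpsD(2) z in \<open>auto simp: A_def Z_def\<close>)
    \<comment> \<open>The entries of \<open>Z\<close> only approximate the true coordinates;
      integrality of coordinates transfers the precision from elements to entries.\<close>
    moreover have "nv (step.Nm n y - det Z) \<le> ?e"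
      unfolding step.Nm_def
    proof (rule nv_cong_det[of _ d])
      fix i j assume ij: "i < d" "j < d"
      let ?s = "\<Sum>i<d. z j i * u (Suc n) ^ i"
      have sL: "?s \<in> step.L n" by (rule step.L_I) (rule z)
      have "step.coord n (y * u (Suc n) ^ j - ?s) i = step.coord n (y * u (Suc n) ^ j) i - step.coord n ?s i"
        by (rule step.coord_diff[OF step.L_mult_u_power[OF yL] sL ij(1)])
      also have "step.coord n ?s i = z j i" by (rule step.coord_eq) (use z ij in auto)
      finally have "step.coord n (y * u (Suc n) ^ j) i - z j i = step.coord n (y * u (Suc n) ^ j - ?s) i" ..
      moreover have "nv \<dots> \<le> ?e"
        by (rule step.nv_coord_le_pi[OF step.L_diff[OF step.L_mult_u_power[OF yL] sL] z(4) ij(1)])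
      ultimately show "nv (step.mulmat n y $$ (i, j) - Z $$ (i, j)) \<le> ?e"
        using ij by (simp add: Z_def)
    qed (use step.nv_mulmat_le_1[OF yL y1] z e in \<open>auto simp: Z_def\<close>)
    ultimately show ?thesis by (rule apx_cong)
  qed
  ultimately show ?thesis by blast
qed

end

section \<open>Coleman power series of norm-compatible sequences\<close>

context coleman_tower
begin

text \<open>Digit by digit: \<open>u n\<close> is a uniformizer of \<open>K_n\<close>, and each
  residue is represented by an integer of \<open>K\<close>.\<close>

lemma ex_expansion:
  assumes y: "y \<in> Kn n" "nv y \<le> 1"
  shows "\<exists>c. (\<forall>i. c i \<in> K \<and> nv (c i) \<le> 1) \<and> nv (y - (\<Sum>i<N. c i * u n ^ i)) \<le> nv (u n) ^ N"
proof (induct N)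
  case 0
  show ?case using y by (intro exI[of _ "\<lambda>_. 0"]) simp
next
  case (Suc N)
  then obtain c where c: "\<And>i. c i \<in> K" "\<And>i. nv (c i) \<le> 1"
    and le: "nv (y - (\<Sum>i<N. c i * u n ^ i)) \<le> nv (u n) ^ N" by blast
  define r where "r = (y - (\<Sum>i<N. c i * u n ^ i)) / u n ^ N"
  have u0: "u n \<noteq> 0" using nv_u_pos[of n] by auto
  have "r \<in> Kn n" unfolding r_def
    by (intro step.divide_mem step.diff_mem y step.sum_mem step.mult_mem step.power_mem K_subset_Kn c step.t_mem)
  moreover have "nv r \<le> 1"
    using le u0 by (simp add: r_def nv_divide nv_power divide_le_eq_1)
  ultimately obtain b where b: "b \<in> K" "nv b \<le> 1" "nv (r - b) < 1"
    using tower_step[of n] by blast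
  have rb: "nv (r - b) \<le> nv (u n)"
    by (rule step.discrete[OF step.diff_mem[OF \<open>r \<in> Kn n\<close> K_subset_Kn[OF b(1)]] b(3)])
  have sum: "(\<Sum>i<N. (c(N := b)) i * u n ^ i) = (\<Sum>i<N. c i * u n ^ i)"
    by (rule sum.cong) auto
  have "r * u n ^ N = y - (\<Sum>i<N. c i * u n ^ i)" using u0 by (simp add: r_def)
  then have "y - (\<Sum>i<Suc N. (c(N := b)) i * u n ^ i) = (r - b) * u n ^ N"
    unfolding sum.lessThan_Suc sum by (simp add: left_diff_distrib)
  then have "nv (y - (\<Sum>i<Suc N. (c(N := b)) i * u n ^ i)) \<le> nv (u n) ^ Suc N"
    using rb by (simp add: nv_mult nv_power mult_right_mono)
  then show ?case using b c by (intro exI[of _ "c(N := b)"]) auto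
qed

lemma ex_apx_mod_pi:
  assumes "y \<in> Kn n" "nv y \<le> 1"
  shows "\<exists>F. OK_fps F \<and> apx (nv \<pi>) F (u n) y"
proof -
  \<comment> \<open>The length \<open>d ^ n\<close> is chosen because \<open>u n ^ (d ^ n)\<close>
    has the size of \<pi>.\<close>
  obtain c where c: "\<And>i. c i \<in> K" "\<And>i. nv (c i) \<le> 1"
    and le: "nv (y - (\<Sum>i<d ^ n. c i * u n ^ i)) \<le> nv \<pi>"
    using ex_expansion[OF assms, of "d ^ n"] by (auto simp: nv_u_power_d_power)
  define F where "F = Abs_fps (\<lambda>i. if i < d ^ n then c i else 0)"
  have "OK_fps F" using c by (intro OK_fpsI) (auto simp: F_def)
  moreover have "apx (nv \<pi>) F (u n) y"
    unfolding apx_def using eventually_ge_at_top[of "d ^ n"]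
  proof eventually_elim
    case (elim N)
    have "(\<Sum>i<N. fps_nth F i * u n ^ i) = (\<Sum>i<d ^ n. c i * u n ^ i)"
      by (rule sum.mono_neutral_cong_right) (use elim in \<open>auto simp: F_def\<close>)
    then show ?case using le by simp
  qed
  ultimately show ?thesis by blast
qed

lemma frobenius_sum:
  assumes "\<And>i. i \<in> I \<Longrightarrow> nv (f i) \<le> 1"
  shows "nv (sum f I ^ d - (\<Sum>i\<in>I. f i ^ d)) \<le> nv \<pi>"
  using assms
proof (induct I rule: infinite_finite_induct)
  case (insert i I)
  have "nv ((f i + sum f I) ^ d - (f i ^ d + sum f I ^ d)) \<le> nv \<pi>"
    using insert by (intro frobenius nv_sum_le) auto
  moreover have "nv ((f i ^ d + sum f I ^ d) - (f i ^ d + (\<Sum>i\<in>I. f i ^ d))) \<le> nv \<pi>"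
    using insert by simp
  ultimately show ?case using insert(1,2) by (auto intro: nv_cong_trans)
qed (use d_ge_2 in \<open>auto simp: power_0_left\<close>)

text \<open>Modulo \<pi> the power \<open>d\<close> passes through the sum, fixes the coefficients
  and turns \<open>u (Suc n)\<close> into \<open>u n\<close>.\<close>

lemma frobenius_apx:
  assumes F: "OK_fps F" and y: "apx (nv \<pi>) F (u (Suc n)) y" and z: "apx (nv \<pi>) F (u n) z"
  shows "nv (y ^ d - z) \<le> nv \<pi>"
proof -
  have pi: "0 \<le> nv \<pi>" "nv \<pi> \<le> 1" using nv_u0_less by auto
  have "\<forall>\<^sub>F N in sequentially. nv (y - (\<Sum>i<N. fps_nth F i * u (Suc n) ^ i)) \<le> nv \<pi> \<and>
      nv (z - (\<Sum>i<N. fps_nth F i * u n ^ i)) \<le> nv \<pi>"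
    using y z unfolding apx_def by (rule eventually_conj)
  then obtain N where N: "nv (y - (\<Sum>i<N. fps_nth F i * u (Suc n) ^ i)) \<le> nv \<pi>"
      "nv (z - (\<Sum>i<N. fps_nth F i * u n ^ i)) \<le> nv \<pi>"
    using eventually_happens'[OF sequentially_bot] by blast
  let ?S = "\<Sum>i<N. fps_nth F i * u (Suc n) ^ i"
  have "nv (y ^ d - ?S ^ d) \<le> nv \<pi>"
    using N(1) pi apx_nv_le_1[OF OK_fpsD(2)[OF F] nv_u_le_1 pi(2) y]
      nv_partial_sum_le_1[OF OK_fpsD(2)[OF F] nv_u_le_1] by (intro nv_cong_power) auto
  moreover have "nv (?S ^ d - (\<Sum>i<N. (fps_nth F i * u (Suc n) ^ i) ^ d)) \<le> nv \<pi>"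
    by (intro frobenius_sum nv_mult_le_1 nv_power_le_1 OK_fpsD(3)[OF F] nv_u_le_1)
  moreover have "nv ((\<Sum>i<N. (fps_nth F i * u (Suc n) ^ i) ^ d) - (\<Sum>i<N. fps_nth F i * u n ^ i)) \<le> nv \<pi>"
  proof (rule nv_cong_sum[OF pi(1)])
    fix i
    have "(fps_nth F i * u (Suc n) ^ i) ^ d = fps_nth F i ^ d * (u (Suc n) ^ d) ^ i"
      by (simp add: power_mult_distrib power_mult[symmetric] mult.commute)
    moreover have "nv (fps_nth F i ^ d * (u (Suc n) ^ d) ^ i - fps_nth F i * u n ^ i) \<le> nv \<pi>"
      using pi step.nv_u_power_d_cong
      by (intro nv_cong_mult nv_cong_power nv_power_le_1 OK_fpsD(3)[OF F] nv_u_le_1 frobenius_K OK_fpsD(1)[OF F]) auto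
    ultimately show "nv ((fps_nth F i * u (Suc n) ^ i) ^ d - fps_nth F i * u n ^ i) \<le> nv \<pi>" by simp
  qed
  ultimately have "nv (y ^ d - (\<Sum>i<N. fps_nth F i * u n ^ i)) \<le> nv \<pi>"
    by (blast intro: nv_cong_trans)
  then show ?thesis using nv_cong_sym[OF N(2)] by (rule nv_cong_trans)
qed

text \<open>The norm operator on power series is the identity modulo \<open>\<pi>\<close>: if \<open>g\<close> represents the norms
  of \<open>F\<close>, then \<open>(g - F) ^ d\<close> vanishes modulo \<open>\<pi>\<close> at every \<open>u n\<close>.\<close>

lemma norm_apx_mod_pi:
  assumes F: "OK_fps F" and y: "y \<in> Kn (Suc n)" "apx (nv \<pi>) F (u (Suc n)) y"
  shows "apx (nv \<pi>) F (u n) (step.Nm n y)"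
proof -
  have pi: "0 < nv \<pi>" "nv \<pi> \<le> 1" using nv_u0_less nv_u0_pos by auto
  \<comment> \<open>The root bounds an element whose power \<open>d\<close> is at most
    \<open>nv \<pi>\<close>; \<open>nv \<pi>\<close> is the precision of the values used. Only
    \<open>c < 1\<close> matters afterwards.\<close>
  define c where "c = max (nv \<pi>) (root d (nv \<pi>))"
  have c1: "c < 1" using nv_u0_less d_ge_2 by (simp add: c_def)
  obtain g where g: "OK_fps g"
    "\<And>n y. y \<in> Kn (Suc n) \<Longrightarrow> apx (nv \<pi>) F (u (Suc n)) y \<Longrightarrow> apx (nv \<pi>) g (u n) (step.Nm n y)"
    using ex_norm_apx[OF F, of 1] by auto
  have "apx c (g - F) (u m) 0" for m
  proof -
    obtain w where w: "w \<in> Kn (Suc m)" "nv w \<le> 1" "apx (nv \<pi>) F (u (Suc m)) w"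
      using ex_apx_Kn[OF F pi] by blast
    obtain z where z: "z \<in> Kn m" "nv z \<le> 1" "apx (nv \<pi>) F (u m) z"
      using ex_apx_Kn[OF F pi] by blast
    have wL: "w \<in> step.L m" using w by (simp add: Kn_Suc)
    have N1: "nv (step.Nm m w) \<le> 1" by (rule step.nv_Nm_le_1[OF wL w(2)])
    have "nv (step.Nm m (w ^ d) - step.Nm m z) \<le> nv \<pi> ^ 1"
      using frobenius_apx[OF F w(3) z(3)] w z
      by (intro step.nv_cong_Nm step.L_power wL nv_power_le_1 step.F_subset_L) auto
    then have "nv (step.Nm m w ^ d - z ^ d) \<le> nv \<pi>"
      by (simp add: step.Nm_power[OF wL] step.Nm_F[OF z(1)])
    \<comment> \<open>Additivity is applied to the sum of \<open>step.Nm m w - z\<close> and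
      \<open>z\<close>, which avoids the sign of \<open>(- z) ^ d\<close>.\<close>
    moreover have "nv ((step.Nm m w - z) ^ d - (step.Nm m w ^ d - z ^ d)) \<le> nv \<pi>"
      using frobenius[of "step.Nm m w - z" z] N1 z(2) nv_cong_sym by (force simp: algebra_simps nv_diff_le)
    ultimately have "nv ((step.Nm m w - z) ^ d) \<le> nv \<pi>"
      using nv_add_le by fastforce
    then have "nv (step.Nm m w - z) \<le> root d (nv \<pi>)"
      using real_root_le_mono[of d "nv (step.Nm m w - z) ^ d" "nv \<pi>"] d_ge_2
      by (simp add: nv_power real_root_power_cancel)
    then have "nv (0 - (step.Nm m w - z)) \<le> c" unfolding diff_0 nv_minus by (simp add: c_def)
    moreover have "apx c (g - F) (u m) (step.Nm m w - z)"
      using apx_diff[OF g(2)[OF w(1,3)] z(3)] by (rule apx_mono) (simp add: c_def)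
    ultimately show ?thesis by (rule apx_cong[rotated])
  qed
  then have "nv (fps_nth (g - F) i) \<le> nv \<pi>" for i
    by (rule coeff_le_pi_if_small[OF OK_fps_diff[OF g(1) F] c1])
  then show ?thesis
    using apx_fps_cong[OF g(2)[OF y]] nv_u_le_1 by simp
qed

text \<open>The one-point variant of \<open>coeff_le_pi_if_small\<close>: a single
  \<open>u n\<close> controls exactly the indices with \<open>nv (u n) ^ i\<close> above
  \<open>nv \<pi>\<close>, namely those below \<open>d ^ n\<close>.\<close>

lemma coeff_cong_if_apx:
  assumes f: "OK_fps f" and g: "OK_fps g" and y: "apx (nv \<pi>) f (u n) y" "apx (nv \<pi>) g (u n) y"
    and i: "i < d ^ n"
  shows "nv (fps_nth f i - fps_nth g i) \<le> nv \<pi>"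
proof -
  let ?h = "f - g"
  have h: "OK_fps ?h" by (rule OK_fps_diff[OF f g])
  have "apx (nv \<pi>) ?h (u n) 0" using apx_diff[OF y] by simp
  then have "\<forall>\<^sub>F N in sequentially. nv (0 - (\<Sum>i<N. fps_nth ?h i * u n ^ i)) \<le> nv \<pi> \<and> d ^ n \<le> N"
    using eventually_ge_at_top[of "d ^ n"] unfolding apx_def by (rule eventually_conj)
  then obtain N where N: "nv (0 - (\<Sum>i<N. fps_nth ?h i * u n ^ i)) \<le> nv \<pi>" "d ^ n \<le> N"
    using eventually_happens'[OF sequentially_bot] by blast
  have "nv (fps_nth ?h i) < 1"
  proof (rule nv_coeff_less_1[where r = "nv \<pi>" and z = "u n" and M = "d ^ n" and N = N and c = "nv \<pi>"])
    show "nv (fps_nth ?h j) \<le> nv \<pi>" if "nv (fps_nth ?h j) < 1" for j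
      by (rule discrete[OF OK_fpsD(1)[OF h] that])
    show "nv (\<Sum>i<N. fps_nth ?h i * u n ^ i) \<le> nv \<pi>" using N(1) by (metis diff_0 nv_minus)
  qed (use N OK_fpsD(3)[OF h] nv_u_less_1 nv_u_power_gt_pi i in auto)
  then show ?thesis using discrete[OF OK_fpsD(1)[OF h]] by simp
qed

section \<open>Existence and uniqueness of the series for a fixed norm-compatible sequence\<close>

context
  fixes x :: "nat \<Rightarrow> 'a"
  assumes x_mem: "\<And>n. x n \<in> Kn n" and nv_x: "\<And>n. nv (x n) \<le> 1"
    and norm_x: "\<And>n. field_norm (Kn n) (Kn (Suc n)) (x (Suc n)) = x n"
begin

lemma x_mem_L: "x (Suc n) \<in> step.L n"
  using x_mem[of "Suc n"] by (simp add: Kn_Suc)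

lemma Nm_x: "step.Nm n (x (Suc n)) = x n"
  using norm_x[of n] step.field_norm_L[OF x_mem_L, of n] by (simp add: Kn_Suc)

text \<open>A series matching \<open>x (Suc n)\<close> at \<open>u (Suc n)\<close> also matches its
  norm \<open>x n\<close> at \<open>u n\<close>. Series chosen separately for each level therefore
  have compatible coefficients and glue to one series.\<close>

lemma ex_coleman_mod_pi: "\<exists>f. OK_fps f \<and> (\<forall>n. apx (nv \<pi>) f (u n) (x n))"
proof -
  have "\<forall>n. \<exists>F. OK_fps F \<and> apx (nv \<pi>) F (u n) (x n)"
    using ex_apx_mod_pi[OF x_mem nv_x] by blast
  from choice[OF this] obtain F where F: "\<And>n. OK_fps (F n)" "\<And>n. apx (nv \<pi>) (F n) (u n) (x n)" by blast
  have "nv (fps_nth (F (Suc n)) i - fps_nth (F n) i) \<le> nv \<pi>" if "i < d ^ n" for n i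
    using norm_apx_mod_pi[OF F(1) x_mem F(2)] F that by (intro coeff_cong_if_apx) (auto simp: Nm_x)
  note cong1 = this
  have cong: "nv (fps_nth (F m) i - fps_nth (F n) i) \<le> nv \<pi>" if "n \<le> m" "i < d ^ n" for m n i
    using that(1)
  proof (induct m rule: dec_induct)
    case (step m)
    have "d ^ n \<le> d ^ m" using step(1) d_ge_2 by (intro power_increasing) auto
    then have "nv (fps_nth (F (Suc m)) i - fps_nth (F m) i) \<le> nv \<pi>" using that by (intro cong1) simp
    then show ?case using step(3) by (rule nv_cong_trans)
  qed simp
  \<comment> \<open>The diagonal works because \<open>i < d ^ i\<close>: from \<open>F i\<close> on,
    the coefficient at \<open>i\<close> is constant modulo \<pi>.\<close>
  define f where "f = Abs_fps (\<lambda>i. fps_nth (F i) i)"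
  have f: "OK_fps f" using OK_fpsD(1,3)[OF F(1)] by (intro OK_fpsI) (auto simp: f_def)
  have "apx (nv \<pi>) f (u n) (x n)" for n
    unfolding apx_def
  proof (rule eventually_mono[OF F(2)[of n, unfolded apx_def]])
    fix N assume "nv (x n - (\<Sum>i<N. fps_nth (F n) i * u n ^ i)) \<le> nv \<pi>"
    moreover have "nv ((\<Sum>i<N. fps_nth (F n) i * u n ^ i) - (\<Sum>i<N. fps_nth f i * u n ^ i)) \<le> nv \<pi>"
      unfolding sum_subtractf[symmetric] left_diff_distrib[symmetric]
    proof (rule nv_sum_le)
      fix i
      show "nv ((fps_nth (F n) i - fps_nth f i) * u n ^ i) \<le> nv \<pi>"
      proof (cases "i < d ^ n")
        case True
        have "nv (fps_nth (F n) i - fps_nth f i) \<le> nv \<pi>"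
          using cong[of i n i] cong[of n i i] True less_d_power[of i]
          by (cases "i \<le> n") (auto simp: f_def nv_minus_commute)
        then show ?thesis by (rule nv_mult_le_right) (rule nv_power_le_1[OF nv_u_le_1])
      next
        case False
        \<comment> \<open>Here the coefficients are uncontrolled, but the power of
          \<open>u n\<close> is already small.\<close>
        then have "nv (u n ^ i) \<le> nv \<pi>"
          unfolding nv_u_power_d_power[of n, symmetric] nv_power
          using nv_u_le_1 by (intro power_decreasing) auto
        moreover have "nv (fps_nth (F n) i - fps_nth f i) \<le> 1"
          using OK_fpsD(3)[OF OK_fps_diff[OF F(1) f]] by (metis fps_sub_nth)
        ultimately show ?thesis by (rule nv_mult_le_left[rotated])
      qed
    qed simp
    ultimately show "nv (x n - (\<Sum>i<N. fps_nth f i * u n ^ i)) \<le> nv \<pi>" by (rule nv_cong_trans)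
  qed
  with f show ?thesis by blast
qed

text \<open>Apply the norm operator to the current series: by \<open>nv_Nm_improve\<close> its
  agreement with \<open>x\<close> at level \<open>n + 1\<close> improves by a factor \<pi> at level
  \<open>n\<close>, and the norms of \<open>x\<close> are again \<open>x\<close>.\<close>

lemma ex_coleman_mod_pi_power:
  "\<exists>f. OK_fps f \<and> (\<forall>n. apx (nv \<pi> ^ Suc k) f (u n) (x n))"
proof (induct k)
  case 0
  show ?case using ex_coleman_mod_pi by simp
next
  case (Suc k)
  then obtain f where f: "OK_fps f" "\<And>n. apx (nv \<pi> ^ Suc k) f (u n) (x n)" by blast
  let ?e = "nv \<pi> ^ Suc (Suc k)"
  obtain g where g: "OK_fps g"
    "\<And>n y. y \<in> Kn (Suc n) \<Longrightarrow> apx ?e f (u (Suc n)) y \<Longrightarrow> apx ?e g (u n) (step.Nm n y)"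
    using ex_norm_apx[OF f(1), of "Suc (Suc k)"] by blast
  have "apx ?e g (u n) (x n)" for n
  proof -
    \<comment> \<open>\<open>y\<close> is a value of \<open>f\<close> to the new precision, as
      \<open>g\<close> requires, while \<open>x (Suc n)\<close> matches it only to the old
      one.\<close>
    obtain y where y: "y \<in> Kn (Suc n)" "nv y \<le> 1" "apx ?e f (u (Suc n)) y"
      using ex_apx_Kn[OF f(1) nv_pi_power(1,2)] by blast
    have "apx (nv \<pi> ^ Suc k) f (u (Suc n)) y"
      by (rule apx_mono[OF y(3)]) (use nv_pi_power(3)[of "Suc k"] in simp)
    from apx_unique[OF f(2) this] have "nv (x (Suc n) - y) \<le> nv \<pi> ^ Suc k" .
    then have "nv (step.Nm n (x (Suc n)) - step.Nm n y) \<le> ?e"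
      using y by (intro step.nv_Nm_improve x_mem_L nv_x) (auto simp: Kn_Suc)
    then show ?thesis using apx_cong[OF g(2)[OF y(1,3)]] by (simp add: Nm_x)
  qed
  with g(1) show ?case by blast
qed

text \<open>Two approximating series agree at all \<open>u n\<close>, hence in their coefficients,
  to the lower of their precisions; the coefficients converge in the complete field
  \<open>K\<close>.\<close>

lemma ex_coleman: "\<exists>f. OK_fps f \<and> (\<forall>n. fps_evaluates_to nv f (u n) (x n))"
proof -
  have "\<forall>k. \<exists>f. OK_fps f \<and> (\<forall>n. apx (nv \<pi> ^ Suc k) f (u n) (x n))"
    using ex_coleman_mod_pi_power by blast
  from choice[OF this] obtain F where F: "\<And>k. OK_fps (F k)" "\<And>k n. apx (nv \<pi> ^ Suc k) (F k) (u n) (x n)" by blast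
  have small: "\<exists>k. nv \<pi> ^ k < e" if "0 < e" for e
    using real_arch_pow_inv[OF that nv_u0_less] .
  have dec: "nv \<pi> ^ m \<le> nv \<pi> ^ k" if "k \<le> m" for k m
    using that nv_u0_less by (intro power_decreasing) auto
  have cong1: "nv (fps_nth (F (Suc k)) i - fps_nth (F k) i) \<le> nv \<pi> ^ Suc k" for k i
  proof -
    have "apx (nv \<pi> ^ Suc k) (F (Suc k) - F k) (u n) 0" for n
      using apx_diff[OF apx_mono[OF F(2)[of "Suc k" n] dec[of "Suc k" "Suc (Suc k)"]] F(2)[of k n]] by simp
    from coeff_le_pi_power[OF OK_fps_diff[OF F(1) F(1)] this] show ?thesis by simp
  qed
  have cong: "nv (fps_nth (F m) i - fps_nth (F k) i) \<le> nv \<pi> ^ Suc k" if "k \<le> m" for m k i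
    using that
  proof (induct m rule: dec_induct)
    case (step m)
    have "nv (fps_nth (F (Suc m)) i - fps_nth (F m) i) \<le> nv \<pi> ^ Suc k"
      using cong1[of m i] dec[of "Suc k" "Suc m"] step by simp
    then show ?case using step(3) by (rule nv_cong_trans)
  qed simp
  have "\<exists>y\<in>K. (\<lambda>m. nv (fps_nth (F m) i - y)) \<longlonglongrightarrow> 0" for i
  proof (rule complete)
    fix e :: real assume "0 < e"
    then obtain k where k: "nv \<pi> ^ k < e" using small by blast
    have "nv (fps_nth (F m) i - fps_nth (F n) i) < e" if "k \<le> m" "k \<le> n" for m n
    proof -
      have "nv (fps_nth (F m) i - fps_nth (F n) i) \<le> nv \<pi> ^ Suc k"
        using cong[OF that(1)] nv_cong_sym[OF cong[OF that(2)]] by (rule nv_cong_trans)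
      then show ?thesis using k dec[of k "Suc k"] by simp
    qed
    then show "\<exists>N. \<forall>m\<ge>N. \<forall>n\<ge>N. nv (fps_nth (F m) i - fps_nth (F n) i) < e" by blast
  qed (rule OK_fpsD(1)[OF F(1)])
  then have "\<forall>i. \<exists>y. y \<in> K \<and> (\<lambda>m. nv (fps_nth (F m) i - y)) \<longlonglongrightarrow> 0" by blast
  from choice[OF this] obtain c where c: "\<And>i. c i \<in> K" "\<And>i. (\<lambda>m. nv (fps_nth (F m) i - c i)) \<longlonglongrightarrow> 0" by blast
  have lim: "nv (fps_nth (F k) i - c i) \<le> nv \<pi> ^ Suc k" for k i
  proof -
    have "\<forall>\<^sub>F m in sequentially. nv (fps_nth (F m) i - c i) < nv \<pi> ^ Suc k \<and> k \<le> m"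
      using order_tendstoD(2)[OF c(2) nv_pi_power(1)] eventually_ge_at_top[of k] by (rule eventually_conj)
    then obtain m where m: "nv (fps_nth (F m) i - c i) < nv \<pi> ^ Suc k" "k \<le> m"
      using eventually_happens'[OF sequentially_bot] by blast
    show ?thesis using nv_cong_sym[OF cong[OF m(2)]] less_imp_le[OF m(1)] by (rule nv_cong_trans)
  qed
  have "nv (c i) \<le> 1" for i
    using nv_cong_sym[OF lim[of 0 i]] nv_u0_less OK_fpsD(3)[OF F(1)] by (auto intro: nv_cong_le_1)
  then have OK: "OK_fps (Abs_fps c)" using c by (intro OK_fpsI) auto
  have "fps_evaluates_to nv (Abs_fps c) (u n) (x n)" for n
    unfolding fps_evaluates_to_iff
  proof (intro allI impI)
    fix e :: real assume "0 < e"
    then obtain k where k: "nv \<pi> ^ k < e" using small by blast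
    have "apx (nv \<pi> ^ Suc k) (Abs_fps c) (u n) (x n)"
      by (rule apx_fps_cong[OF F(2)]) (use lim nv_u_le_1 in auto)
    then show "apx e (Abs_fps c) (u n) (x n)"
      by (rule apx_mono) (use k dec[of k "Suc k"] in simp)
  qed
  with OK show ?thesis by blast
qed

lemma coleman_unique:
  assumes f: "OK_fps f" "\<And>n. fps_evaluates_to nv f (u n) (x n)"
    and g: "OK_fps g" "\<And>n. fps_evaluates_to nv g (u n) (x n)"
  shows "f = g"
proof (rule fps_ext)
  fix i
  have le: "nv (fps_nth f i - fps_nth g i) \<le> nv \<pi> ^ k" for k
  proof -
    have "apx (nv \<pi> ^ k) (f - g) (u n) 0" for n
      using apx_diff[OF fps_evaluates_to_imp_apx[OF f(2)[of n] nv_pi_power(1)[of k]]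
          fps_evaluates_to_imp_apx[OF g(2)[of n] nv_pi_power(1)[of k]]] by simp
    from coeff_le_pi_power[OF OK_fps_diff[OF f(1) g(1)] this] show ?thesis by simp
  qed
  have "\<not> 0 < nv (fps_nth f i - fps_nth g i)"
  proof
    assume "0 < nv (fps_nth f i - fps_nth g i)"
    then obtain k where "nv \<pi> ^ k < nv (fps_nth f i - fps_nth g i)"
      using real_arch_pow_inv[OF _ nv_u0_less] by blast
    then show False using le[of k] by simp
  qed
  then show "fps_nth f i = fps_nth g i" by simp
qed

lemma ex1_coleman: "\<exists>!f. OK_fps f \<and> (\<forall>n. fps_evaluates_to nv f (u n) (x n))"
  using ex_coleman coleman_unique by blast

end

end

section \<open>Residue fields and completeness\<close>

locale finite_residue_field = nonarch_abs nv + amb_subfield K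
  for nv :: "'a :: field \<Rightarrow> real" and K :: "'a set" +
  fixes p :: nat
  assumes prime_p: "prime p" and nv_p: "nv (of_nat p) < 1"
    and finite_residue: "finite (carrier (residue_field nv K))"
begin

abbreviation OK :: "'a ring"
  where "OK \<equiv> int_ring nv K"

abbreviation \<mm> :: "'a set"
  where "\<mm> \<equiv> max_ideal nv K"

abbreviation k :: "'a set ring"
  where "k \<equiv> residue_field nv K"

abbreviation res :: "'a \<Rightarrow> 'a set"
  where "res x \<equiv> \<mm> +>\<^bsub>OK\<^esub> x"

lemma int_ring_simps [simp]:
  "carrier OK = {x \<in> K. nv x \<le> 1}" "monoid.mult OK = (*)" "monoid.one OK = 1"
  "ring.zero OK = 0" "ring.add OK = (+)"
  by (simp_all add: int_ring_def)

lemma cring_int_ring: "cring OK"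
proof -
  interpret amb: field "amb :: 'a ring" by (rule amb_field)
  have "subring {x \<in> K. nv x \<le> 1} amb"
    by (rule amb.subringI) (auto intro: nv_add_le nv_mult_le_1)
  from amb.subcringI'[OF this] show ?thesis
    unfolding int_ring_def by (subst (asm) amb.subcring_iff) simp_all
qed

lemma ideal_max_ideal: "ideal \<mm> OK"
proof (rule idealI)
  show ring: "ring OK" using cring_int_ring by (rule cring.axioms)
  then have ag: "abelian_group OK" by (rule ring.is_abelian_group)
  have inv: "a_inv OK x = - x" if "x \<in> carrier OK" for x
    by (rule abelian_group.minus_equality[OF ag]) (use that in \<open>simp_all add: minus_mem\<close>)
  show "subgroup \<mm> (add_monoid OK)"
  proof (rule group.subgroupI[OF abelian_group.a_group[OF ag]])
    have "0 \<in> \<mm>" by (simp add: max_ideal_def)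
    then show "\<mm> \<noteq> {}" by blast
    show "\<mm> \<subseteq> carrier (add_monoid OK)" by (auto simp: max_ideal_def)
    fix x y assume x: "x \<in> \<mm>" and y: "y \<in> \<mm>"
    have "a_inv OK x = - x" using x by (intro inv) (auto simp: max_ideal_def)
    then have "inv\<^bsub>add_monoid OK\<^esub> x = - x" unfolding a_inv_def .
    moreover have "- x \<in> \<mm>" using x by (auto simp: max_ideal_def)
    ultimately show "inv\<^bsub>add_monoid OK\<^esub> x \<in> \<mm>" by (simp only:)
    show "x \<otimes>\<^bsub>add_monoid OK\<^esub> y \<in> \<mm>" using x y by (auto simp: max_ideal_def nv_add_less)
  qed
  fix y x assume y: "y \<in> \<mm>" and x: "x \<in> carrier OK"
  have "nv (x * y) \<le> nv y" using x by (intro nv_mult_le_left) auto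
  then have "x * y \<in> \<mm>" using x y by (auto simp: max_ideal_def)
  then show "x \<otimes>\<^bsub>OK\<^esub> y \<in> \<mm>" "y \<otimes>\<^bsub>OK\<^esub> x \<in> \<mm>" by (simp_all add: mult.commute)
qed

lemma mem_res_iff: "y \<in> res x \<longleftrightarrow> y - x \<in> \<mm>"
  by (auto simp: a_r_coset_def' intro: bexI[of _ "y - x"])

lemma res_eq_iff:
  assumes "x \<in> carrier OK" "y \<in> carrier OK"
  shows "res x = res y \<longleftrightarrow> nv (x - y) < 1"
proof
  assume "res x = res y"
  moreover have "x \<in> res x" unfolding mem_res_iff by (simp add: max_ideal_def)
  ultimately have "x - y \<in> \<mm>" using mem_res_iff[of x y] by simp
  then show "nv (x - y) < 1" by (simp add: max_ideal_def)
next
  assume less: "nv (x - y) < 1"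
  have "z - x \<in> \<mm> \<longleftrightarrow> z - y \<in> \<mm>" for z
    using nv_add_less[of "z - x" 1 "x - y"] nv_diff_less[of "z - y" 1 "x - y"] less assms
      add_mem[of "z - x" "x - y"] diff_mem[of "z - y" "x - y"]
    by (auto simp: max_ideal_def)
  then show "res x = res y" by (auto simp: mem_res_iff)
qed

sublocale k: cring k
  unfolding residue_field_def by (rule ideal.quotient_is_cring[OF ideal_max_ideal cring_int_ring])

lemma res_hom: "res \<in> Ring.ring_hom OK k"
  unfolding residue_field_def by (rule ideal.rcos_ring_hom[OF ideal_max_ideal])

lemma carrier_k: "carrier k = res ` carrier OK"
  by (auto simp: residue_field_def FactRing_def A_RCOSETS_def')

lemma res_closed: "x \<in> carrier OK \<Longrightarrow> res x \<in> carrier k"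
  by (auto simp: carrier_k)

lemma res_zero: "res 0 = \<zero>\<^bsub>k\<^esub>"
  using ring_hom_zero[OF res_hom] cring_int_ring k.ring_axioms by (simp add: cring_def)

lemma res_one: "res 1 = \<one>\<^bsub>k\<^esub>"
  using ring_hom_one[OF res_hom] by simp

lemma res_mult: "x \<in> carrier OK \<Longrightarrow> y \<in> carrier OK \<Longrightarrow> res (x * y) = res x \<otimes>\<^bsub>k\<^esub> res y"
  using ring_hom_mult[OF res_hom, of x y] by simp

lemma res_add: "x \<in> carrier OK \<Longrightarrow> y \<in> carrier OK \<Longrightarrow> res (x + y) = res x \<oplus>\<^bsub>k\<^esub> res y"
  using ring_hom_add[OF res_hom, of x y] by simp

lemma res_power: "x \<in> carrier OK \<Longrightarrow> res (x ^ n) = res x [^]\<^bsub>k\<^esub> n"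
proof (induct n)
  case (Suc n)
  then have "x ^ n \<in> carrier OK" by (auto intro: nv_power_le_1)
  then show ?case using Suc res_mult[of "x ^ n" x] by (simp add: mult.commute)
qed (simp add: res_one)

lemma res_of_nat_mult:
  "x \<in> carrier OK \<Longrightarrow> res (of_nat n * x) = res x [^]\<^bsub>add_monoid k\<^esub> n"
proof (induct n)
  case (Suc n)
  then have "of_nat n * x \<in> carrier OK" by (auto intro: nv_mult_le_1)
  then show ?case using Suc res_add[of "of_nat n * x" x] by (simp add: distrib_right add.commute)
qed (simp add: res_zero)

lemma res_eq_zero_iff: "x \<in> carrier OK \<Longrightarrow> res x = \<zero>\<^bsub>k\<^esub> \<longleftrightarrow> nv x < 1"
  using res_eq_iff[of x 0] by (simp add: res_zero)

lemma Units_k: "Units k = carrier k - {\<zero>\<^bsub>k\<^esub>}"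
proof
  have "\<one>\<^bsub>k\<^esub> \<noteq> \<zero>\<^bsub>k\<^esub>" using res_eq_zero_iff[of 1] by (simp add: res_one)
  then show "Units k \<subseteq> carrier k - {\<zero>\<^bsub>k\<^esub>}"
    unfolding Units_def using k.l_null by auto
  show "carrier k - {\<zero>\<^bsub>k\<^esub>} \<subseteq> Units k"
  proof
    fix z assume z: "z \<in> carrier k - {\<zero>\<^bsub>k\<^esub>}"
    then have "z \<in> res ` carrier OK" by (simp add: carrier_k)
    then obtain x where x: "z = res x" "x \<in> carrier OK" by blast
    with z have "\<not> nv x < 1" using res_eq_zero_iff[OF x(2)] by blast
    then have "nv x = 1" using x by simp
    moreover from this have "x \<noteq> 0" by auto
    ultimately have ix: "inverse x \<in> carrier OK" "x * inverse x = 1"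
      using x by (auto simp: nv_inverse)
    then have "res x \<otimes>\<^bsub>k\<^esub> res (inverse x) = \<one>\<^bsub>k\<^esub>"
      using res_mult[OF x(2) ix(1)] by (simp add: res_one)
    then show "z \<in> Units k"
      using x ix res_closed k.m_comm unfolding Units_def by (auto intro!: bexI[of _ "res (inverse x)"])
  qed
qed

text \<open>Lagrange's theorem in the unit group of the residue field, with the zero class treated
  apart.\<close>

lemma nv_power_card_cong:
  assumes c: "c \<in> K" "nv c \<le> 1"
  shows "nv (c ^ card (carrier k) - c) < 1"
proof -
  have pos: "0 < card (carrier k)" using finite_residue k.zero_closed card_gt_0_iff by blast
  have cO: "c \<in> carrier OK" using c by simp
  have "res c [^]\<^bsub>k\<^esub> card (carrier k) = res c"
  proof (cases "res c = \<zero>\<^bsub>k\<^esub>")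
    case True
    then show ?thesis using pos by (simp add: k.nat_pow_zero)
  next
    case False
    then have U: "res c \<in> Units k" using res_closed[OF cO] by (simp add: Units_k)
    have card: "card (carrier k) = Suc (card (Units k))"
      unfolding Units_k using finite_residue k.zero_closed pos by (simp add: card_Diff_singleton)
    have "res c [^]\<^bsub>k\<^esub> card (Units k) = \<one>\<^bsub>k\<^esub>"
      using k.units_power_order_eq_one[OF _ U] finite_residue by (simp add: Units_k)
    then show ?thesis unfolding card using res_closed[OF cO] by simp
  qed
  then have "res (c ^ card (carrier k)) = res c" using res_power[OF cO] by simp
  moreover have "c ^ card (carrier k) \<in> carrier OK" using c by (auto intro: nv_power_le_1)
  ultimately show ?thesis using res_eq_iff cO by blast
qed

text \<open>The additive group is killed by \<open>p\<close>, so no other prime can divide its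
  order; the exponent is positive because 0 and 1 have different residues.\<close>

lemma card_residue_field: "\<exists>r\<ge>1. card (carrier k) = p ^ r"
proof -
  let ?G = "add_monoid k" and ?q = "card (carrier k)"
  have pos: "0 < ?q" using finite_residue k.zero_closed card_gt_0_iff by blast
  have pz: "z [^]\<^bsub>?G\<^esub> p = \<one>\<^bsub>?G\<^esub>" if "z \<in> carrier ?G" for z
  proof -
    from that have "z \<in> res ` carrier OK" by (simp add: carrier_k)
    then obtain x where x: "z = res x" "x \<in> carrier OK" by blast
    have "nv (of_nat p * x) < 1"
      using nv_mult_le_right[of "of_nat p" "nv (of_nat p)" x] x nv_p by simp
    moreover have "of_nat p * x \<in> carrier OK" using x by (auto intro: nv_mult_le_1)
    ultimately have "res (of_nat p * x) = \<zero>\<^bsub>k\<^esub>" by (simp only: res_eq_zero_iff)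
    then show ?thesis using res_of_nat_mult[OF x(2), of p] x(1) by simp
  qed
  have only_p: "r = p" if r: "prime r" "r dvd ?q" for r
  proof (rule ccontr)
    assume "r \<noteq> p"
    \<comment> \<open>Sylow's theorem with exponent 1 plays the role of Cauchy's: it gives a
      subgroup of order \<open>r\<close>, whose nontrivial elements would have order dividing both
      \<open>r\<close> and \<open>p\<close>.\<close>
    obtain m where "?q = r ^ 1 * m" using r(2) by auto
    then have "Coset.order ?G = r ^ 1 * m" by (simp add: Coset.order_def)
    then obtain H where H: "subgroup H ?G" "card H = r ^ 1"
      using sylow_thm[OF r(1) k.a_group] finite_residue by fastforce
    have "card H \<noteq> 1" using H(2) r(1) prime_gt_1_nat[of r] by simp
    then have "H \<noteq> {\<one>\<^bsub>?G\<^esub>}" by auto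
    then obtain z where z: "z \<in> H" "z \<noteq> \<one>\<^bsub>?G\<^esub>"
      using subgroup.one_closed[OF H(1)] by blast
    have zG: "z \<in> carrier ?G" using z(1) subgroup.subset[OF H(1)] by blast
    interpret H: group "?G\<lparr>carrier := H\<rparr>" by (rule subgroup.subgroup_is_group[OF H(1) k.a_group])
    have "z [^]\<^bsub>?G\<lparr>carrier := H\<rparr>\<^esub> Coset.order (?G\<lparr>carrier := H\<rparr>) = \<one>\<^bsub>?G\<lparr>carrier := H\<rparr>\<^esub>"
      using H.pow_order_eq_1[of z] z(1) by simp
    then have "z [^]\<^bsub>?G\<lparr>carrier := H\<rparr>\<^esub> r = \<one>\<^bsub>?G\<^esub>"
      using H(2) by (simp add: Coset.order_def)
    then have "z [^]\<^bsub>?G\<^esub> r = \<one>\<^bsub>?G\<^esub>"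
      by (rule trans[OF monoid.nat_pow_consistent[OF group.is_monoid[OF k.a_group]]])
    then have "group.ord ?G z dvd r" "group.ord ?G z dvd p" using group.pow_eq_id[OF k.a_group zG] pz[OF zG] by auto
    moreover have "coprime r p" using primes_coprime[OF r(1) prime_p \<open>r \<noteq> p\<close>] .
    ultimately have "group.ord ?G z = 1" using coprime_common_divisor_nat by blast
    then show False using group.ord_eq_1[OF k.a_group zG] z(2) by simp
  qed
  have "?q = p ^ multiplicity p ?q"
  proof -
    have "prime_factors ?q \<subseteq> {p}" using only_p by (auto simp: prime_factors_dvd)
    then have "(\<Prod>r\<in>prime_factors ?q. r ^ multiplicity r ?q) = (\<Prod>r\<in>{p}. r ^ multiplicity r ?q)"
      by (intro prod.mono_neutral_left) (auto simp: prime_factors_multiplicity prime_p)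
    then show ?thesis using prime_factorization_nat[of ?q] pos by simp
  qed
  moreover have "multiplicity p ?q \<noteq> 0"
  proof
    assume "multiplicity p ?q = 0"
    then have "?q = 1" using calculation by simp
    then obtain z where "carrier k = {z}" using card_1_singletonE by blast
    then have "\<one>\<^bsub>k\<^esub> = \<zero>\<^bsub>k\<^esub>" using k.one_closed k.zero_closed by auto
    then show False using res_eq_zero_iff[of 1] by (simp add: res_one)
  qed
  ultimately show ?thesis by (metis less_one not_less)
qed

end

context nonarch_abs
begin

section \<open>Additivity of \<open>p\<close>-power maps modulo \<open>p\<close>\<close>

lemma nv_frobenius_prime:
  assumes p: "prime p" and x: "nv x \<le> 1" and y: "nv y \<le> 1"
  shows "nv ((x + y) ^ p - (x ^ p + y ^ p)) \<le> nv (of_nat p)"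
proof -
  have "(x + y) ^ p = (\<Sum>i\<le>p. of_nat (p choose i) * x ^ i * y ^ (p - i))"
    by (rule binomial_ring)
  also have "\<dots> = (\<Sum>i\<in>{..p} - {0, p}. of_nat (p choose i) * x ^ i * y ^ (p - i))
      + (\<Sum>i\<in>{0, p}. of_nat (p choose i) * x ^ i * y ^ (p - i))"
    by (rule sum.subset_diff) auto
  also have "(\<Sum>i\<in>{0, p}. of_nat (p choose i) * x ^ i * y ^ (p - i)) = x ^ p + y ^ p"
    using prime_gt_0_nat[OF p] by (simp add: add.commute)
  finally have eq: "(x + y) ^ p - (x ^ p + y ^ p) = (\<Sum>i\<in>{..p} - {0, p}. of_nat (p choose i) * x ^ i * y ^ (p - i))"
    by simp
  show ?thesis unfolding eq
  proof (rule nv_sum_le)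
    fix i assume "i \<in> {..p} - {0, p}"
    then have "p dvd (p choose i)" using p by (intro dvd_choose_prime) auto
    then obtain m where m: "p choose i = p * m" by blast
    have "nv (of_nat p * of_nat m * x ^ i * y ^ (p - i)) \<le> nv (of_nat p)"
      by (intro nv_mult_le_right) (auto intro: nv_power_le_1 x y)
    then show "nv (of_nat (p choose i) * x ^ i * y ^ (p - i)) \<le> nv (of_nat p)" by (simp add: m)
  qed simp
qed

lemma nv_frobenius:
  assumes p: "prime p" and x: "nv x \<le> 1" and y: "nv y \<le> 1"
  shows "nv ((x + y) ^ p ^ r - (x ^ p ^ r + y ^ p ^ r)) \<le> nv (of_nat p)"
proof (induct r)
  case (Suc r)
  have X: "nv (x ^ p ^ r) \<le> 1" "nv (y ^ p ^ r) \<le> 1" "nv ((x + y) ^ p ^ r) \<le> 1"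
    using x y by (auto intro!: nv_power_le_1 nv_add_le)
  have "nv (((x + y) ^ p ^ r) ^ p - (x ^ p ^ r + y ^ p ^ r) ^ p) \<le> nv (of_nat p)"
    by (rule nv_cong_power) (use Suc X nv_add_le in auto)
  moreover have "nv ((x ^ p ^ r + y ^ p ^ r) ^ p - ((x ^ p ^ r) ^ p + (y ^ p ^ r) ^ p)) \<le> nv (of_nat p)"
    by (rule nv_frobenius_prime[OF p X(1,2)])
  ultimately have "nv (((x + y) ^ p ^ r) ^ p - ((x ^ p ^ r) ^ p + (y ^ p ^ r) ^ p)) \<le> nv (of_nat p)"
    by (rule nv_cong_trans)
  then show ?case by (simp add: power_mult[symmetric] mult.commute)
qed simp

section \<open>Completeness of finite-dimensional spaces\<close>

definition nv_cauchy :: "(nat \<Rightarrow> 'a) \<Rightarrow> bool"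
  where "nv_cauchy s \<longleftrightarrow> (\<forall>e>0. \<exists>N. \<forall>m\<ge>N. \<forall>n\<ge>N. nv (s m - s n) < e)"

definition nv_complete :: "'a set \<Rightarrow> bool"
  where "nv_complete E \<longleftrightarrow> (\<forall>s. (\<forall>n. s n \<in> E) \<and> nv_cauchy s \<longrightarrow> (\<exists>y\<in>E. (\<lambda>n. nv (s n - y)) \<longlonglongrightarrow> 0))"

lemma nv_tendsto_imp_small:
  "(\<lambda>n. nv (s n - y)) \<longlonglongrightarrow> 0 \<Longrightarrow> 0 < e \<Longrightarrow> \<exists>N. \<forall>n\<ge>N. nv (s n - y) < e"
  using order_tendstoD(2)[of "\<lambda>n. nv (s n - y)" 0 sequentially e] by (simp add: eventually_sequentially)

lemma nv_cauchy_if_tendsto: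
  assumes "(\<lambda>n. nv (s n - y)) \<longlonglongrightarrow> 0"
  shows "nv_cauchy s"
  unfolding nv_cauchy_def
proof (intro allI impI)
  fix e :: real assume "0 < e"
  then obtain N where N: "\<And>n. n \<ge> N \<Longrightarrow> nv (s n - y) < e" using nv_tendsto_imp_small[OF assms] by blast
  have "nv (s m - s n) < e" if "m \<ge> N" "n \<ge> N" for m n
    using nv_diff_less[OF N[OF that(1)] N[OF that(2)]] by simp
  then show "\<exists>N. \<forall>m\<ge>N. \<forall>n\<ge>N. nv (s m - s n) < e" by blast
qed

lemma nv_tendsto_unique:
  assumes "(\<lambda>n. nv (s n - y)) \<longlonglongrightarrow> 0" "(\<lambda>n. nv (s n - z)) \<longlonglongrightarrow> 0"
  shows "y = z"
proof (rule ccontr)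
  assume "y \<noteq> z"
  then have e: "0 < nv (y - z)" by simp
  obtain N M where N: "\<And>n. n \<ge> N \<Longrightarrow> nv (s n - y) < nv (y - z)"
    and M: "\<And>n. n \<ge> M \<Longrightarrow> nv (s n - z) < nv (y - z)"
    using nv_tendsto_imp_small[OF assms(1) e] nv_tendsto_imp_small[OF assms(2) e] by blast
  have "nv (s (max N M) - z - (s (max N M) - y)) < nv (y - z)"
    by (rule nv_diff_less[OF M N]) auto
  then show False by simp
qed

lemma nv_tendsto_add:
  assumes "(\<lambda>n. nv (s n - y)) \<longlonglongrightarrow> 0" "(\<lambda>n. nv (r n - z)) \<longlonglongrightarrow> 0"
  shows "(\<lambda>n. nv (s n + r n - (y + z))) \<longlonglongrightarrow> 0"
proof (rule tendsto_sandwich[where f = "\<lambda>_. 0"])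
  show "\<forall>\<^sub>F n in sequentially. nv (s n + r n - (y + z)) \<le> nv (s n - y) + nv (r n - z)"
  proof (intro always_eventually allI)
    fix n
    have "nv ((s n - y) + (r n - z)) \<le> nv (s n - y) + nv (r n - z)"
      using nv_add_le_max[of "s n - y" "r n - z"] nv_nonneg[of "s n - y"] nv_nonneg[of "r n - z"]
      by linarith
    then show "nv (s n + r n - (y + z)) \<le> nv (s n - y) + nv (r n - z)" by (simp add: algebra_simps)
  qed
  show "(\<lambda>n. nv (s n - y) + nv (r n - z)) \<longlonglongrightarrow> 0" using tendsto_add[OF assms] by simp
qed auto

lemma nv_tendsto_mult_const:
  assumes "(\<lambda>n. nv (s n - y)) \<longlonglongrightarrow> 0"
  shows "(\<lambda>n. nv (s n * c - y * c)) \<longlonglongrightarrow> 0"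
  using tendsto_mult_right[OF assms, of "nv c"] by (simp add: left_diff_distrib[symmetric] nv_mult)

lemma nv_cauchy_diff: "nv_cauchy s \<Longrightarrow> nv_cauchy r \<Longrightarrow> nv_cauchy (\<lambda>n. s n - r n)"
  unfolding nv_cauchy_def
proof (intro allI impI)
  fix e :: real
  assume *: "\<forall>e>0. \<exists>N. \<forall>m\<ge>N. \<forall>n\<ge>N. nv (s m - s n) < e" "\<forall>e>0. \<exists>N. \<forall>m\<ge>N. \<forall>n\<ge>N. nv (r m - r n) < e"
    and "0 < e"
  then obtain N M where N: "\<And>m n. m \<ge> N \<Longrightarrow> n \<ge> N \<Longrightarrow> nv (s m - s n) < e"
    and M: "\<And>m n. m \<ge> M \<Longrightarrow> n \<ge> M \<Longrightarrow> nv (r m - r n) < e" by meson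
  have "nv (s m - r m - (s n - r n)) < e" if "m \<ge> max N M" "n \<ge> max N M" for m n
    using nv_diff_less[OF N[of m n] M[of m n]] that by (simp add: algebra_simps)
  then show "\<exists>N. \<forall>m\<ge>N. \<forall>n\<ge>N. nv (s m - r m - (s n - r n)) < e" by blast
qed

text \<open>A vector outside the complete subspace \<open>E\<close> has positive distance from it, so the coefficients
  along that vector of a Cauchy sequence form a Cauchy sequence.\<close>

lemma nv_complete_line:
  assumes F: "amb_subfield F" "nv_complete F"
    and E: "nv_complete E" "0 \<in> E" "\<And>x y. x \<in> E \<Longrightarrow> y \<in> E \<Longrightarrow> x + y \<in> E" "\<And>c x. c \<in> F \<Longrightarrow> x \<in> E \<Longrightarrow> c * x \<in> E"
    and v: "v \<notin> E"
  shows "nv_complete {c * v + w | c w. c \<in> F \<and> w \<in> E}"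
proof -
  interpret F: amb_subfield F by fact
  \<comment> \<open>Otherwise points of \<open>E\<close> would converge to \<open>v\<close>, and
    completeness would put \<open>v\<close> into \<open>E\<close>.\<close>
  have "\<exists>\<delta>>0. \<forall>w\<in>E. \<delta> \<le> nv (w - v)"
  proof (rule ccontr)
    assume "\<not> ?thesis"
    then have "\<forall>n. \<exists>w. w \<in> E \<and> nv (w - v) < 1 / real (Suc n)"
      by (meson not_le of_nat_0_less_iff zero_less_Suc zero_less_divide_1_iff)
    from choice[OF this] obtain w where w: "\<And>n. w n \<in> E" "\<And>n. nv (w n - v) < 1 / real (Suc n)" by blast
    have "(\<lambda>n. nv (w n - v)) \<longlonglongrightarrow> 0"
    proof (rule tendsto_sandwich[where f = "\<lambda>_. 0"])
      show "\<forall>\<^sub>F n in sequentially. nv (w n - v) \<le> 1 / real (Suc n)"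
        using w(2) less_imp_le by (intro always_eventually) blast
      show "(\<lambda>n. 1 / real (Suc n)) \<longlonglongrightarrow> 0" using LIMSEQ_inverse_real_of_nat by (simp add: inverse_eq_divide)
    qed auto
    moreover from this obtain y where "y \<in> E" "(\<lambda>n. nv (w n - y)) \<longlonglongrightarrow> 0"
      using E(1) w(1) nv_cauchy_if_tendsto unfolding nv_complete_def by blast
    ultimately show False using nv_tendsto_unique v by blast
  qed
  then obtain \<delta> where \<delta>: "0 < \<delta>" "\<And>w. w \<in> E \<Longrightarrow> \<delta> \<le> nv (w - v)" by blast
  \<comment> \<open>Scaling: \<open>E\<close> is stable under \<open>- inverse c\<close>, so the
    distance from \<open>v\<close> to \<open>E\<close> is multiplied by \<open>nv c\<close>.\<close>
  have dist: "nv c * \<delta> \<le> nv (c * v + w)" if "c \<in> F" "w \<in> E" for c w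
  proof (cases "c = 0")
    case False
    have "\<delta> \<le> nv ((- inverse c) * w - v)" using that by (intro \<delta> E) auto
    then have "nv c * \<delta> \<le> nv (c * ((- inverse c) * w - v))" by (simp add: nv_mult mult_left_mono)
    also have "c * ((- inverse c) * w - v) = - (c * v + w)" using False by (simp add: algebra_simps)
    finally show ?thesis by (simp only: nv_minus)
  qed simp
  show ?thesis unfolding nv_complete_def
  proof (intro allI impI, elim conjE)
    fix s assume "\<forall>n. s n \<in> {c * v + w | c w. c \<in> F \<and> w \<in> E}" and s: "nv_cauchy s"
    then have "\<forall>n. \<exists>cw. fst cw \<in> F \<and> snd cw \<in> E \<and> s n = fst cw * v + snd cw" by fastforce
    from choice[OF this] obtain cw where cw: "\<And>n. fst (cw n) \<in> F \<and> snd (cw n) \<in> E \<and> s n = fst (cw n) * v + snd (cw n)" by blast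
    define c where "c n = fst (cw n)" for n
    define w where "w n = snd (cw n)" for n
    have c: "\<And>n. c n \<in> F" and w: "\<And>n. w n \<in> E" and s_eq: "\<And>n. s n = c n * v + w n"
      using cw by (auto simp: c_def w_def)
    have "nv_cauchy c" unfolding nv_cauchy_def
    proof (intro allI impI)
      fix e :: real assume "0 < e"
      then have "0 < e * \<delta>" using \<delta> by simp
      then obtain N where N: "\<And>m n. m \<ge> N \<Longrightarrow> n \<ge> N \<Longrightarrow> nv (s m - s n) < e * \<delta>"
        using s unfolding nv_cauchy_def by meson
      have "nv (c m - c n) < e" if "m \<ge> N" "n \<ge> N" for m n
      proof -
        have "w m - w n = w m + (- 1) * w n" by simp
        then have "w m - w n \<in> E" using E(3)[OF w E(4)[OF F.minus_mem[OF F.one_mem] w]] by simp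
        then have "nv (c m - c n) * \<delta> \<le> nv ((c m - c n) * v + (w m - w n))" using c by (intro dist) auto
        also have "\<dots> < e * \<delta>" using N[OF that] by (simp add: s_eq algebra_simps)
        finally show ?thesis using \<delta> by simp
      qed
      then show "\<exists>N. \<forall>m\<ge>N. \<forall>n\<ge>N. nv (c m - c n) < e" by blast
    qed
    then obtain c' where c': "c' \<in> F" "(\<lambda>n. nv (c n - c')) \<longlonglongrightarrow> 0"
      using F(2) c unfolding nv_complete_def by blast
    have cv: "(\<lambda>n. nv (c n * v - c' * v)) \<longlonglongrightarrow> 0" by (rule nv_tendsto_mult_const[OF c'(2)])
    have "nv_cauchy (\<lambda>n. s n - c n * v)" by (rule nv_cauchy_diff[OF s nv_cauchy_if_tendsto[OF cv]])
    then have "nv_cauchy w" by (simp add: s_eq)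
    then obtain w' where w': "w' \<in> E" "(\<lambda>n. nv (w n - w')) \<longlonglongrightarrow> 0"
      using E(1) w unfolding nv_complete_def by blast
    have "(\<lambda>n. nv (s n - (c' * v + w'))) \<longlonglongrightarrow> 0"
      unfolding s_eq by (rule nv_tendsto_add[OF cv w'(2)])
    then show "\<exists>y\<in>{c * v + w | c w. c \<in> F \<and> w \<in> E}. (\<lambda>n. nv (s n - y)) \<longlonglongrightarrow> 0"
      using c'(1) w'(1) by blast
  qed
qed

text \<open>\<open>dimension\<close> is defined by adding one line at a time, and
  \<open>nv_complete_line\<close> handles one such step.\<close>

lemma nv_complete_finite_dimension:
  assumes F: "subfield F amb" "nv_complete F" and dim: "ring.dimension amb n F E"
  shows "nv_complete E"
proof -
  interpret amb: field "amb :: 'a ring" by (rule amb_field)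
  show ?thesis using dim F
  proof (induct n F E rule: amb.dimension.induct[consumes 1])
    case (zero_dim F)
    have "s = (\<lambda>_. 0)" if "\<forall>n. s n \<in> {0}" for s :: "nat \<Rightarrow> 'a" using that by auto
    then have "(\<lambda>n. nv (s n - 0)) \<longlonglongrightarrow> 0" if "\<forall>n. s n \<in> {0}" for s using that by auto
    then show ?case by (auto simp: nv_complete_def)
  next
    case (Suc_dim v E n F)
    note E = amb.space_subgroup_props[OF Suc_dim(5,3), simplified]
    have "amb.line_extension F v E = {c * v + w | c w. c \<in> F \<and> w \<in> E}"
      by (rule Set.set_eqI) (simp add: amb.line_extension_mem_iff, blast)
    moreover have "nv_complete {c * v + w | c w. c \<in> F \<and> w \<in> E}"
      using Suc_dim E by (intro nv_complete_line) (auto simp: amb_subfield_def)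
    ultimately show ?case by simp
  qed
qed

end

theorem theorem3p1:
  fixes p q d h :: nat
    and nv :: "'a :: {field_char_0, alg_closed_field} \<Rightarrow> real"
    and K :: "'a set"
    and a u x :: "nat \<Rightarrow> 'a"
    and P :: "'a poly"
    and Kn :: "nat \<Rightarrow> 'a set"
  assumes "padic_alg_closure p nv"
    and "p \<noteq> 2"
    and "finite_ext (Qp nv) K"
    and "q = card (carrier (residue_field nv K))"
    and "h \<ge> 1"
    and "d = q ^ h"
    and "\<And>i. 1 \<le> i \<Longrightarrow> i \<le> d - 1 \<Longrightarrow> a i \<in> max_ideal nv K"
    and "P = monom 1 d + (\<Sum>i=1..d-1. monom (a i) i)"
    and "uniformizer nv K (u 0)"
    and "\<And>n. poly P (u (Suc n)) = u n"
    and "\<And>n. Kn n = adjoin K (u n)"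
    and "\<And>n. x n \<in> carrier (int_ring nv (Kn n))"
    and "\<And>n. field_norm (Kn n) (Kn (Suc n)) (x (Suc n)) = x n"
  shows "\<exists>!Col :: 'a fps. (\<forall>i. fps_nth Col i \<in> carrier (int_ring nv K)) \<and>
           (\<forall>n. fps_evaluates_to nv Col (u n) (x n))"
proof -
  interpret Q: padic_alg_closure p nv by fact
  interpret nonarch_abs nv
    by (rule nonarch_abs.intro) (fact Q.nv_nonneg Q.nv_eq_0_iff Q.nv_mult Q.nv_add_le_max)+
  have Qp: "subfield (Qp nv) amb" "subfield K amb" "Qp nv \<subseteq> K" "ring.finite_dimension amb (Qp nv) K"
    using assms(3) by (auto simp: finite_ext_def)
  interpret amb_subfield K by (rule amb_subfield.intro) (rule Qp)
  have p_gt_1: "1 < real p" using prime_gt_1_nat[OF Q.prime_p] by simp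
  have nv_p: "nv (of_nat p) = 1 / real p"
    using Q.nv_of_int[of "int p"] Q.prime_p by (simp add: multiplicity_self)
  have int_carrier: "carrier (int_ring nv E) = {y \<in> E. nv y \<le> 1}" for E
    by (simp add: int_ring_def)
  have u0: "u 0 \<in> K" "nv (u 0) \<le> 1" and max: "{y * u 0 |y. y \<in> K \<and> nv y \<le> 1} = max_ideal nv K"
    using assms(9) by (simp_all add: uniformizer_def int_ring_def cgenideal_def)
  \<comment> \<open>The generator lies in the ideal it generates, hence in the maximal
    ideal.\<close>
  have "1 * u 0 \<in> {y * u 0 |y. y \<in> K \<and> nv y \<le> 1}" using one_mem nv_1 by (metis (mono_tags, lifting) mem_Collect_eq order_refl)
  then have nv_u0_less: "nv (u 0) < 1" unfolding max by (simp add: max_ideal_def)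
  have discrete: "nv y \<le> nv (u 0)" if "y \<in> K" "nv y < 1" for y
  proof -
    have "y \<in> {y * u 0 |y. y \<in> K \<and> nv y \<le> 1}" unfolding max using that by (simp add: max_ideal_def)
    then obtain z where "y = z * u 0" "nv z \<le> 1" by blast
    then show ?thesis by (simp add: nv_mult_le_left)
  qed
  \<comment> \<open>\<open>p\<close> is a nonzero element of the maximal ideal; this also shows that
    \<open>u 0\<close> is nonzero.\<close>
  have nv_p_le: "nv (of_nat p) \<le> nv (u 0)"
    using p_gt_1 nv_p by (intro discrete) auto
  moreover have "0 < nv (of_nat p)" using p_gt_1 unfolding nv_p by simp
  ultimately have nv_u0_pos: "0 < nv (u 0)" by linarith
  have q0: "q \<noteq> 0"
  proof
    \<comment> \<open>An infinite residue field would have cardinality 0, hence \<open>d = 0\<close> and \<open>P = 1\<close>.\<close>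
    assume "q = 0"
    then have "d = 0" using assms(5,6) by (simp add: power_0_left)
    then have "P = monom 1 0" using assms(8) by simp
    then have "u 0 = 1" using assms(10)[of 0] by (simp add: poly_monom)
    then show False using nv_u0_less by simp
  qed
  then have "finite (carrier (residue_field nv K))" using assms(4) by (simp add: card_gt_0_iff)
  then interpret R: finite_residue_field nv K p
    by unfold_locales (use Q.prime_p p_gt_1 nv_p in auto)
  obtain r where r: "1 \<le> r" "q = p ^ r" using R.card_residue_field assms(4) by blast
  have d: "d = p ^ (r * h)" by (simp add: assms(6) r power_mult)
  have rh: "1 \<le> r * h" using r assms(5) by simp
  have d_eq: "d = p * p ^ (r * h - 1)" using rh unfolding d by (simp add: power_Suc[symmetric] del: power_Suc)
  have d_ge_2: "2 \<le> d"
    using rh prime_ge_2_nat[OF Q.prime_p] power_increasing[of 1 "r * h" p] unfolding d by simp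
  have nv_d: "nv (of_nat d) \<le> nv (u 0)"
    unfolding d_eq of_nat_mult by (intro nv_mult_le_right nv_p_le nv_of_nat_le_1)
  have a: "a i \<in> K" "nv (a i) \<le> nv (u 0)" if "1 \<le> i" "i < d" for i
    using assms(7)[of i] that discrete by (auto simp: max_ideal_def)
  have interval: "{1..d - 1} = {1..<d}" using d_ge_2 by auto
  have root: "u (Suc n) ^ d = u n - (\<Sum>i=1..<d. a i * u (Suc n) ^ i)" for n
    using assms(10)[of n] unfolding assms(8) interval by (simp add: poly_sum poly_monom algebra_simps)
  \<comment> \<open>Since \<open>d\<close> is a power of \<open>q\<close>, the congruence for the
    power \<open>q\<close> is iterated; discreteness turns "smaller than 1" into divisibility by
    \<open>u 0\<close>.\<close>
  have frobenius_K: "nv (c ^ d - c) \<le> nv (u 0)" if c: "c \<in> K" "nv c \<le> 1" for c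
  proof (rule discrete)
    show "c ^ d - c \<in> K" using c by auto
    have "nv (c ^ q ^ j - c) < 1" for j
    proof (induct j)
      case (Suc j)
      have "nv ((c ^ q ^ j) ^ q - c ^ q ^ j) < 1"
        using R.nv_power_card_cong[of "c ^ q ^ j"] c assms(4) by (auto intro: nv_power_le_1)
      from nv_add_less[OF this Suc] show ?case by (simp add: power_mult[symmetric] mult.commute)
    qed simp
    then show "nv (c ^ d - c) < 1" unfolding assms(6) .
  qed
  \<comment> \<open>Completeness is assumed for \<open>Qp nv\<close>; \<open>K\<close> inherits it
    as a finite-dimensional space.\<close>
  have "nv_complete (Qp nv)"
    unfolding nv_complete_def nv_cauchy_def using Q.Qp_complete by blast
  moreover obtain n where "ring.dimension amb n (Qp nv) K"
    using Qp(4) field.is_ring[OF amb_field] ring.finite_dimension_def by blast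
  ultimately have K_complete: "nv_complete K" using nv_complete_finite_dimension Qp(1) by blast
  interpret coleman_tower nv K a u d
  proof unfold_locales
    show "nv ((y + z) ^ d - (y ^ d + z ^ d)) \<le> nv (u 0)" if "nv y \<le> 1" "nv z \<le> 1" for y z
      using nv_frobenius[OF Q.prime_p that, of "r * h"] nv_p_le unfolding d by simp
    show "\<exists>y\<in>K. (\<lambda>n. nv (s n - y)) \<longlonglongrightarrow> 0"
      if "\<And>n. s n \<in> K" "\<And>e. e > 0 \<Longrightarrow> \<exists>N. \<forall>m\<ge>N. \<forall>n\<ge>N. nv (s m - s n) < e" for s
      using K_complete that unfolding nv_complete_def nv_cauchy_def by blast
  qed (fact u0 nv_u0_pos nv_u0_less discrete d_ge_2 nv_d a root frobenius_K)+
  have "\<exists>!f. OK_fps f \<and> (\<forall>n. fps_evaluates_to nv f (u n) (x n))"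
    using assms(11-13) by (intro ex1_coleman) (auto simp: int_carrier)
  then show ?thesis by (simp add: OK_fps_def int_fps_def int_carrier all_conj_distrib)
qed

end
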